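(* Let $X=\{X_n\}_{n\ge 0}$ be a centered Gaussian sequence as described in the context, with $E[X_n^2]\to f$ as $n\to\infty$. Assume that there are a symmetric positive function $\rho:\mathbb{R}\to\mathbb{R}$ with $\rho(0)=1$ and a positive constant $C_0$ such that $|E[X_tX_s]|\le C_0\,\rho(|t-s|)$ for all indices $s,t$. (1) If for some $\beta\ge\frac12$ we have $\rho(t)=O(|t|^{-\beta})$ for large $|t|$, then there is a constant $C>0$ not depending on $n$ such that for all $n>1$ $$d_W\left(\sqrt{\tfrac{n}{v_n}}\,(\hat f_n(X)-f),N\right)\le\sqrt{\tfrac n{v_n}}\,|A_n(X)-f|+\frac{C}{v_n^2\wedge v_n^{3/2}}\begin{cases}1 & \text{if }\beta=\frac12,\\ n^{\frac32-3\beta} & \text{if }\beta\in(\frac12,\frac23),\\ n^{-1/2}\log(n)^2 & \text{if }\beta=\frac23,\\ n^{-1/2} & \text{if }\beta>\frac23.\end{cases}$$ (2) If in addition $v_n\to\sigma^2>0$ as $n\to\infty$, then (for $\beta>\frac12$) there is a constant $C>0$ not depending on $n$ such that for all $n>1$ $$d_W\left(\tfrac{\sqrt n}{\sigma}(\hat f_n(X)-f),N\right)\le C\left(\sqrt n\,|A_n(X)-f|+|v_n-\sigma^2|\right)+C\begin{cases} n^{\frac32-3\beta} & \text{if }\beta\in(\frac12,\frac23),\\ n^{-1/2}\log(n)^2 & \text{if }\beta=\frac23,\\ n^{-1/2} & \text{if }\beta>\frac23.\end{cases}$$ (3) In particular, if $v_n\to\sigma^2>0$, $\sqrt n\,|A_n(X)-f|\to0$,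 and $\rho(t)=O(|t|^{-\beta})$ for large $|t|$ for some $\beta>1/2$, then as $n\to\infty$ $$\sqrt n\,(\hat f_n(X)-f)\xrightarrow{\text{law}}\mathcal N(0,\sigma^2).$$
   Context: $G=\{G_t\}_{t\ge0}$ is an underlying Gaussian process with associated Hilbert space $\mathcal{H}$, and $X=\{X_n\}_{n\ge0}$ is a mean-zero Gaussian sequence of the form $X_n=I_1(h_n)$ with $h_n\in\mathcal{H}$, where $I_1$ is the Wiener integral with respect to $G$ (so the $X_n$ are jointly Gaussian and centered). No stationarity is assumed. For $n\ge1$ set $$A_n(X):=\frac1n\sum_{i=1}^nE[X_i^2],\quad V_n(X):=\frac1{\sqrt n}\sum_{i=1}^n\left(X_i^2-E[X_i^2]\right),\quad v_n:=E[V_n(X)^2],\quad \hat f_n(X):=\frac1n\sum_{i=1}^nX_i^2,$$ where $v_n>0$ whenever one divides by it. $\sigma>0$ is the positive root of $\sigma^2$. $N\sim\mathcal N(0,1)$; $d_W(Y,Z)=\sup_f|Ef(Y)-Ef(Z)|$, the supremum being over all $f:\mathbb R\to\mathbb R$ that are Lipschitz with constant $\le1$; $a\wedge b=\min(a,b)$. *)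

theory Defs
  imports "HOL-Probability.Probability"
begin

text \<open>The point mass at \<open>0\<close> counts as a centered Gaussian law (variance \<open>0\<close>).\<close>

definition centered_gaussian :: "'w measure \<Rightarrow> ('w \<Rightarrow> real) \<Rightarrow> bool" where
  "centered_gaussian M Y \<longleftrightarrow> Y \<in> borel_measurable M \<and>
     ((AE \<omega> in M. Y \<omega> = 0) \<or> (\<exists>s>0. distributed M lborel Y (normal_density 0 s)))"

definition centered_gaussian_process ::
    "'w measure \<Rightarrow> 'i set \<Rightarrow> ('i \<Rightarrow> 'w \<Rightarrow> real) \<Rightarrow> bool" where
  "centered_gaussian_process M T G \<longleftrightarrow>
     (\<forall>F c. finite F \<and> F \<subseteq> T \<longrightarrow> centered_gaussian M (\<lambda>\<omega>. \<Sum>t\<in>F. c t * G t \<omega>))"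

text \<open>The Hilbert space associated with \<open>G\<close> is the completion of the step functions on
  \<open>[0, \<infinity>)\<close> with respect to the inner product that gives the indicators of \<open>[0, s]\<close> and
  \<open>[0, t]\<close> the value \<open>E[G\<^sub>s G\<^sub>t]\<close>. It is described up to isometry: \<open>'h\<close> is a Hilbert space
  and \<open>e t\<close> is the element represented by the indicator of \<open>[0, t]\<close>.\<close>

definition associated_hilbert_space ::
    "'w measure \<Rightarrow> (real \<Rightarrow> 'w \<Rightarrow> real) \<Rightarrow> (real \<Rightarrow> 'h :: {real_inner, complete_space}) \<Rightarrow> bool" where
  "associated_hilbert_space M G e \<longleftrightarrow>
     (\<forall>s\<ge>0. \<forall>t\<ge>0. e s \<bullet> e t = (\<integral>\<omega>. G s \<omega> * G t \<omega> \<partial>M)) \<and>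
     closure (span (e ` {0..})) = UNIV"

text \<open>\<open>I\<close> is a version of the linear isometry into \<open>L\<^sup>2(M)\<close> that sends \<open>e t\<close> to \<open>G t\<close>.\<close>

definition wiener_integral ::
    "'w measure \<Rightarrow> (real \<Rightarrow> 'w \<Rightarrow> real) \<Rightarrow> (real \<Rightarrow> 'h :: {real_inner, complete_space}) \<Rightarrow>
     ('h \<Rightarrow> 'w \<Rightarrow> real) \<Rightarrow> bool" where
  "wiener_integral M G e I \<longleftrightarrow>
     (\<forall>h. I h \<in> borel_measurable M \<and> integrable M (\<lambda>\<omega>. (I h \<omega>)\<^sup>2)) \<and>
     (\<forall>a b g h. AE \<omega> in M. I (a *\<^sub>R g + b *\<^sub>R h) \<omega> = a * I g \<omega> + b * I h \<omega>) \<and>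
     (\<forall>g h. (\<integral>\<omega>. I g \<omega> * I h \<omega> \<partial>M) = g \<bullet> h) \<and>
     (\<forall>t\<ge>0. AE \<omega> in M. I (e t) \<omega> = G t \<omega>)"

definition mean_A :: "'w measure \<Rightarrow> (nat \<Rightarrow> 'w \<Rightarrow> real) \<Rightarrow> nat \<Rightarrow> real" where
  "mean_A M X n = (1 / real n) * (\<Sum>i=1..n. \<integral>\<omega>. (X i \<omega>)\<^sup>2 \<partial>M)"

definition fluct_V :: "'w measure \<Rightarrow> (nat \<Rightarrow> 'w \<Rightarrow> real) \<Rightarrow> nat \<Rightarrow> 'w \<Rightarrow> real" where
  "fluct_V M X n \<omega> =
     (1 / sqrt (real n)) * (\<Sum>i=1..n. (X i \<omega>)\<^sup>2 - (\<integral>\<omega>'. (X i \<omega>')\<^sup>2 \<partial>M))"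

definition var_v :: "'w measure \<Rightarrow> (nat \<Rightarrow> 'w \<Rightarrow> real) \<Rightarrow> nat \<Rightarrow> real" where
  "var_v M X n = (\<integral>\<omega>. (fluct_V M X n \<omega>)\<^sup>2 \<partial>M)"

definition f_hat :: "(nat \<Rightarrow> 'w \<Rightarrow> real) \<Rightarrow> nat \<Rightarrow> 'w \<Rightarrow> real" where
  "f_hat X n \<omega> = (1 / real n) * (\<Sum>i=1..n. (X i \<omega>)\<^sup>2)"

text \<open>Wasserstein distance of two laws on the line with finite first moment. The value is an
  extended real, since a supremum over an unbounded set of reals would be unspecified.\<close>

definition wasserstein :: "real measure \<Rightarrow> real measure \<Rightarrow> ereal" where
  "wasserstein \<mu> \<nu> =
     (SUP f \<in> {f :: real \<Rightarrow> real. 1-lipschitz_on UNIV f}.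
        ereal \<bar>(\<integral>x. f x \<partial>\<mu>) - (\<integral>x. f x \<partial>\<nu>)\<bar>)"

text \<open>Only used for \<open>\<beta> \<ge> 1/2\<close>.\<close>

definition rate :: "real \<Rightarrow> nat \<Rightarrow> real" where
  "rate \<beta> n =
     (if \<beta> = 1/2 then 1
      else if \<beta> < 2/3 then real n powr (3/2 - 3 * \<beta>)
      else if \<beta> = 2/3 then real n powr (-1/2) * (ln (real n))\<^sup>2
      else real n powr (-1/2))"

end

theory Submission
  imports Defs
begin

text \<open>Let \<open>R\<close> be the covariance matrix of \<open>X\<^sub>1, \<dots>, X\<^sub>n\<close>. In an orthonormal basis that
  diagonalizes \<open>R\<close>, the sum of the \<open>X\<^sub>i\<^sup>2 - E[X\<^sub>i\<^sup>2]\<close> becomes the sum of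
  \<open>\<lambda>\<^sub>k (Z\<^sub>k\<^sup>2 - 1)\<close> with \<open>Z\<^sub>k\<close> independent standard normal and \<open>\<lambda>\<^sub>k \<ge> 0\<close>. Stein's method
  for sums of independent variables bounds the Wasserstein distance to the normal law by a multiple
  of the sum of the third absolute moments, that is, of
  \<open>tr (R\<^sup>3) / (n v\<^sub>n)\<^bsup>3/2\<^esup>\<close>. Since all \<open>\<lambda>\<^sub>k\<close> are nonnegative, this is the third cumulant up
  to a constant factor, which is why no rate is lost. Finally \<open>tr (R\<^sup>3)\<close> is at most a multiple of \<open>n\<close> times the square of \<open>\<Sum>k<n. \<rho>(k)\<^bsup>3/2\<^esup>\<close>.\<close>

section \<open>The Stein equation\<close>

text \<open>Gaussianity is assumed only for finite combinations of the \<open>G t\<close>, and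
  \<open>I\<close> is determined merely by almost sure linearity and isometry. Neither the normality
  of \<open>I g\<close> nor any independence is therefore given. Both are extracted from
  characteristic functions: normality by approximating \<open>g\<close> in the span of the
  \<open>e t\<close>, independence because orthogonality makes the joint characteristic function
  factor. Since the Hilbert space may be infinite-dimensional, the eigenbasis is built inside the
  span of \<open>h 1, ..., h n\<close>, where unit spheres are compact. The variance
  \<open>v n\<close> is twice the sum of the squared eigenvalues divided by \<open>n\<close>, so the
  third-moment bound has the size n^(-1/2) W^2 / v_n^(3/2), where W is the partial sum of
  \<rho>^(3/2). The cases of \<open>rate\<close> are the possible growths of W. Replacing
  \<open>A n\<close> by \<open>f\<close> and \<open>sqrt (v n)\<close> by \<open>\<sigma>\<close> is
  paid for by the Lipschitz property of the test function. The estimate behind (2) is kept in the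
  form of a bound for each test function, because in this form it also gives the weak convergence in
  (3).\<close>

lemma antiderivative_vanishing_at_ends:
  fixes w :: "real \<Rightarrow> real"
  assumes cont: "continuous_on UNIV w" and int: "integrable lborel w"
    and zero: "(\<integral>x. w x \<partial>lborel) = 0"
  obtains P where "\<And>x. (P has_real_derivative w x) (at x)"
    "(P \<longlongrightarrow> 0) at_top" "(P \<longlongrightarrow> 0) at_bot"
proof -
  have "isCont w x" for x
    using cont by (simp add: continuous_on_eq_continuous_at)
  then obtain Q where Q: "\<And>x. (Q has_vector_derivative w x) (at x)"
    using einterval_antiderivative[of "-\<infinity>" \<infinity> w] by auto
  have FTC: "(LINT x:{a..b}|lborel. w x) = Q b - Q a" if "a \<le> b" for a b
    unfolding set_lebesgue_integral_def
    by (rule integral_FTC_atLeastAtMost[OF that])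
      (use Q cont in \<open>auto intro: has_vector_derivative_at_within continuous_on_subset\<close>)
  have int': "set_integrable lborel A w" if "A \<in> sets lborel" for A
    using integrable_mult_indicator[OF that int] by (simp add: set_integrable_def)
  \<comment> \<open>\<open>L\<close> is the limit of \<open>Q\<close> at plus infinity. The
    vanishing integral makes it the limit at minus infinity as well, so one constant corrects both
    ends.\<close>
  define L where "L = Q 0 + (LINT x:{0..}|lborel. w x)"
  have "((\<lambda>b. LINT x:{0..b}|lborel. w x) \<longlongrightarrow> (LINT x:{0..}|lborel. w x)) at_top"
    by (rule tendsto_set_lebesgue_integral_at_top) (auto intro: int')
  moreover have "\<forall>\<^sub>F b in at_top. (LINT x:{0..b}|lborel. w x) = Q b - Q 0"
    using eventually_ge_at_top[of 0] by eventually_elim (simp add: FTC)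
  ultimately have "((\<lambda>b. Q b - Q 0) \<longlongrightarrow> (LINT x:{0..}|lborel. w x)) at_top"
    by (rule Lim_transform_eventually)
  from tendsto_add[OF this tendsto_const[of "Q 0 - L"]] have top: "((\<lambda>b. Q b - L) \<longlongrightarrow> 0) at_top"
    by (simp add: L_def diff_diff_eq)
  have "((\<lambda>a. LINT x:{a..0}|lborel. w x) \<longlongrightarrow> (LINT x:{..0}|lborel. w x)) at_bot"
    by (rule tendsto_set_lebesgue_integral_at_bot) (auto intro: int')
  moreover have "\<forall>\<^sub>F a in at_bot. (LINT x:{a..0}|lborel. w x) = Q 0 - Q a"
    using eventually_le_at_bot[of 0] by eventually_elim (simp add: FTC)
  ultimately have bot1: "((\<lambda>a. Q 0 - Q a) \<longlongrightarrow> (LINT x:{..0}|lborel. w x)) at_bot"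
    by (rule Lim_transform_eventually)
  have "(LINT x:{..0}|lborel. w x) + (LINT x:{0<..}|lborel. w x)
      = (LINT x:{..0} \<union> {0<..}|lborel. w x)"
    by (rule set_integral_Un[symmetric]) (auto intro: int')
  also have "{..0} \<union> {0<..} = (UNIV :: real set)" by auto
  also have "(LINT x:UNIV|lborel. w x) = 0"
    using zero by (simp add: set_lebesgue_integral_def)
  also have "(LINT x:{0<..}|lborel. w x) = (LINT x:{0..}|lborel. w x)"
    unfolding set_lebesgue_integral_def
    by (rule integral_cong_AE, measurable)
      (use int AE_lborel_singleton[of 0] in \<open>auto simp: indicator_def elim!: eventually_mono\<close>)
  finally have "(LINT x:{..0}|lborel. w x) = Q 0 - L"
    by (simp add: L_def)
  with tendsto_diff[OF tendsto_const[of "Q 0 - L"] bot1] have bot: "((\<lambda>a. Q a - L) \<longlongrightarrow> 0) at_bot"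
    by simp
  show ?thesis
    by (rule that[OF _ top bot])
       (use Q in \<open>auto intro!: derivative_eq_intros simp: has_real_derivative_iff_has_vector_derivative\<close>)
qed

lemma DERIV_std_normal_density:
  "(std_normal_density has_real_derivative - x * std_normal_density x) (at x)"
  unfolding std_normal_density_def[abs_def]
  by (auto intro!: derivative_eq_intros simp: field_simps power2_eq_square)

lemma std_normal_density_tendsto_0: "(std_normal_density \<longlongrightarrow> 0) at_top"
  unfolding std_normal_density_def[abs_def]
proof -
  have "LIM x at_top. (1/2) * x\<^sup>2 :> (at_top :: real filter)"
    by (intro filterlim_tendsto_pos_mult_at_top[OF tendsto_const] filterlim_pow_at_top filterlim_ident)
      auto
  then have "LIM x at_top. - x\<^sup>2 / 2 :> (at_bot :: real filter)"
    by (simp add: filterlim_uminus_at_bot)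
  from tendsto_mult_right_zero[OF filterlim_compose[OF exp_at_bot this]]
  show "((\<lambda>x. 1 / sqrt (2 * pi) * exp (- x\<^sup>2 / 2)) \<longlongrightarrow> 0) at_top" .
qed

text \<open>With \<open>s\<close> the normal density, the barrier \<open>s x * (B + A / x)\<close>
  has derivative \<open>- s x * (A + B * x + A / x\<^sup>2)\<close>, so it falls at least as fast as
  \<open>P\<close> can move. Barrier minus \<open>P\<close> and barrier plus \<open>P\<close> are
  thus nonincreasing with limit 0, hence nonnegative. This is a Mills ratio estimate that evaluates
  no tail integral.\<close>

lemma gaussian_tail_comparison:
  fixes P r :: "real \<Rightarrow> real"
  assumes P: "\<And>x. x > 0 \<Longrightarrow> (P has_real_derivative r x * std_normal_density x) (at x)"
    and r: "\<And>x. x > 0 \<Longrightarrow> \<bar>r x\<bar> \<le> A + B * x"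
    and lim: "(P \<longlongrightarrow> 0) at_top" and "A \<ge> 0" "B \<ge> 0" "x > 0"
  shows "\<bar>P x\<bar> \<le> std_normal_density x * (B + A / x)"
proof -
  define s where "s = std_normal_density"
  define \<Psi> where "\<Psi> = (\<lambda>x. s x * (B + A / x))"
  have s: "s x > 0" for x by (simp add: s_def normal_density_pos)
  have \<Psi>: "(\<Psi> has_real_derivative - (s y * (A + B * y + A / y\<^sup>2))) (at y)" if "y > 0" for y
  proof -
    have "((\<lambda>x. B + A / x) has_real_derivative - A / y\<^sup>2) (at y)"
      using that by (auto intro!: derivative_eq_intros simp: power2_eq_square)
    from DERIV_mult[OF DERIV_std_normal_density this]
    show ?thesis
      using that by (simp add: \<Psi>_def s_def algebra_simps)
  qed
  have lim\<Psi>: "(\<Psi> \<longlongrightarrow> 0) at_top"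
  proof -
    have "((\<lambda>x. A / x) \<longlongrightarrow> 0) at_top"
      by (intro tendsto_divide_0[OF tendsto_const] filterlim_at_top_imp_at_infinity filterlim_ident)
    from tendsto_mult[OF std_normal_density_tendsto_0 tendsto_add[OF tendsto_const[of B] this]]
    show ?thesis by (simp add: \<Psi>_def s_def)
  qed
  have bound: "\<bar>r y * s y\<bar> \<le> s y * (A + B * y + A / y\<^sup>2)" if "y > 0" for y
  proof -
    have "0 \<le> A / y\<^sup>2" using \<open>A \<ge> 0\<close> by simp
    then have "\<bar>r y\<bar> \<le> A + B * y + A / y\<^sup>2"
      using r[OF that] by linarith
    then show ?thesis
      using s[of y] by (simp add: abs_mult mult.commute)
  qed
  have main: "\<epsilon> * P x \<le> \<Psi> x" if "\<epsilon> = 1 \<or> \<epsilon> = -1" for \<epsilon> :: real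
  proof -
    have der: "((\<lambda>x. \<Psi> x - \<epsilon> * P x) has_real_derivative
        - (s y * (A + B * y + A / y\<^sup>2)) - \<epsilon> * (r y * s y)) (at y)" if "y > 0" for y
      using DERIV_diff[OF \<Psi>[OF that] DERIV_cmult[OF P[OF that], of \<epsilon>]] by (simp add: s_def)
    have mono: "\<Psi> y - \<epsilon> * P y \<le> \<Psi> x - \<epsilon> * P x" if "x \<le> y" for y
    proof (rule DERIV_nonpos_imp_nonincreasing[OF that])
      fix z assume "x \<le> z" "z \<le> y"
      with \<open>x > 0\<close> have z: "z > 0" by simp
      show "\<exists>d. ((\<lambda>x. \<Psi> x - \<epsilon> * P x) has_real_derivative d) (at z) \<and> d \<le> 0"
        using der[OF z] bound[OF z] \<open>\<epsilon> = 1 \<or> \<epsilon> = -1\<close> by (intro exI conjI) auto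
    qed
    have "((\<lambda>y. \<Psi> y - \<epsilon> * P y) \<longlongrightarrow> 0 - \<epsilon> * 0) at_top"
      by (intro tendsto_intros lim lim\<Psi>)
    then have "0 - \<epsilon> * 0 \<le> \<Psi> x - \<epsilon> * P x"
      by (rule tendsto_upperbound) (auto intro: eventually_mono[OF eventually_ge_at_top[of x]] mono)
    then show ?thesis by simp
  qed
  from main[of 1] main[of "-1"] show ?thesis
    by (simp add: \<Psi>_def s_def abs_le_iff)
qed

lemma std_normal_density_even: "std_normal_density (- x) = std_normal_density x"
  by (simp add: std_normal_density_def)

lemma gaussian_tail_comparison_both:
  fixes P r :: "real \<Rightarrow> real"
  assumes P: "\<And>x. (P has_real_derivative r x * std_normal_density x) (at x)"
    and r: "\<And>x. \<bar>r x\<bar> \<le> A + B * \<bar>x\<bar>"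
    and "(P \<longlongrightarrow> 0) at_top" "(P \<longlongrightarrow> 0) at_bot" and "A \<ge> 0" "B \<ge> 0" "x \<noteq> 0"
  shows "\<bar>P x\<bar> \<le> std_normal_density x * (B + A / \<bar>x\<bar>)"
proof (cases "x > 0")
  case True
  with gaussian_tail_comparison[of P r A B x] assms show ?thesis
    by (metis abs_of_pos)
next
  case False
  have "\<bar>P (- (- x))\<bar> \<le> std_normal_density (-x) * (B + A / (-x))"
  proof (rule gaussian_tail_comparison[where P="\<lambda>x. P (-x)" and r="\<lambda>x. - r (-x)"])
    fix y :: real
    show "((\<lambda>x. P (- x)) has_real_derivative - r (- y) * std_normal_density y) (at y)"
      using DERIV_chain2[OF P DERIV_minus[OF DERIV_ident], of y]
      by (simp add: std_normal_density_even)
    show "\<bar>- r (- y)\<bar> \<le> A + B * y" if "y > 0" using r[of "-y"] that by simp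
    show "((\<lambda>x. P (- x)) \<longlongrightarrow> 0) at_top"
      by (rule filterlim_compose[OF assms(4) filterlim_uminus_at_bot_at_top])
  qed (use assms False in auto)
  with False \<open>x \<noteq> 0\<close> show ?thesis by (simp add: std_normal_density_even)
qed

lemma abs_mult_std_normal_density_tendsto_0:
  shows "((\<lambda>x. \<bar>x\<bar> * std_normal_density x) \<longlongrightarrow> 0) at_top"
    and "((\<lambda>x. \<bar>x\<bar> * std_normal_density x) \<longlongrightarrow> 0) at_bot"
proof -
  show top: "((\<lambda>x. \<bar>x\<bar> * std_normal_density x) \<longlongrightarrow> 0) at_top"
  proof (rule tendsto_sandwich[where f="\<lambda>_. 0"])
    have "((\<lambda>x. (2 / sqrt (2 * pi)) / x) \<longlongrightarrow> 0) at_top"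
      by (intro tendsto_divide_0[OF tendsto_const] filterlim_at_top_imp_at_infinity filterlim_ident)
    then show "((\<lambda>x. (2 / sqrt (2 * pi)) / x) \<longlongrightarrow> 0) at_top" .
    show "\<forall>\<^sub>F x in at_top. \<bar>x\<bar> * std_normal_density x \<le> (2 / sqrt (2 * pi)) / x"
      using eventually_gt_at_top[of 0]
    proof eventually_elim
      case (elim x)
      have "x\<^sup>2 / 2 \<le> exp (x\<^sup>2 / 2)"
        using exp_ge_add_one_self[of "x\<^sup>2 / 2"] by linarith
      then have "exp (- (x\<^sup>2 / 2)) \<le> 2 / x\<^sup>2"
        using elim by (simp add: exp_minus field_simps)
      then have "x * exp (- (x\<^sup>2 / 2)) \<le> x * (2 / x\<^sup>2)"
        using elim by (intro mult_left_mono) auto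
      also have "\<dots> = 2 / x"
        using elim by (simp add: power2_eq_square)
      finally have "1 / sqrt (2 * pi) * (x * exp (- (x\<^sup>2 / 2))) \<le> 1 / sqrt (2 * pi) * (2 / x)"
        by (intro mult_left_mono) auto
      then show ?case
        using elim by (simp add: std_normal_density_def mult_ac)
    qed
  qed (auto intro!: always_eventually)
  have "((\<lambda>x. \<bar>- x\<bar> * std_normal_density (- x)) \<longlongrightarrow> 0) at_bot"
    by (rule filterlim_compose[OF top filterlim_uminus_at_top_at_bot])
  then show "((\<lambda>x. \<bar>x\<bar> * std_normal_density x) \<longlongrightarrow> 0) at_bot"
    by (simp add: std_normal_density_even)
qed

lemma lipschitz_from_derivative_bound:
  fixes h h' :: "real \<Rightarrow> real"
  assumes h: "\<And>x. (h has_real_derivative h' x) (at x)" and h': "\<And>x. \<bar>h' x\<bar> \<le> B"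
  shows "\<bar>h x - h y\<bar> \<le> B * \<bar>x - y\<bar>"
  using field_differentiable_bound[of UNIV h h' B x y] assms by simp

lemma borel_measurable_lipschitz:
  fixes g :: "real \<Rightarrow> real"
  assumes g: "\<And>x y. \<bar>g x - g y\<bar> \<le> L * \<bar>x - y\<bar>"
  shows "g \<in> borel_measurable borel"
proof -
  have "L \<ge> 0" using g[of 0 1] by simp
  then have "L-lipschitz_on UNIV g"
    by (intro lipschitz_onI) (use g in \<open>auto simp: dist_real_def\<close>)
  then show ?thesis
    by (intro borel_measurable_continuous_onI lipschitz_on_continuous_on)
qed

lemma std_normal_abs_moment_le_1: "(\<integral>x. std_normal_density x * \<bar>x\<bar> \<partial>lborel) \<le> 1"
proof -
  have "2 / pi \<le> 1" using pi_ge_two by simp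
  then have "sqrt (2 / pi) \<le> 1" by (subst real_sqrt_le_1_iff)
  with integral_std_normal_moment_abs_odd[of 0] show ?thesis by simp
qed

text \<open>The difference is the mean of \<open>h y - h N\<close>, and
  \<open>E |N| = sqrt (2 / pi)\<close> is at most 1. The affine bound is the input for the tail
  comparison; at \<open>y = 0\<close> it later compares the normal law with the point mass at
  0.\<close>

lemma lipschitz_std_normal:
  fixes h :: "real \<Rightarrow> real"
  assumes lip: "\<And>x y. \<bar>h x - h y\<bar> \<le> \<bar>x - y\<bar>"
  shows "integrable lborel (\<lambda>x. std_normal_density x * h x)"
    and "\<bar>h y - (\<integral>x. std_normal_density x * h x \<partial>lborel)\<bar> \<le> 1 + \<bar>y\<bar>"
proof -
  have [measurable]: "h \<in> borel_measurable borel"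
    by (rule borel_measurable_lipschitz[of h 1]) (simp add: lip)
  have int1: "integrable lborel (\<lambda>x. std_normal_density x * \<bar>x\<bar>)"
    using integrable_std_normal_moment_abs[of 1] by simp
  have int: "integrable lborel (\<lambda>x. std_normal_density x * h x)"
  proof (rule Bochner_Integration.integrable_bound)
    show "integrable lborel (\<lambda>x. std_normal_density x * \<bar>h 0\<bar> + std_normal_density x * \<bar>x\<bar>)"
      by (intro Bochner_Integration.integrable_add integrable_mult_left int1) auto
    have "\<bar>std_normal_density x * h x\<bar> \<le> std_normal_density x * (\<bar>h 0\<bar> + \<bar>x\<bar>)" for x
      unfolding abs_mult using lip[of x 0] by (intro mult_mono) auto
    then show "AE x in lborel. norm (std_normal_density x * h x)
        \<le> norm (std_normal_density x * \<bar>h 0\<bar> + std_normal_density x * \<bar>x\<bar>)"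
      by (simp add: distrib_left)
  qed measurable
  then show "integrable lborel (\<lambda>x. std_normal_density x * h x)" .
  have "h y - (\<integral>x. std_normal_density x * h x \<partial>lborel)
      = (\<integral>x. std_normal_density x * h y \<partial>lborel) - (\<integral>x. std_normal_density x * h x \<partial>lborel)"
    by simp
  also have "\<dots> = (\<integral>x. std_normal_density x * h y - std_normal_density x * h x \<partial>lborel)"
    by (rule Bochner_Integration.integral_diff[symmetric]) (auto intro!: int integrable_mult_left)
  also have "\<bar>\<dots>\<bar> \<le> (\<integral>x. \<bar>std_normal_density x * h y - std_normal_density x * h x\<bar> \<partial>lborel)"
    by (rule integral_abs_bound)
  also have "\<dots> \<le> (\<integral>x. std_normal_density x * \<bar>y\<bar> + std_normal_density x * \<bar>x\<bar> \<partial>lborel)"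
  proof (rule integral_mono)
    show "integrable lborel (\<lambda>x. \<bar>std_normal_density x * h y - std_normal_density x * h x\<bar>)"
      by (intro integrable_abs Bochner_Integration.integrable_diff int integrable_mult_left) auto
    show "integrable lborel (\<lambda>x. std_normal_density x * \<bar>y\<bar> + std_normal_density x * \<bar>x\<bar>)"
      by (intro Bochner_Integration.integrable_add integrable_mult_left int1) auto
    fix x
    have "\<bar>std_normal_density x * (h y - h x)\<bar> \<le> std_normal_density x * (\<bar>y\<bar> + \<bar>x\<bar>)"
      unfolding abs_mult using lip[of y x] by (intro mult_mono) auto
    then show "\<bar>std_normal_density x * h y - std_normal_density x * h x\<bar>
        \<le> std_normal_density x * \<bar>y\<bar> + std_normal_density x * \<bar>x\<bar>"
      by (simp add: algebra_simps)
  qed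
  also have "\<dots> = \<bar>y\<bar> + (\<integral>x. std_normal_density x * \<bar>x\<bar> \<partial>lborel)"
    by (subst Bochner_Integration.integral_add) (auto intro!: int1 integrable_mult_left)
  also have "\<dots> \<le> 1 + \<bar>y\<bar>"
    using std_normal_abs_moment_le_1 by simp
  finally show "\<bar>h y - (\<integral>x. std_normal_density x * h x \<partial>lborel)\<bar> \<le> 1 + \<bar>y\<bar>" .
qed

text \<open>The derivative \<open>d\<close> of the solution satisfies \<open>d' x - x * d x = f x + h' x\<close>, an equation of
  the same form with bounded right-hand side, so the tail comparison that bounds \<open>f\<close> also bounds
  \<open>x * d x\<close> and hence \<open>d'\<close>.\<close>

lemma stein_equation_solution:
  fixes h h' :: "real \<Rightarrow> real"
  assumes h: "\<And>x. (h has_real_derivative h' x) (at x)" and h'1: "\<And>x. \<bar>h' x\<bar> \<le> 1"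
  obtains f d where "\<And>x. (f has_real_derivative d x) (at x)"
    "\<And>x. d x - x * f x = h x - (\<integral>x. std_normal_density x * h x \<partial>lborel)"
    "\<And>x. \<bar>f x\<bar> \<le> 10" "\<And>x y. \<bar>d x - d y\<bar> \<le> 22 * \<bar>x - y\<bar>"
proof -
  define s where "s = std_normal_density"
  define g where "g = (\<lambda>x. h x - (\<integral>x. s x * h x \<partial>lborel))"
  have s: "s x > 0" for x by (simp add: s_def normal_density_pos)
  have s': "(s has_real_derivative - x * s x) (at x)" for x
    unfolding s_def by (rule DERIV_std_normal_density)
  have lip: "\<bar>h x - h y\<bar> \<le> \<bar>x - y\<bar>" for x y
    using lipschitz_from_derivative_bound[OF h h'1] by simp
  have g: "\<bar>g y\<bar> \<le> 1 + \<bar>y\<bar>" for y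
    unfolding g_def s_def by (rule lipschitz_std_normal[OF lip])
  have g': "(g has_real_derivative h' x) (at x)" for x
    unfolding g_def by (auto intro!: derivative_eq_intros h)
  have inth: "integrable lborel (\<lambda>x. s x * h x)"
    unfolding s_def by (rule lipschitz_std_normal[OF lip])
  have "integrable lborel (\<lambda>x. s x * h x - s x * (\<integral>x. s x * h x \<partial>lborel))"
    by (intro Bochner_Integration.integrable_diff inth integrable_mult_left) (simp add: s_def)
  then have int: "integrable lborel (\<lambda>x. g x * s x)"
    by (simp add: g_def algebra_simps)
  have "(\<integral>x. g x * s x \<partial>lborel) = (\<integral>x. s x * h x - s x * (\<integral>x. s x * h x \<partial>lborel) \<partial>lborel)"
    by (simp add: g_def algebra_simps)
  also have "\<dots> = (\<integral>x. s x * h x \<partial>lborel) - (\<integral>x. s x * (\<integral>x. s x * h x \<partial>lborel) \<partial>lborel)"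
    by (intro Bochner_Integration.integral_diff inth integrable_mult_left) (simp add: s_def)
  also have "\<dots> = 0" by (simp add: s_def)
  finally have zero: "(\<integral>x. g x * s x \<partial>lborel) = 0" .
  have cont: "continuous_on UNIV (\<lambda>x. g x * s x)"
    by (intro continuous_at_imp_continuous_on ballI continuous_intros)
       (auto intro: DERIV_isCont g' s')
  obtain P where P: "\<And>x. (P has_real_derivative g x * s x) (at x)"
    "(P \<longlongrightarrow> 0) at_top" "(P \<longlongrightarrow> 0) at_bot"
    by (rule antiderivative_vanishing_at_ends[OF cont int zero]) blast
  \<comment> \<open>Multiplied by the density \<open>s\<close>, the left side of the Stein equation
    is the derivative of \<open>f * s\<close>; hence \<open>f\<close> is an antiderivative of
    \<open>g * s\<close> divided by \<open>s\<close>. Any antiderivative other than \<open>P\<close>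
    would make the quotient unbounded.\<close>
  define f where "f = (\<lambda>x. P x / s x)"
  define d where "d = (\<lambda>x. g x + x * f x)"
  have f': "(f has_real_derivative d x) (at x)" for x
  proof -
    have "((\<lambda>x. P x / s x) has_real_derivative
        (g x * s x * s x - P x * (- x * s x)) / (s x * s x)) (at x)"
      using s[of x] by (intro DERIV_divide P s') auto
    moreover have "(g x * s x * s x - P x * (- x * s x)) / (s x * s x) = d x"
      using s[of x] by (simp add: d_def f_def field_simps)
    ultimately show ?thesis by (simp add: f_def)
  qed
  have P_bound: "\<bar>P x\<bar> \<le> s x * (1 + 1 / \<bar>x\<bar>)" if "x \<noteq> 0" for x
    using gaussian_tail_comparison_both[of P g 1 1 x] P g that by (simp add: s_def)
  \<comment> \<open>On [-1, 1] the density varies by a factor of at most 2, because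
    \<open>exp (-1/2)\<close> is at least 1/2.\<close>
  have s_le: "s 1 \<le> s x" "s x \<le> 2 * s 1" if "\<bar>x\<bar> \<le> 1" for x
  proof -
    have "x\<^sup>2 \<le> 1" using that by (simp add: abs_square_le_1)
    then have "exp (- (1 / 2)) \<le> exp (- (x\<^sup>2 / 2))" by simp
    then show "s 1 \<le> s x"
      by (simp add: s_def std_normal_density_def divide_right_mono)
    have "exp (- (x\<^sup>2 / 2)) \<le> 1" by simp
    also have "1 \<le> 2 * exp (- (1 / 2) :: real)"
      using exp_ge_add_one_self[of "- (1/2) :: real"] by simp
    finally show "s x \<le> 2 * s 1"
      by (simp add: s_def std_normal_density_def divide_right_mono)
  qed
  \<comment> \<open>The tail estimate is useless near 0. There \<open>P\<close> is reached from
    \<open>P 1\<close>, which is at most \<open>2 * s 1\<close>; the slope is at most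
    \<open>4 * s 1\<close> over a distance of at most 2. This gives \<open>10 * s 1\<close>, and
    \<open>s 1 \<le> s x\<close>.\<close>
  have f_bound: "\<bar>f x\<bar> \<le> 10" for x
  proof (cases "\<bar>x\<bar> \<ge> 1")
    case True
    then have "\<bar>P x\<bar> \<le> s x * (1 + 1 / \<bar>x\<bar>)" by (intro P_bound) auto
    also have "\<dots> \<le> s x * 10"
      using True s[of x] by (intro mult_left_mono) (auto simp: field_simps)
    finally show ?thesis using s[of x] by (simp add: f_def field_simps)
  next
    case False
    have "\<bar>P x - P 1\<bar> \<le> (4 * s 1) * \<bar>x - 1\<bar>"
    proof -
      have "\<bar>g y * s y\<bar> \<le> 4 * s 1" if "y \<in> {-1..1}" for y
      proof -
        have "\<bar>g y * s y\<bar> \<le> 2 * (2 * s 1)"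
          unfolding abs_mult using g[of y] that s[of y] s_le[of y] by (intro mult_mono) auto
        then show ?thesis by simp
      qed
      then have "norm (P x - P 1) \<le> (4 * s 1) * norm (x - 1)"
        by (intro field_differentiable_bound[of "{-1..1}" P "\<lambda>x. g x * s x"])
           (use P False in \<open>auto intro: has_field_derivative_at_within\<close>)
      then show ?thesis by simp
    qed
    also have "\<dots> \<le> (4 * s 1) * 2"
      using False s[of 1] by (intro mult_left_mono) auto
    finally have "\<bar>P x\<bar> \<le> 8 * s 1 + \<bar>P 1\<bar>" by linarith
    also have "\<bar>P 1\<bar> \<le> 2 * s 1" using P_bound[of 1] by simp
    finally have "\<bar>P x\<bar> \<le> 10 * s x" using s_le[of x] False by simp
    then show ?thesis using s[of x] by (simp add: f_def field_simps)
  qed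
  define e where "e = (\<lambda>x. h' x + f x + x * d x)"
  have d': "(d has_real_derivative e x) (at x)" for x
    using DERIV_add[OF g'[of x] DERIV_mult[OF DERIV_ident f'[of x]]]
    unfolding d_def e_def by (simp add: algebra_simps)
  \<comment> \<open>The terms \<open>x * d x * s x\<close> cancel, so \<open>d * s\<close> is an
    antiderivative of a bounded function times the density.\<close>
  have ds': "((\<lambda>x. d x * s x) has_real_derivative (h' x + f x) * s x) (at x)" for x
    using DERIV_mult[OF d'[of x] s'[of x]] by (simp add: e_def algebra_simps)
  \<comment> \<open>This crude bound serves only to show that \<open>d * s\<close> vanishes at both
    ends, as the tail comparison requires.\<close>
  have ds_bound: "\<bar>d x * s x\<bar> \<le> 2 * (s x + \<bar>x\<bar> * s x)" if "x \<noteq> 0" for x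
  proof -
    have "\<bar>d x * s x\<bar> = \<bar>g x * s x + x * P x\<bar>"
      using s[of x] by (simp add: d_def f_def distrib_right)
    also have "\<dots> \<le> \<bar>g x\<bar> * s x + \<bar>x\<bar> * \<bar>P x\<bar>"
      using s[of x] by (simp add: abs_mult abs_triangle_ineq[THEN order_trans])
    also have "\<dots> \<le> (1 + \<bar>x\<bar>) * s x + \<bar>x\<bar> * (s x * (1 + 1 / \<bar>x\<bar>))"
      using g[of x] P_bound[OF that] s[of x] by (intro add_mono mult_left_mono mult_right_mono) auto
    also have "\<dots> = 2 * (s x + \<bar>x\<bar> * s x)"
      using that by (simp add: field_simps)
    finally show ?thesis .
  qed
  have s_bot: "(s \<longlongrightarrow> 0) at_bot"
  proof -
    have "((\<lambda>x. std_normal_density (- x)) \<longlongrightarrow> 0) at_bot"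
      by (rule filterlim_compose[OF std_normal_density_tendsto_0 filterlim_uminus_at_top_at_bot])
    then show ?thesis by (simp add: std_normal_density_even s_def)
  qed
  have ds_top: "((\<lambda>x. d x * s x) \<longlongrightarrow> 0) at_top"
  proof (rule Lim_null_comparison)
    show "\<forall>\<^sub>F x in at_top. norm (d x * s x) \<le> 2 * (s x + \<bar>x\<bar> * s x)"
      using eventually_gt_at_top[of 0] by eventually_elim (simp only: real_norm_def, rule ds_bound, simp)
    show "((\<lambda>x. 2 * (s x + \<bar>x\<bar> * s x)) \<longlongrightarrow> 0) at_top"
      unfolding s_def by (intro tendsto_mult_right_zero tendsto_add_zero
          std_normal_density_tendsto_0 abs_mult_std_normal_density_tendsto_0)
  qed
  have ds_bot: "((\<lambda>x. d x * s x) \<longlongrightarrow> 0) at_bot"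
  proof (rule Lim_null_comparison)
    show "\<forall>\<^sub>F x in at_bot. norm (d x * s x) \<le> 2 * (s x + \<bar>x\<bar> * s x)"
      using eventually_gt_at_bot[of 0] by eventually_elim (simp only: real_norm_def, rule ds_bound, simp)
    show "((\<lambda>x. 2 * (s x + \<bar>x\<bar> * s x)) \<longlongrightarrow> 0) at_bot"
      using abs_mult_std_normal_density_tendsto_0(2) s_bot
      by (intro tendsto_mult_right_zero tendsto_add_zero) (auto simp: s_def)
  qed
  have xd: "\<bar>x * d x\<bar> \<le> 11" for x
  proof (cases "x = 0")
    case False
    \<comment> \<open>\<open>11 = 1 + 10\<close> bounds \<open>h' + f\<close> with no linear term,
      so the comparison yields \<open>11 / \<bar>x\<bar>\<close> for \<open>d\<close>. Then
      \<open>22 = 1 + 10 + 11\<close> bounds the three terms of \<open>e\<close>.\<close>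
    have "\<bar>h' x + f x\<bar> \<le> 11 + 0 * \<bar>x\<bar>" for x
      using h'1[of x] f_bound[of x] by simp
    from gaussian_tail_comparison_both[OF ds'[unfolded s_def] this
        ds_top[unfolded s_def] ds_bot[unfolded s_def] _ _ False]
    have "\<bar>d x\<bar> * s x \<le> (11 / \<bar>x\<bar>) * s x"
      using s[of x] by (simp add: abs_mult s_def mult_ac)
    then have "\<bar>d x\<bar> \<le> 11 / \<bar>x\<bar>"
      by (rule mult_right_le_imp_le) (rule s)
    then show ?thesis using False by (simp add: abs_mult field_simps)
  qed simp
  have "\<bar>e x\<bar> \<le> 22" for x
    using h'1[of x] f_bound[of x] xd[of x] by (simp add: e_def)
  then have "\<bar>d x - d y\<bar> \<le> 22 * \<bar>x - y\<bar>" for x y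
    by (rule lipschitz_from_derivative_bound[OF d'])
  moreover have "d x - x * f x = h x - (\<integral>x. std_normal_density x * h x \<partial>lborel)" for x
    by (simp add: d_def g_def s_def)
  ultimately show ?thesis using that f' f_bound by blast
qed

section \<open>Normal approximation of independent sums\<close>

text \<open>The mean of \<open>h\<close> over [x, x + \<epsilon>] is differentiable, its derivative
  is a difference quotient of \<open>h\<close>, and it equals a value of \<open>h\<close> at
  distance less than \<open>\<epsilon>\<close> from x. This passes from the differentiable test
  functions of the Stein equation to all Lipschitz ones.\<close>

lemma lipschitz_smoothing:
  fixes h :: "real \<Rightarrow> real"
  assumes lip: "\<And>x y. \<bar>h x - h y\<bar> \<le> \<bar>x - y\<bar>" and "\<epsilon> > 0"
  obtains k k' where "\<And>x. (k has_real_derivative k' x) (at x)" "\<And>x. \<bar>k' x\<bar> \<le> 1"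
    "\<And>x. \<bar>k x - h x\<bar> \<le> \<epsilon>"
proof -
  have "1-lipschitz_on UNIV h"
    by (rule lipschitz_onI) (use lip in \<open>auto simp: dist_real_def\<close>)
  then have "isCont h x" for x
    using lipschitz_on_continuous_on[of 1 UNIV h] by (simp add: continuous_on_eq_continuous_at)
  then obtain H where "\<And>x. (H has_vector_derivative h x) (at x)"
    using einterval_antiderivative[of "-\<infinity>" \<infinity> h] by auto
  then have H: "(H has_real_derivative h x) (at x)" for x
    by (simp add: has_real_derivative_iff_has_vector_derivative)
  show ?thesis
  proof (rule that)
    fix x
    have "((\<lambda>x. H (x + \<epsilon>)) has_real_derivative h (x + \<epsilon>)) (at x)"
      using H[of "x + \<epsilon>"] by (simp add: DERIV_shift)
    then show "((\<lambda>x. (H (x + \<epsilon>) - H x) / \<epsilon>) has_real_derivative (h (x + \<epsilon>) - h x) / \<epsilon>) (at x)"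
      by (intro DERIV_cdivide DERIV_diff H)
    show "\<bar>(h (x + \<epsilon>) - h x) / \<epsilon>\<bar> \<le> 1"
      using lip[of "x + \<epsilon>" x] \<open>\<epsilon> > 0\<close> by (simp add: abs_divide)
    obtain z where z: "x < z" "z < x + \<epsilon>" "H (x + \<epsilon>) - H x = (x + \<epsilon> - x) * h z"
      using MVT2[of x "x + \<epsilon>" H h] H \<open>\<epsilon> > 0\<close> by auto
    then have "(H (x + \<epsilon>) - H x) / \<epsilon> = h z"
      using \<open>\<epsilon> > 0\<close> by simp
    then show "\<bar>(H (x + \<epsilon>) - H x) / \<epsilon> - h x\<bar> \<le> \<epsilon>"
      using lip[of z x] z by simp
  qed
qed

text \<open>Mean value inequality for \<open>f z - z * d y\<close>, whose derivative
  \<open>d z - d y\<close> is at most \<open>L * \<bar>x\<bar>\<close> in size between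
  \<open>y\<close> and \<open>y + x\<close>.\<close>

lemma first_order_taylor_bound:
  fixes f d :: "real \<Rightarrow> real"
  assumes f: "\<And>x. (f has_real_derivative d x) (at x)"
    and d: "\<And>x y. \<bar>d x - d y\<bar> \<le> L * \<bar>x - y\<bar>"
  shows "\<bar>f (y + x) - f y - x * d y\<bar> \<le> L * x\<^sup>2"
proof -
  have "\<bar>d z - d y\<bar> \<le> L * \<bar>x\<bar>" if "z \<in> closed_segment y (y + x)" for z
  proof -
    have "L \<ge> 0" using d[of 0 1] by simp
    moreover have "\<bar>z - y\<bar> \<le> \<bar>x\<bar>"
      using that by (auto simp: closed_segment_eq_real_ivl split: if_splits)
    ultimately show ?thesis using d[of z y] mult_left_mono by fastforce
  qed
  then have "norm ((f (y + x) - (y + x) * d y) - (f y - y * d y)) \<le> L * \<bar>x\<bar> * norm (y + x - y)"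
    by (intro field_differentiable_bound[of "closed_segment y (y + x)" _ "\<lambda>z. d z - d y"])
       (auto intro!: DERIV_diff[OF f] derivative_eq_intros has_field_derivative_at_within[OF f])
  then show ?thesis
    by (simp add: algebra_simps power2_eq_square abs_mult_self_eq)
qed

context prob_space
begin

lemma integrable_power_le:
  fixes \<xi> :: "'a \<Rightarrow> real"
  assumes [measurable]: "\<xi> \<in> borel_measurable M"
    and "integrable M (\<lambda>\<omega>. \<bar>\<xi> \<omega>\<bar> ^ n)" "k \<le> n"
  shows "integrable M (\<lambda>\<omega>. \<bar>\<xi> \<omega>\<bar> ^ k)"
proof (rule Bochner_Integration.integrable_bound)
  show "integrable M (\<lambda>\<omega>. 1 + \<bar>\<xi> \<omega>\<bar> ^ n)"
    using assms by simp
  have "x ^ k \<le> 1 + x ^ n" if "x \<ge> 0" for x :: real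
  proof (cases "x \<le> 1")
    case True
    with that have "x ^ k \<le> 1" by (simp add: power_le_one)
    with that show ?thesis by (simp add: add_increasing2)
  next
    case False
    with \<open>k \<le> n\<close> have "x ^ k \<le> x ^ n" by (intro power_increasing) auto
    then show ?thesis by simp
  qed
  then show "AE \<omega> in M. norm (\<bar>\<xi> \<omega>\<bar> ^ k) \<le> norm (1 + \<bar>\<xi> \<omega>\<bar> ^ n)"
    by (auto simp: abs_of_nonneg)
qed measurable

lemma integrable_lipschitz:
  fixes g :: "real \<Rightarrow> real"
  assumes g: "\<And>x y. \<bar>g x - g y\<bar> \<le> L * \<bar>x - y\<bar>" and Y: "integrable M Y"
  shows "integrable M (\<lambda>\<omega>. g (Y \<omega>))"
proof (rule Bochner_Integration.integrable_bound)
  have "L \<ge> 0" using g[of 0 1] by simp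
  have [measurable]: "g \<in> borel_measurable borel"
    by (rule borel_measurable_lipschitz[OF g])
  show "(\<lambda>\<omega>. g (Y \<omega>)) \<in> borel_measurable M"
    using Y by measurable
  show "integrable M (\<lambda>\<omega>. \<bar>g 0\<bar> + L * \<bar>Y \<omega>\<bar>)" using Y by simp
  show "AE \<omega> in M. norm (g (Y \<omega>)) \<le> norm (\<bar>g 0\<bar> + L * \<bar>Y \<omega>\<bar>)"
  proof (rule AE_I2)
    fix \<omega> show "norm (g (Y \<omega>)) \<le> norm (\<bar>g 0\<bar> + L * \<bar>Y \<omega>\<bar>)"
      using g[of "Y \<omega>" 0] \<open>L \<ge> 0\<close> by simp
  qed
qed

text \<open>Expand \<open>f (G + \<xi>)\<close> around \<open>G\<close>. By independence and
  centering the zeroth-order term has mean 0, and the first-order term has mean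
  \<open>E \<xi>\<^sup>2 * E d(G)\<close>. The remainder, multiplied by \<open>\<xi>\<close>, costs
  \<open>L * E \<bar>\<xi>\<bar>^3\<close>; restoring the argument \<open>G + \<xi>\<close> in
  \<open>d\<close> costs \<open>L * E \<bar>\<xi>\<bar>\<close> times the variance.\<close>

lemma stein_leave_one_out:
  fixes \<xi> G :: "'a \<Rightarrow> real" and f d :: "real \<Rightarrow> real"
  assumes ind: "indep_var borel \<xi> borel G"
    and \<xi>3: "integrable M (\<lambda>\<omega>. \<bar>\<xi> \<omega>\<bar> ^ 3)" and mean: "expectation \<xi> = 0"
    and G: "integrable M G"
    and f: "\<And>x. (f has_real_derivative d x) (at x)" and f_bound: "\<And>x. \<bar>f x\<bar> \<le> K"
    and d: "\<And>x y. \<bar>d x - d y\<bar> \<le> L * \<bar>x - y\<bar>"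
  shows "integrable M (\<lambda>\<omega>. \<xi> \<omega> * f (G \<omega> + \<xi> \<omega>))"
    and "\<bar>expectation (\<lambda>\<omega>. (\<xi> \<omega>)\<^sup>2) * expectation (\<lambda>\<omega>. d (G \<omega> + \<xi> \<omega>))
        - expectation (\<lambda>\<omega>. \<xi> \<omega> * f (G \<omega> + \<xi> \<omega>))\<bar>
      \<le> L * (expectation (\<lambda>\<omega>. \<bar>\<xi> \<omega>\<bar> ^ 3)
          + expectation (\<lambda>\<omega>. (\<xi> \<omega>)\<^sup>2) * expectation (\<lambda>\<omega>. \<bar>\<xi> \<omega>\<bar>))"
proof -
  have m[measurable]: "\<xi> \<in> borel_measurable M" "G \<in> borel_measurable M"
    using indep_var_rv1[OF ind] indep_var_rv2[OF ind] by auto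
  have [measurable]: "f \<in> borel_measurable borel"
    by (intro borel_measurable_continuous_onI continuous_at_imp_continuous_on)
       (auto intro: DERIV_isCont f)
  have [measurable]: "d \<in> borel_measurable borel"
    by (rule borel_measurable_lipschitz[OF d])
  have \<xi>1a: "integrable M (\<lambda>\<omega>. \<bar>\<xi> \<omega>\<bar>)"
    using integrable_power_le[OF _ \<xi>3, of 1] by simp
  then have \<xi>1: "integrable M \<xi>"
    by (subst (asm) integrable_abs_iff) auto
  have \<xi>2: "integrable M (\<lambda>\<omega>. (\<xi> \<omega>)\<^sup>2)"
    using integrable_power_le[OF _ \<xi>3, of 2] by simp
  have F: "integrable M (\<lambda>\<omega>. G \<omega> + \<xi> \<omega>)" using G \<xi>1 by simp
  have dF: "integrable M (\<lambda>\<omega>. d (G \<omega> + \<xi> \<omega>))" by (rule integrable_lipschitz[OF d F])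
  have dG: "integrable M (\<lambda>\<omega>. d (G \<omega>))" by (rule integrable_lipschitz[OF d G])
  have f_int: "integrable M (\<lambda>\<omega>. f (Y \<omega>))" if "Y \<in> borel_measurable M" for Y
    using that f_bound by (intro integrable_const_bound[of _ K]) auto
  have \<xi>f: "integrable M (\<lambda>\<omega>. \<xi> \<omega> * f (Y \<omega>))" if [measurable]: "Y \<in> borel_measurable M" for Y
  proof (rule Bochner_Integration.integrable_bound)
    show "integrable M (\<lambda>\<omega>. K * \<xi> \<omega>)" using \<xi>1 by simp
    show "AE \<omega> in M. norm (\<xi> \<omega> * f (Y \<omega>)) \<le> norm (K * \<xi> \<omega>)"
    proof (rule AE_I2)
      fix \<omega>
      have "\<bar>\<xi> \<omega>\<bar> * \<bar>f (Y \<omega>)\<bar> \<le> \<bar>\<xi> \<omega>\<bar> * \<bar>K\<bar>"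
        using f_bound[of "Y \<omega>"] by (intro mult_left_mono) auto
      then show "norm (\<xi> \<omega> * f (Y \<omega>)) \<le> norm (K * \<xi> \<omega>)"
        by (simp add: abs_mult mult.commute)
    qed
  qed measurable
  show "integrable M (\<lambda>\<omega>. \<xi> \<omega> * f (G \<omega> + \<xi> \<omega>))" by (rule \<xi>f) measurable
  have "indep_var borel (id \<circ> \<xi>) borel (f \<circ> G)"
    by (rule indep_var_compose[OF ind]) auto
  then have i1: "indep_var borel \<xi> borel (\<lambda>\<omega>. f (G \<omega>))" by (simp add: comp_def id_def)
  have "indep_var borel ((\<lambda>x. x\<^sup>2) \<circ> \<xi>) borel (d \<circ> G)"
    by (rule indep_var_compose[OF ind]) auto
  then have i2: "indep_var borel (\<lambda>\<omega>. (\<xi> \<omega>)\<^sup>2) borel (\<lambda>\<omega>. d (G \<omega>))" by (simp add: comp_def)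
  have e1: "expectation (\<lambda>\<omega>. \<xi> \<omega> * f (G \<omega>)) = 0"
    using indep_var_lebesgue_integral[OF i1 \<xi>1 f_int] mean by simp
  note e2 = indep_var_lebesgue_integral[OF i2 \<xi>2 dG]
  note int2 = indep_var_integrable[OF i2 \<xi>2 dG]
  define V where "V = expectation (\<lambda>\<omega>. (\<xi> \<omega>)\<^sup>2)"
  have "V \<ge> 0" by (simp add: V_def)
  define R where "R = (\<lambda>\<omega>. \<xi> \<omega> * f (G \<omega> + \<xi> \<omega>) - \<xi> \<omega> * f (G \<omega>) - (\<xi> \<omega>)\<^sup>2 * d (G \<omega>))"
  have R_int: "integrable M R"
    unfolding R_def by (intro Bochner_Integration.integrable_diff \<xi>f int2) measurable
  have "expectation R = expectation (\<lambda>\<omega>. \<xi> \<omega> * f (G \<omega> + \<xi> \<omega>))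
      - expectation (\<lambda>\<omega>. \<xi> \<omega> * f (G \<omega>)) - expectation (\<lambda>\<omega>. (\<xi> \<omega>)\<^sup>2 * d (G \<omega>))"
    unfolding R_def by (simp add: \<xi>f int2)
  then have ER: "expectation R = expectation (\<lambda>\<omega>. \<xi> \<omega> * f (G \<omega> + \<xi> \<omega>))
      - V * expectation (\<lambda>\<omega>. d (G \<omega>))"
    by (simp add: e1 e2 V_def)
  have "\<bar>expectation R\<bar> \<le> expectation (\<lambda>\<omega>. \<bar>R \<omega>\<bar>)" by (rule integral_abs_bound)
  also have "\<dots> \<le> expectation (\<lambda>\<omega>. L * \<bar>\<xi> \<omega>\<bar> ^ 3)"
  proof (rule integral_mono)
    fix \<omega>
    have "R \<omega> = \<xi> \<omega> * (f (G \<omega> + \<xi> \<omega>) - f (G \<omega>) - \<xi> \<omega> * d (G \<omega>))"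
      by (simp add: R_def algebra_simps power2_eq_square)
    then have "\<bar>R \<omega>\<bar> \<le> \<bar>\<xi> \<omega>\<bar> * (L * (\<xi> \<omega>)\<^sup>2)"
      using first_order_taylor_bound[OF f d, of "G \<omega>" "\<xi> \<omega>"]
      by (simp add: abs_mult mult_left_mono)
    then show "\<bar>R \<omega>\<bar> \<le> L * \<bar>\<xi> \<omega>\<bar> ^ 3"
      by (simp add: power3_eq_cube power2_eq_square abs_mult mult_ac)
  qed (use R_int \<xi>3 in auto)
  finally have R: "\<bar>expectation R\<bar> \<le> L * expectation (\<lambda>\<omega>. \<bar>\<xi> \<omega>\<bar> ^ 3)" by simp
  have "\<bar>expectation (\<lambda>\<omega>. d (G \<omega> + \<xi> \<omega>)) - expectation (\<lambda>\<omega>. d (G \<omega>))\<bar>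
      = \<bar>expectation (\<lambda>\<omega>. d (G \<omega> + \<xi> \<omega>) - d (G \<omega>))\<bar>"
    by (simp add: dF dG)
  also have "\<dots> \<le> expectation (\<lambda>\<omega>. \<bar>d (G \<omega> + \<xi> \<omega>) - d (G \<omega>)\<bar>)"
    by (rule integral_abs_bound)
  also have "\<dots> \<le> expectation (\<lambda>\<omega>. L * \<bar>\<xi> \<omega>\<bar>)"
  proof (rule integral_mono)
    fix \<omega> show "\<bar>d (G \<omega> + \<xi> \<omega>) - d (G \<omega>)\<bar> \<le> L * \<bar>\<xi> \<omega>\<bar>"
      using d[of "G \<omega> + \<xi> \<omega>" "G \<omega>"] by simp
  qed (use dF dG \<xi>1 in auto)
  finally have D: "\<bar>expectation (\<lambda>\<omega>. d (G \<omega> + \<xi> \<omega>)) - expectation (\<lambda>\<omega>. d (G \<omega>))\<bar>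
      \<le> L * expectation (\<lambda>\<omega>. \<bar>\<xi> \<omega>\<bar>)" by simp
  have "V * expectation (\<lambda>\<omega>. d (G \<omega> + \<xi> \<omega>)) - expectation (\<lambda>\<omega>. \<xi> \<omega> * f (G \<omega> + \<xi> \<omega>))
      = V * (expectation (\<lambda>\<omega>. d (G \<omega> + \<xi> \<omega>)) - expectation (\<lambda>\<omega>. d (G \<omega>))) - expectation R"
    by (simp add: ER algebra_simps)
  also have "\<bar>\<dots>\<bar> \<le> V * \<bar>expectation (\<lambda>\<omega>. d (G \<omega> + \<xi> \<omega>)) - expectation (\<lambda>\<omega>. d (G \<omega>))\<bar>
      + \<bar>expectation R\<bar>"
    using \<open>V \<ge> 0\<close> by (intro order_trans[OF abs_triangle_ineq4]) (simp add: abs_mult)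
  also have "\<dots> \<le> V * (L * expectation (\<lambda>\<omega>. \<bar>\<xi> \<omega>\<bar>)) + L * expectation (\<lambda>\<omega>. \<bar>\<xi> \<omega>\<bar> ^ 3)"
    using \<open>V \<ge> 0\<close> D R by (intro add_mono mult_left_mono) auto
  finally show "\<bar>expectation (\<lambda>\<omega>. (\<xi> \<omega>)\<^sup>2) * expectation (\<lambda>\<omega>. d (G \<omega> + \<xi> \<omega>))
        - expectation (\<lambda>\<omega>. \<xi> \<omega> * f (G \<omega> + \<xi> \<omega>))\<bar>
      \<le> L * (expectation (\<lambda>\<omega>. \<bar>\<xi> \<omega>\<bar> ^ 3)
          + expectation (\<lambda>\<omega>. (\<xi> \<omega>)\<^sup>2) * expectation (\<lambda>\<omega>. \<bar>\<xi> \<omega>\<bar>))"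
    by (simp add: V_def algebra_simps)
qed

text \<open>The Stein equation rewrites the error as \<open>E [d(F) - F * f(F)]\<close>, and each
  summand of \<open>F\<close> is compared with the rest of the sum, from which it is independent.
  The factor 22 is the Lipschitz constant of \<open>d\<close>.\<close>

lemma normal_approximation_indep_sum_smooth:
  fixes \<xi> :: "'i \<Rightarrow> 'a \<Rightarrow> real" and h h' :: "real \<Rightarrow> real"
  assumes fin: "finite I" and ind: "indep_vars (\<lambda>_. borel) \<xi> I"
    and \<xi>3: "\<And>i. i \<in> I \<Longrightarrow> integrable M (\<lambda>\<omega>. \<bar>\<xi> i \<omega>\<bar> ^ 3)"
    and mean: "\<And>i. i \<in> I \<Longrightarrow> expectation (\<xi> i) = 0"
    and var: "(\<Sum>i\<in>I. expectation (\<lambda>\<omega>. (\<xi> i \<omega>)\<^sup>2)) = 1"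
    and h: "\<And>x. (h has_real_derivative h' x) (at x)" and h'1: "\<And>x. \<bar>h' x\<bar> \<le> 1"
  shows "\<bar>expectation (\<lambda>\<omega>. h (\<Sum>i\<in>I. \<xi> i \<omega>)) - (\<integral>x. std_normal_density x * h x \<partial>lborel)\<bar>
    \<le> 22 * (\<Sum>i\<in>I. expectation (\<lambda>\<omega>. \<bar>\<xi> i \<omega>\<bar> ^ 3)
        + expectation (\<lambda>\<omega>. (\<xi> i \<omega>)\<^sup>2) * expectation (\<lambda>\<omega>. \<bar>\<xi> i \<omega>\<bar>))"
proof -
  obtain f d where f: "\<And>x. (f has_real_derivative d x) (at x)"
    and eq: "\<And>x. d x - x * f x = h x - (\<integral>x. std_normal_density x * h x \<partial>lborel)"
    and f_bound: "\<And>x. \<bar>f x\<bar> \<le> 10" and d: "\<And>x y. \<bar>d x - d y\<bar> \<le> 22 * \<bar>x - y\<bar>"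
    using stein_equation_solution[OF h h'1] by blast
  have m[measurable]: "i \<in> I \<Longrightarrow> \<xi> i \<in> borel_measurable M" for i
    using ind by (auto simp: indep_vars_def)
  have \<xi>1: "integrable M (\<xi> i)" if "i \<in> I" for i
    using integrable_power_le[OF _ \<xi>3[OF that], of 1] that by (subst integrable_abs_iff[symmetric]) auto
  define F where "F = (\<lambda>\<omega>. \<Sum>i\<in>I. \<xi> i \<omega>)"
  have F: "integrable M F" unfolding F_def by (intro Bochner_Integration.integrable_sum \<xi>1)
  have *: "integrable M (\<lambda>\<omega>. \<xi> i \<omega> * f (F \<omega>)) \<and>
      \<bar>expectation (\<lambda>\<omega>. (\<xi> i \<omega>)\<^sup>2) * expectation (\<lambda>\<omega>. d (F \<omega>))
        - expectation (\<lambda>\<omega>. \<xi> i \<omega> * f (F \<omega>))\<bar>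
      \<le> 22 * (expectation (\<lambda>\<omega>. \<bar>\<xi> i \<omega>\<bar> ^ 3)
          + expectation (\<lambda>\<omega>. (\<xi> i \<omega>)\<^sup>2) * expectation (\<lambda>\<omega>. \<bar>\<xi> i \<omega>\<bar>))" if i: "i \<in> I" for i
  proof -
    define G where "G = (\<lambda>\<omega>. \<Sum>j\<in>I - {i}. \<xi> j \<omega>)"
    have FG: "F = (\<lambda>\<omega>. G \<omega> + \<xi> i \<omega>)"
      unfolding F_def G_def using fin i by (auto simp: sum.remove[of I i])
    have "indep_var borel (\<xi> i) borel G"
      unfolding G_def using fin i ind by (intro indep_vars_sum) (auto simp: insert_absorb)
    moreover have "integrable M G"
      unfolding G_def by (intro Bochner_Integration.integrable_sum \<xi>1) auto
    ultimately show ?thesis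
      using stein_leave_one_out[OF _ \<xi>3[OF i] mean[OF i] _ f f_bound d] unfolding FG by blast
  qed
  have dF: "integrable M (\<lambda>\<omega>. d (F \<omega>))" by (rule integrable_lipschitz[OF d F])
  have hF: "integrable M (\<lambda>\<omega>. h (F \<omega>))"
    by (rule integrable_lipschitz[OF lipschitz_from_derivative_bound[OF h h'1] F])
  have "expectation (\<lambda>\<omega>. h (F \<omega>)) - (\<integral>x. std_normal_density x * h x \<partial>lborel)
      = expectation (\<lambda>\<omega>. h (F \<omega>) - (\<integral>x. std_normal_density x * h x \<partial>lborel))"
    using hF by (simp add: prob_space)
  also have "\<dots> = expectation (\<lambda>\<omega>. d (F \<omega>) - (\<Sum>i\<in>I. \<xi> i \<omega> * f (F \<omega>)))"
    by (simp add: eq[symmetric] sum_distrib_right[symmetric] F_def)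
  also have "\<dots> = expectation (\<lambda>\<omega>. d (F \<omega>)) - (\<Sum>i\<in>I. expectation (\<lambda>\<omega>. \<xi> i \<omega> * f (F \<omega>)))"
    using * dF by (simp add: Bochner_Integration.integral_diff Bochner_Integration.integral_sum)
  \<comment> \<open>Here the total variance 1 is used: it distributes \<open>E d(F)\<close> over the
    summands in proportion to their variances.\<close>
  also have "\<dots> = (\<Sum>i\<in>I. expectation (\<lambda>\<omega>. (\<xi> i \<omega>)\<^sup>2) * expectation (\<lambda>\<omega>. d (F \<omega>))
        - expectation (\<lambda>\<omega>. \<xi> i \<omega> * f (F \<omega>)))"
    by (simp add: sum_subtractf sum_distrib_right[symmetric] var)
  also have "\<bar>\<dots>\<bar> \<le> (\<Sum>i\<in>I. 22 * (expectation (\<lambda>\<omega>. \<bar>\<xi> i \<omega>\<bar> ^ 3)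
          + expectation (\<lambda>\<omega>. (\<xi> i \<omega>)\<^sup>2) * expectation (\<lambda>\<omega>. \<bar>\<xi> i \<omega>\<bar>)))"
    using * by (intro order_trans[OF sum_abs] sum_mono) blast
  finally show ?thesis by (simp add: F_def sum_distrib_left)
qed

theorem normal_approximation_indep_sum:
  fixes \<xi> :: "'i \<Rightarrow> 'a \<Rightarrow> real" and h :: "real \<Rightarrow> real"
  assumes fin: "finite I" and ind: "indep_vars (\<lambda>_. borel) \<xi> I"
    and \<xi>3: "\<And>i. i \<in> I \<Longrightarrow> integrable M (\<lambda>\<omega>. \<bar>\<xi> i \<omega>\<bar> ^ 3)"
    and mean: "\<And>i. i \<in> I \<Longrightarrow> expectation (\<xi> i) = 0"
    and var: "(\<Sum>i\<in>I. expectation (\<lambda>\<omega>. (\<xi> i \<omega>)\<^sup>2)) = 1"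
    and lip: "\<And>x y. \<bar>h x - h y\<bar> \<le> \<bar>x - y\<bar>"
  shows "\<bar>expectation (\<lambda>\<omega>. h (\<Sum>i\<in>I. \<xi> i \<omega>)) - (\<integral>x. std_normal_density x * h x \<partial>lborel)\<bar>
    \<le> 22 * (\<Sum>i\<in>I. expectation (\<lambda>\<omega>. \<bar>\<xi> i \<omega>\<bar> ^ 3)
        + expectation (\<lambda>\<omega>. (\<xi> i \<omega>)\<^sup>2) * expectation (\<lambda>\<omega>. \<bar>\<xi> i \<omega>\<bar>))" (is "_ \<le> ?B")
proof (rule field_le_epsilon)
  fix \<epsilon> :: real assume "\<epsilon> > 0"
  then obtain k k' where k: "\<And>x. (k has_real_derivative k' x) (at x)" "\<And>x. \<bar>k' x\<bar> \<le> 1"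
    \<comment> \<open>Smoothing within \<open>\<epsilon> / 2\<close> moves each of the two
      expectations by at most \<open>\<epsilon> / 2\<close>.\<close>
    and close: "\<And>x. \<bar>k x - h x\<bar> \<le> \<epsilon> / 2"
    using lipschitz_smoothing[OF lip, of "\<epsilon> / 2"] by auto
  have [measurable]: "i \<in> I \<Longrightarrow> \<xi> i \<in> borel_measurable M" for i
    using ind by (auto simp: indep_vars_def)
  have \<xi>1: "integrable M (\<xi> i)" if "i \<in> I" for i
    using integrable_power_le[OF _ \<xi>3[OF that], of 1] that by (subst integrable_abs_iff[symmetric]) auto
  define F where "F = (\<lambda>\<omega>. \<Sum>i\<in>I. \<xi> i \<omega>)"
  have F: "integrable M F" unfolding F_def by (intro Bochner_Integration.integrable_sum \<xi>1)
  note k_lip = lipschitz_from_derivative_bound[OF k]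
  have hF: "integrable M (\<lambda>\<omega>. h (F \<omega>))" and kF: "integrable M (\<lambda>\<omega>. k (F \<omega>))"
    using integrable_lipschitz[of h 1, OF _ F] integrable_lipschitz[OF k_lip F] lip by auto
  have "\<bar>expectation (\<lambda>\<omega>. k (F \<omega>)) - expectation (\<lambda>\<omega>. h (F \<omega>))\<bar>
      = \<bar>expectation (\<lambda>\<omega>. k (F \<omega>) - h (F \<omega>))\<bar>"
    by (simp add: hF kF)
  also have "\<dots> \<le> expectation (\<lambda>\<omega>. \<bar>k (F \<omega>) - h (F \<omega>)\<bar>)" by (rule integral_abs_bound)
  also have "\<dots> \<le> expectation (\<lambda>_. \<epsilon> / 2)"
    using close hF kF by (intro integral_mono) auto
  finally have 1: "\<bar>expectation (\<lambda>\<omega>. k (F \<omega>)) - expectation (\<lambda>\<omega>. h (F \<omega>))\<bar> \<le> \<epsilon> / 2"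
    by (simp add: prob_space)
  have int: "integrable lborel (\<lambda>x. std_normal_density x * h x)"
    "integrable lborel (\<lambda>x. std_normal_density x * k x)"
    using lipschitz_std_normal(1)[OF lip] lipschitz_std_normal(1)[of k] k_lip by auto
  have "\<bar>(\<integral>x. std_normal_density x * k x \<partial>lborel) - (\<integral>x. std_normal_density x * h x \<partial>lborel)\<bar>
      = \<bar>\<integral>x. std_normal_density x * k x - std_normal_density x * h x \<partial>lborel\<bar>"
    by (simp add: int)
  also have "\<dots> \<le> (\<integral>x. \<bar>std_normal_density x * k x - std_normal_density x * h x\<bar> \<partial>lborel)"
    by (rule integral_abs_bound)
  also have "\<dots> \<le> (\<integral>x. std_normal_density x * (\<epsilon> / 2) \<partial>lborel)"
  proof (rule integral_mono)
    fix x
    show "\<bar>std_normal_density x * k x - std_normal_density x * h x\<bar> \<le> std_normal_density x * (\<epsilon> / 2)"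
      using close[of x] by (simp add: right_diff_distrib[symmetric] abs_mult mult_left_mono
          del: times_divide_eq_right)
  qed (use int in auto)
  finally have 2: "\<bar>(\<integral>x. std_normal_density x * k x \<partial>lborel) - (\<integral>x. std_normal_density x * h x \<partial>lborel)\<bar>
      \<le> \<epsilon> / 2"
    by simp
  have "\<bar>expectation (\<lambda>\<omega>. k (F \<omega>)) - (\<integral>x. std_normal_density x * k x \<partial>lborel)\<bar> \<le> ?B"
    unfolding F_def by (rule normal_approximation_indep_sum_smooth[OF fin ind \<xi>3 mean var k])
  with 1 2 show "\<bar>expectation (\<lambda>\<omega>. h (\<Sum>i\<in>I. \<xi> i \<omega>)) - (\<integral>x. std_normal_density x * h x \<partial>lborel)\<bar>
      \<le> ?B + \<epsilon>"
    unfolding F_def by linarith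
qed

end

section \<open>Independence via characteristic functions\<close>

context prob_space
begin

lemma integrable_bounded_measurable:
  fixes W :: "'a \<Rightarrow> 'b::{banach, second_countable_topology}"
  assumes "W \<in> borel_measurable M" "\<And>\<omega>. norm (W \<omega>) \<le> B"
  shows "integrable M W"
  using assms by (intro integrable_const_bound[of _ B]) auto

text \<open>After adding a constant, \<open>W\<close> is a positive density, and the uniqueness theorem applies to the
  law of \<open>Z\<close> under the reweighted measure.\<close>

lemma real_weight_char_imp_indep:
  fixes W Z :: "'a \<Rightarrow> real"
  assumes [measurable]: "W \<in> borel_measurable M" "Z \<in> borel_measurable M"
    and bound: "\<And>\<omega>. \<bar>W \<omega>\<bar> \<le> B"
    and char: "\<And>t. (CLINT \<omega>|M. W \<omega> * iexp (t * Z \<omega>))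
        = expectation W * (CLINT \<omega>|M. iexp (t * Z \<omega>))"
    and [measurable]: "A \<in> sets borel"
  shows "expectation (\<lambda>\<omega>. W \<omega> * indicator A (Z \<omega>)) = expectation W * prob (Z -` A \<inter> space M)"
proof -
  \<comment> \<open>\<open>W' \<ge> 1\<close> makes the density nonnegative and its mass
    \<open>c\<close> positive. The constant part satisfies the factorization trivially, so it can be
    subtracted again at the end.\<close>
  define W' where "W' = (\<lambda>\<omega>. W \<omega> + (B + 1))"
  have [measurable]: "W' \<in> borel_measurable M" by (simp add: W'_def)
  have W'_ge: "W' \<omega> \<ge> 1" for \<omega> using bound[of \<omega>] by (simp add: W'_def abs_le_iff)
  have W'_le: "W' \<omega> \<le> 2 * B + 1" for \<omega> using bound[of \<omega>] by (simp add: W'_def abs_le_iff)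
  have intW: "integrable M W" using bound by (intro integrable_bounded_measurable[of _ B]) auto
  have intW': "integrable M W'" unfolding W'_def using intW by simp
  define c where "c = expectation W'"
  have c: "c = expectation W + (B + 1)" by (simp add: c_def W'_def intW prob_space)
  have "1 \<le> c"
    using integral_mono[of M "\<lambda>_. 1" W'] intW' W'_ge by (simp add: c_def prob_space)
  then have "c > 0" by simp
  define D where "D = density M (\<lambda>\<omega>. W' \<omega> / c)"
  have W'_nn: "0 \<le> W' \<omega> / c" for \<omega> using W'_ge[of \<omega>] \<open>c > 0\<close> by simp
  have "prob_space D"
  proof
    have "emeasure D (space D) = (\<integral>\<^sup>+\<omega>. ennreal (W' \<omega> / c) \<partial>M)"
      by (simp add: D_def emeasure_density cong: nn_integral_cong)
    also have "\<dots> = ennreal (expectation (\<lambda>\<omega>. W' \<omega> / c))"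
      using intW' W'_nn by (intro nn_integral_eq_integral) auto
    also have "\<dots> = 1" using \<open>c > 0\<close> by (simp add: c_def[symmetric])
    finally show "emeasure D (space D) = 1" .
  qed
  then interpret D: prob_space D .
  have [measurable]: "Z \<in> borel_measurable D" by (simp add: D_def)
  have d1: "real_distribution (distr D borel Z)" by (rule D.real_distribution_distr) measurable
  have d2: "real_distribution (distr M borel Z)" by (rule real_distribution_distr) measurable
  have intZ: "integrable M (\<lambda>\<omega>. iexp (t * Z \<omega>))" for t
    by (rule integrable_bounded_measurable[of _ 1]) auto
  have intWZ: "integrable M (\<lambda>\<omega>. W \<omega> * iexp (t * Z \<omega>))" for t
    using bound by (intro integrable_bounded_measurable[of _ B]) (auto simp: norm_mult)
  have "char (distr D borel Z) t = char (distr M borel Z) t" for t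
  proof -
    have "char (distr D borel Z) t = (CLINT \<omega>|D. iexp (t * Z \<omega>))"
      by (simp add: char_def integral_distr)
    also have "\<dots> = (CLINT \<omega>|M. (W' \<omega> / c) *\<^sub>R iexp (t * Z \<omega>))"
      unfolding D_def using W'_nn by (intro integral_density) auto
    also have "\<dots> = (CLINT \<omega>|M. complex_of_real (1 / c) * (W \<omega> * iexp (t * Z \<omega>) + (B + 1) * iexp (t * Z \<omega>)))"
      by (intro Bochner_Integration.integral_cong refl)
         (simp add: W'_def scaleR_conv_of_real field_simps)
    also have "\<dots> = complex_of_real (1 / c) *
        ((CLINT \<omega>|M. W \<omega> * iexp (t * Z \<omega>)) + (CLINT \<omega>|M. (B + 1) * iexp (t * Z \<omega>)))"
      by (subst integral_mult_right_zero, subst Bochner_Integration.integral_add)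
         (auto intro!: intWZ intZ integrable_mult_right simp del: of_real_divide of_real_add of_real_mult)
    also have "(CLINT \<omega>|M. (B + 1) * iexp (t * Z \<omega>)) = (B + 1) * (CLINT \<omega>|M. iexp (t * Z \<omega>))"
      by (rule integral_mult_right_zero)
    also have "complex_of_real (1 / c) * ((CLINT \<omega>|M. W \<omega> * iexp (t * Z \<omega>)) + \<dots>)
        = complex_of_real (1 / c) * complex_of_real c * (CLINT \<omega>|M. iexp (t * Z \<omega>))"
      by (simp only: char c of_real_add) (simp only: algebra_simps)
    also have "\<dots> = char (distr M borel Z) t"
      using \<open>c > 0\<close> by (simp add: char_def integral_distr)
    finally show ?thesis .
  qed
  then have "distr D borel Z = distr M borel Z"
    by (intro Levy_uniqueness d1 d2 ext)
  then have "measure (distr D borel Z) A = measure (distr M borel Z) A" by simp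
  then have "measure D (Z -` A \<inter> space M) = prob (Z -` A \<inter> space M)"
    by (simp add: measure_distr D_def)
  moreover have "measure D (Z -` A \<inter> space M) = expectation (\<lambda>\<omega>. indicator A (Z \<omega>) * (W' \<omega> / c))"
  proof -
    have "measure D (Z -` A \<inter> space M) = (\<integral>\<omega>. indicator (Z -` A \<inter> space M) \<omega> \<partial>D)"
      by (simp add: D_def)
    also have "\<dots> = expectation (\<lambda>\<omega>. (W' \<omega> / c) *\<^sub>R indicator (Z -` A \<inter> space M) \<omega>)"
      unfolding D_def using W'_nn by (intro integral_density) auto
    also have "\<dots> = expectation (\<lambda>\<omega>. indicator A (Z \<omega>) * (W' \<omega> / c))"
      by (intro Bochner_Integration.integral_cong refl) (auto simp: indicator_def)
    finally show ?thesis .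
  qed
  ultimately have "expectation (\<lambda>\<omega>. indicator A (Z \<omega>) * (W' \<omega> / c)) = prob (Z -` A \<inter> space M)"
    by simp
  then have e1: "expectation (\<lambda>\<omega>. indicator A (Z \<omega>) * W' \<omega>) = c * prob (Z -` A \<inter> space M)"
    using \<open>c > 0\<close> by (simp add: field_simps)
  have i1: "integrable M (\<lambda>\<omega>. W \<omega> * indicator A (Z \<omega>))"
    using bound by (intro integrable_bounded_measurable[of _ B])
      (auto simp: indicator_def intro: order_trans[OF abs_ge_zero])
  have i2: "integrable M (\<lambda>\<omega>. indicator A (Z \<omega>) :: real)"
    by (intro integrable_bounded_measurable[of _ 1]) (auto simp: indicator_def)
  have e2: "expectation (\<lambda>\<omega>. indicator A (Z \<omega>)) = prob (Z -` A \<inter> space M)"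
  proof -
    have "expectation (\<lambda>\<omega>. indicat_real A (Z \<omega>)) = expectation (indicator (Z -` A \<inter> space M))"
      by (intro Bochner_Integration.integral_cong refl) (auto simp: indicator_def)
    then show ?thesis by simp
  qed
  have "expectation (\<lambda>\<omega>. indicator A (Z \<omega>) * W' \<omega>)
      = expectation (\<lambda>\<omega>. W \<omega> * indicator A (Z \<omega>) + (B + 1) * indicator A (Z \<omega>))"
    by (intro Bochner_Integration.integral_cong refl) (simp add: W'_def algebra_simps)
  also have "\<dots> = expectation (\<lambda>\<omega>. W \<omega> * indicator A (Z \<omega>)) + (B + 1) * prob (Z -` A \<inter> space M)"
    by (subst Bochner_Integration.integral_add) (auto simp: i1 i2 e2 intro: integrable_mult_right)
  finally show ?thesis using e1 c by (simp add: algebra_simps)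
qed

text \<open>Conjugating the hypothesis at \<open>- t\<close> gives it for \<open>cnj W\<close> at
  \<open>t\<close>. It then holds for the real and imaginary parts of \<open>W\<close>, which are
  linear combinations of \<open>W\<close> and \<open>cnj W\<close>, and the real case applies to
  each.\<close>

lemma complex_weight_char_imp_indep:
  fixes W :: "'a \<Rightarrow> complex" and Z :: "'a \<Rightarrow> real"
  assumes [measurable]: "W \<in> borel_measurable M" "Z \<in> borel_measurable M"
    and bound: "\<And>\<omega>. norm (W \<omega>) \<le> B"
    and char: "\<And>t. (CLINT \<omega>|M. W \<omega> * iexp (t * Z \<omega>))
        = (CLINT \<omega>|M. W \<omega>) * (CLINT \<omega>|M. iexp (t * Z \<omega>))"
    and [measurable]: "A \<in> sets borel"
  shows "(CLINT \<omega>|M. W \<omega> * indicator A (Z \<omega>)) = (CLINT \<omega>|M. W \<omega>) * prob (Z -` A \<inter> space M)"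
proof -
  have [measurable]: "cnj \<in> borel_measurable borel"
    by (intro borel_measurable_continuous_onI continuous_intros)
  have int: "integrable M W" using bound by (intro integrable_bounded_measurable) auto
  have intZ: "integrable M (\<lambda>\<omega>. W \<omega> * iexp (t * Z \<omega>))" for t
    using bound by (intro integrable_bounded_measurable[of _ B]) (auto simp: norm_mult)
  have char_cnj: "(CLINT \<omega>|M. cnj (W \<omega>) * iexp (t * Z \<omega>))
      = cnj (CLINT \<omega>|M. W \<omega>) * (CLINT \<omega>|M. iexp (t * Z \<omega>))" for t
  proof -
    have "(CLINT \<omega>|M. cnj (W \<omega>) * iexp (t * Z \<omega>)) = (CLINT \<omega>|M. cnj (W \<omega> * iexp (- t * Z \<omega>)))"
      by (intro Bochner_Integration.integral_cong refl) (simp add: exp_cnj)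
    also have "\<dots> = cnj (CLINT \<omega>|M. W \<omega> * iexp (- t * Z \<omega>))"
      by (rule Bochner_Integration.integral_cnj)
    also have "\<dots> = cnj ((CLINT \<omega>|M. W \<omega>) * (CLINT \<omega>|M. iexp (- t * Z \<omega>)))"
      by (simp only: char)
    also have "\<dots> = cnj (CLINT \<omega>|M. W \<omega>) * (CLINT \<omega>|M. cnj (iexp (- t * Z \<omega>)))"
      by (simp only: complex_cnj_mult Bochner_Integration.integral_cnj[symmetric])
    also have "(\<lambda>\<omega>. cnj (iexp (- t * Z \<omega>))) = (\<lambda>\<omega>. iexp (t * Z \<omega>))"
      by (simp add: exp_cnj)
    finally show ?thesis .
  qed
  have intZc: "integrable M (\<lambda>\<omega>. cnj (W \<omega>) * iexp (t * Z \<omega>))" for t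
    using bound by (intro integrable_bounded_measurable[of _ B]) (auto simp: norm_mult)
  have re: "expectation (\<lambda>\<omega>. Re (W \<omega>) * indicator A (Z \<omega>))
      = expectation (\<lambda>\<omega>. Re (W \<omega>)) * prob (Z -` A \<inter> space M)"
  proof (rule real_weight_char_imp_indep[of _ _ B])
    fix \<omega> show "\<bar>Re (W \<omega>)\<bar> \<le> B" using abs_Re_le_cmod[of "W \<omega>"] bound[of \<omega>] by linarith
  next
    fix t
    have "(CLINT \<omega>|M. Re (W \<omega>) * iexp (t * Z \<omega>))
        = (CLINT \<omega>|M. 1 / 2 * (W \<omega> * iexp (t * Z \<omega>) + cnj (W \<omega>) * iexp (t * Z \<omega>)))"
      by (intro Bochner_Integration.integral_cong refl)
         (simp add: distrib_right[symmetric] complex_add_cnj)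
    also have "\<dots> = 1 / 2 * ((CLINT \<omega>|M. W \<omega> * iexp (t * Z \<omega>)) + (CLINT \<omega>|M. cnj (W \<omega>) * iexp (t * Z \<omega>)))"
      by (subst integral_mult_right_zero, subst Bochner_Integration.integral_add) (auto intro!: intZ intZc simp del: of_real_mult)
    also have "\<dots> = 1 / 2 * ((CLINT \<omega>|M. W \<omega>) + cnj (CLINT \<omega>|M. W \<omega>)) * (CLINT \<omega>|M. iexp (t * Z \<omega>))"
      by (simp only: char char_cnj) (simp only: algebra_simps)
    also have "\<dots> = expectation (\<lambda>\<omega>. Re (W \<omega>)) * (CLINT \<omega>|M. iexp (t * Z \<omega>))"
      by (simp add: complex_add_cnj int)
    finally show "(CLINT \<omega>|M. Re (W \<omega>) * iexp (t * Z \<omega>))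
        = expectation (\<lambda>\<omega>. Re (W \<omega>)) * (CLINT \<omega>|M. iexp (t * Z \<omega>))" .
  qed auto
  have im_eq: "1 / (2 * \<i>) * (complex_of_real (2 * y) * \<i>) = y" for y
    by (simp add: complex_eq_iff)
  have im: "expectation (\<lambda>\<omega>. Im (W \<omega>) * indicator A (Z \<omega>))
      = expectation (\<lambda>\<omega>. Im (W \<omega>)) * prob (Z -` A \<inter> space M)"
  proof (rule real_weight_char_imp_indep[of _ _ B])
    fix \<omega> show "\<bar>Im (W \<omega>)\<bar> \<le> B" using abs_Im_le_cmod[of "W \<omega>"] bound[of \<omega>] by linarith
  next
    fix t
    have "(CLINT \<omega>|M. Im (W \<omega>) * iexp (t * Z \<omega>))
        = (CLINT \<omega>|M. 1 / (2 * \<i>) * (W \<omega> * iexp (t * Z \<omega>) - cnj (W \<omega>) * iexp (t * Z \<omega>)))"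
      by (intro Bochner_Integration.integral_cong refl)
         (simp only: left_diff_distrib[symmetric] complex_diff_cnj mult.assoc[symmetric] im_eq[unfolded mult.assoc[symmetric]])
    also have "\<dots> = 1 / (2 * \<i>) * ((CLINT \<omega>|M. W \<omega> * iexp (t * Z \<omega>)) - (CLINT \<omega>|M. cnj (W \<omega>) * iexp (t * Z \<omega>)))"
      by (subst integral_mult_right_zero, subst Bochner_Integration.integral_diff) (auto intro!: intZ intZc simp del: of_real_mult)
    also have "\<dots> = 1 / (2 * \<i>) * ((CLINT \<omega>|M. W \<omega>) - cnj (CLINT \<omega>|M. W \<omega>)) * (CLINT \<omega>|M. iexp (t * Z \<omega>))"
      by (simp only: char char_cnj) (simp only: algebra_simps)
    also have "\<dots> = expectation (\<lambda>\<omega>. Im (W \<omega>)) * (CLINT \<omega>|M. iexp (t * Z \<omega>))"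
      by (simp only: complex_diff_cnj im_eq integral_Im[OF int])
    finally show "(CLINT \<omega>|M. Im (W \<omega>) * iexp (t * Z \<omega>))
        = expectation (\<lambda>\<omega>. Im (W \<omega>)) * (CLINT \<omega>|M. iexp (t * Z \<omega>))" .
  qed auto
  have intA: "integrable M (\<lambda>\<omega>. W \<omega> * indicator A (Z \<omega>))"
    using bound by (intro integrable_bounded_measurable[of _ B])
      (auto simp: indicator_def intro: order_trans[OF norm_ge_zero])
  have eqRe: "Re (W \<omega> * indicator A (Z \<omega>)) = Re (W \<omega>) * indicator A (Z \<omega>)"
    and eqIm: "Im (W \<omega> * indicator A (Z \<omega>)) = Im (W \<omega>) * indicator A (Z \<omega>)" for \<omega>
    by (auto simp: indicator_def)
  show ?thesis
    by (rule complex_eqI)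
       (simp_all only: integral_Re[OF intA, symmetric] integral_Im[OF intA, symmetric] eqRe eqIm re im,
        simp_all add: int)
qed

text \<open>The variables are converted from exponentials to indicators one at a time: \<open>J\<close> collects
  those already converted.\<close>

lemma indicator_char_factorization:
  fixes Z :: "'i \<Rightarrow> 'a \<Rightarrow> real"
  assumes fin: "finite I" and [measurable]: "\<And>i. i \<in> I \<Longrightarrow> Z i \<in> borel_measurable M"
    and char: "\<And>t. (CLINT \<omega>|M. (\<Prod>i\<in>I. iexp (t i * Z i \<omega>)))
        = (\<Prod>i\<in>I. CLINT \<omega>|M. iexp (t i * Z i \<omega>))"
    and A: "\<And>i. i \<in> I \<Longrightarrow> A i \<in> sets borel" and "J \<subseteq> I"
  shows "(CLINT \<omega>|M. (\<Prod>i\<in>J. indicator (A i) (Z i \<omega>)) * (\<Prod>i\<in>I - J. iexp (t i * Z i \<omega>)))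
    = (\<Prod>i\<in>J. complex_of_real (prob (Z i -` A i \<inter> space M)))
      * (\<Prod>i\<in>I - J. CLINT \<omega>|M. iexp (t i * Z i \<omega>))"
  using finite_subset[OF \<open>J \<subseteq> I\<close> fin] \<open>J \<subseteq> I\<close>
proof (induction J arbitrary: t rule: finite_induct)
  case empty
  then show ?case using char[of t] by simp
next
  case (insert m J)
  have [measurable]: "A i \<in> sets borel" if "i \<in> I" for i by (rule A[OF that])
  have mI: "m \<in> I" and JI: "J \<subseteq> I" using insert.prems by auto
  define K where "K = I - insert m J"
  have K: "I - J = insert m K" "m \<notin> K" "finite K" "K \<subseteq> I"
    using insert mI fin by (auto simp: K_def)
  define W where "W = (\<lambda>\<omega>. (\<Prod>i\<in>J. indicator (A i) (Z i \<omega>)) * (\<Prod>i\<in>K. iexp (t i * Z i \<omega>)) :: complex)"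
  define c where "c = (\<Prod>i\<in>J. complex_of_real (prob (Z i -` A i \<inter> space M)))
      * (\<Prod>i\<in>K. CLINT \<omega>|M. iexp (t i * Z i \<omega>))"
  have step: "(CLINT \<omega>|M. W \<omega> * iexp (s * Z m \<omega>)) = c * (CLINT \<omega>|M. iexp (s * Z m \<omega>))" for s
  proof -
    \<comment> \<open>The induction hypothesis is needed for every frequency in the coordinate
      \<open>m\<close>, so that the law of \<open>Z m\<close> is tested completely.\<close>
    define t' where "t' = t(m := s)"
    have t': "t' m = s" "\<And>i. i \<in> K \<Longrightarrow> t' i = t i" using K by (auto simp: t'_def)
    have "(CLINT \<omega>|M. (\<Prod>i\<in>J. indicator (A i) (Z i \<omega>)) * (\<Prod>i\<in>I - J. iexp (t' i * Z i \<omega>)))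
      = (\<Prod>i\<in>J. complex_of_real (prob (Z i -` A i \<inter> space M)))
        * (\<Prod>i\<in>I - J. CLINT \<omega>|M. iexp (t' i * Z i \<omega>))"
      by (rule insert.IH[OF JI])
    moreover have "(\<Prod>i\<in>J. indicator (A i) (Z i \<omega>)) * (\<Prod>i\<in>I - J. iexp (t' i * Z i \<omega>))
        = W \<omega> * iexp (s * Z m \<omega>)" for \<omega>
      using K by (simp add: W_def t' mult_ac cong: prod.cong)
    moreover have "(\<Prod>i\<in>J. complex_of_real (prob (Z i -` A i \<inter> space M)))
        * (\<Prod>i\<in>I - J. CLINT \<omega>|M. iexp (t' i * Z i \<omega>)) = c * (CLINT \<omega>|M. iexp (s * Z m \<omega>))"
      using K by (simp add: c_def t' mult_ac cong: prod.cong)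
    ultimately show ?thesis by simp
  qed
  \<comment> \<open>Frequency 0 identifies the constant as the mean of the weight \<open>W\<close>,
    which is the form that the one-variable lemma expects.\<close>
  from step[of 0] have c: "c = (CLINT \<omega>|M. W \<omega>)" by (simp add: prob_space)
  have [measurable]: "W \<in> borel_measurable M"
    unfolding W_def using JI K mI by (intro borel_measurable_times borel_measurable_prod) auto
  have "norm (W \<omega>) \<le> 1" for \<omega>
  proof -
    have "norm (\<Prod>i\<in>J. indicator (A i) (Z i \<omega>) :: complex) \<le> 1"
      unfolding prod_norm[symmetric] by (rule prod_le_1) (auto simp: indicator_def)
    then show ?thesis by (simp add: W_def norm_mult prod_norm[symmetric])
  qed
  then have "(CLINT \<omega>|M. W \<omega> * indicator (A m) (Z m \<omega>)) = c * prob (Z m -` A m \<inter> space M)"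
    unfolding c using step c mI by (intro complex_weight_char_imp_indep[of _ _ 1]) auto
  then show ?case
    using insert.hyps by (simp add: W_def c_def K_def mult_ac)
qed

theorem indep_vars_if_char_factorizes:
  fixes Z :: "'i \<Rightarrow> 'a \<Rightarrow> real"
  assumes fin: "finite I" and Z[measurable]: "\<And>i. i \<in> I \<Longrightarrow> Z i \<in> borel_measurable M"
    and char: "\<And>t. (CLINT \<omega>|M. (\<Prod>i\<in>I. iexp (t i * Z i \<omega>)))
        = (\<Prod>i\<in>I. CLINT \<omega>|M. iexp (t i * Z i \<omega>))"
  shows "indep_vars (\<lambda>_. borel) Z I"
\<comment> \<open>An empty intersection would be \<open>UNIV\<close>, which need not be the sample
  space.\<close>
proof (cases "I = {}")
  case True
  then show ?thesis by (simp add: indep_vars_def indep_sets_def)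
next
  case False
  have "prob (\<Inter>j\<in>I. Z j -` A j \<inter> space M) = (\<Prod>j\<in>I. prob (Z j -` A j \<inter> space M))"
    if A: "A \<in> (\<Pi> i\<in>I. sets borel)" for A
  proof -
    have [measurable]: "A i \<in> sets borel" if "i \<in> I" for i using A that by auto
    have E[measurable]: "(\<Inter>j\<in>I. Z j -` A j \<inter> space M) \<in> events"
      using fin False by (intro sets.finite_INT) auto
    have "complex_of_real (prob (\<Inter>j\<in>I. Z j -` A j \<inter> space M))
        = (CLINT \<omega>|M. complex_of_real (indicator (\<Inter>j\<in>I. Z j -` A j \<inter> space M) \<omega>))"
      using E by (subst integral_complex_of_real) simp
    also have "\<dots> = (CLINT \<omega>|M. (\<Prod>i\<in>I. indicator (A i) (Z i \<omega>)))"
    proof (intro Bochner_Integration.integral_cong refl)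
      fix \<omega> assume "\<omega> \<in> space M"
      then show "complex_of_real (indicator (\<Inter>j\<in>I. Z j -` A j \<inter> space M) \<omega>)
          = (\<Prod>i\<in>I. indicator (A i) (Z i \<omega>))"
        using fin False by (auto simp: indicator_def)
    qed
    also have "\<dots> = complex_of_real (\<Prod>j\<in>I. prob (Z j -` A j \<inter> space M))"
      \<comment> \<open>With \<open>J = I\<close> no exponential is left, so the frequencies are
        immaterial and are set to 0.\<close>
      using indicator_char_factorization[OF fin Z char _ subset_refl, of A "\<lambda>_. 0"] A by auto
    finally show ?thesis by (simp only: of_real_eq_iff)
  qed
  then show ?thesis
    using False fin by (subst indep_vars_finite[where E="\<lambda>_. sets borel"])
      (auto simp: Int_stable_def sets.sigma_sets_eq[of borel, simplified])
qed

end

section \<open>Wiener integrals\<close>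

context prob_space
begin

lemma L1_le_L2:
  fixes Y :: "'a \<Rightarrow> real"
  assumes [measurable]: "Y \<in> borel_measurable M" and sq: "integrable M (\<lambda>\<omega>. (Y \<omega>)\<^sup>2)"
  shows "integrable M Y" and "expectation (\<lambda>\<omega>. \<bar>Y \<omega>\<bar>) \<le> sqrt (expectation (\<lambda>\<omega>. (Y \<omega>)\<^sup>2))"
proof -
  show int: "integrable M Y"
    using integrable_power_le[of Y 2 1] sq by (subst integrable_abs_iff[symmetric]) auto
  have "0 \<le> variance (\<lambda>\<omega>. \<bar>Y \<omega>\<bar>)" by (rule variance_positive)
  also have "\<dots> = expectation (\<lambda>\<omega>. (Y \<omega>)\<^sup>2) - (expectation (\<lambda>\<omega>. \<bar>Y \<omega>\<bar>))\<^sup>2"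
    using int sq by (subst variance_eq) auto
  finally show "expectation (\<lambda>\<omega>. \<bar>Y \<omega>\<bar>) \<le> sqrt (expectation (\<lambda>\<omega>. (Y \<omega>)\<^sup>2))"
    by (intro real_le_rsqrt) simp
qed

lemma distr_eq_std_normal_iff:
  assumes [measurable]: "Y \<in> borel_measurable M"
  shows "distributed M lborel Y std_normal_density \<longleftrightarrow> distr M borel Y = std_normal_distribution"
proof -
  have "distr M lborel Y = distr M borel Y" by (rule distr_cong) auto
  then show ?thesis by (auto simp: distributed_def)
qed

text \<open>Expressing the exponent through the second moment covers the point mass at 0 by the same
  formula, and under the isometry the second moment becomes a squared norm.\<close>

lemma char_centered_gaussian:
  assumes "centered_gaussian M Y"
  shows "(CLINT \<omega>|M. iexp (t * Y \<omega>)) = exp (- (t\<^sup>2 * expectation (\<lambda>\<omega>. (Y \<omega>)\<^sup>2) / 2))"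
proof -
  have [measurable]: "Y \<in> borel_measurable M" using assms by (simp add: centered_gaussian_def)
  consider "AE \<omega> in M. Y \<omega> = 0" | s where "s > 0" "distributed M lborel Y (normal_density 0 s)"
    using assms by (auto simp: centered_gaussian_def)
  then show ?thesis
  proof cases
    case 1
    have "(CLINT \<omega>|M. iexp (t * Y \<omega>)) = (CLINT \<omega>|M. 1)"
      by (rule integral_cong_AE) (use 1 in auto)
    moreover have "expectation (\<lambda>\<omega>. (Y \<omega>)\<^sup>2) = expectation (\<lambda>\<omega>. 0)"
      by (rule integral_cong_AE) (use 1 in auto)
    ultimately show ?thesis by (simp add: prob_space)
  next
    case 2
    define N where "N = (\<lambda>\<omega>. Y \<omega> / s)"
    have [measurable]: "N \<in> borel_measurable M" by (simp add: N_def)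
    have "distributed M lborel N std_normal_density"
      using 2 normal_standard_normal_convert[of s Y 0] by (simp add: N_def)
    then have N: "distr M borel N = std_normal_distribution" by (simp add: distr_eq_std_normal_iff)
    have Y: "Y = (\<lambda>\<omega>. s * N \<omega>)" using \<open>s > 0\<close> by (simp add: N_def)
    have "(CLINT \<omega>|M. iexp (t * Y \<omega>)) = (CLINT \<omega>|M. iexp ((t * s) * N \<omega>))"
      by (simp add: Y mult_ac)
    also have "\<dots> = char (distr M borel N) (t * s)"
      by (simp add: char_def integral_distr)
    also have "\<dots> = exp (- (t\<^sup>2 * s\<^sup>2 / 2))"
      by (simp only: N char_std_normal_distribution power_mult_distrib minus_divide_left)
    also have "s\<^sup>2 = expectation (\<lambda>\<omega>. (Y \<omega>)\<^sup>2)"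
    proof -
      have "expectation (\<lambda>\<omega>. (N \<omega>)\<^sup>2) = (\<integral>x. x\<^sup>2 \<partial>distr M borel N)"
        by (simp add: integral_distr)
      also have "\<dots> = 1"
        using std_normal_distribution_even_moments(1)[of 1] by (simp add: N)
      finally show ?thesis by (simp add: Y power_mult_distrib)
    qed
    finally show ?thesis .
  qed
qed

lemma iexp_lipschitz: "cmod (iexp x - iexp y) \<le> \<bar>x - y\<bar>"
proof -
  have "iexp x - iexp y = iexp y * (iexp (x - y) - 1)"
    by (simp add: algebra_simps exp_diff)
  then have "cmod (iexp x - iexp y) = cmod (iexp (x - y) - 1)"
    by (simp add: norm_mult)
  also have "\<dots> \<le> \<bar>x - y\<bar>"
    using iexp_approx1[of "x - y" 0] by simp
  finally show ?thesis .
qed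

end

locale wiener_integral_gaussian = prob_space M
  for M :: "'w measure" and G :: "real \<Rightarrow> 'w \<Rightarrow> real"
    and e :: "real \<Rightarrow> 'h :: {real_inner, complete_space}" and I :: "'h \<Rightarrow> 'w \<Rightarrow> real" +
  assumes gaussian: "centered_gaussian_process M {0..} G"
    and hilbert: "associated_hilbert_space M G e"
    and wiener: "wiener_integral M G e I"
begin

lemma I_measurable[measurable]: "I g \<in> borel_measurable M"
  and I_square_integrable: "integrable M (\<lambda>\<omega>. (I g \<omega>)\<^sup>2)"
  and I_linear: "AE \<omega> in M. I (a *\<^sub>R g + b *\<^sub>R g') \<omega> = a * I g \<omega> + b * I g' \<omega>"
  and I_isometry: "expectation (\<lambda>\<omega>. I g \<omega> * I g' \<omega>) = g \<bullet> g'"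
  and I_e: "t \<ge> 0 \<Longrightarrow> AE \<omega> in M. I (e t) \<omega> = G t \<omega>"
  using wiener by (auto simp: wiener_integral_def)

lemma I_norm: "expectation (\<lambda>\<omega>. (I g \<omega>)\<^sup>2) = (norm g)\<^sup>2"
  using I_isometry[of g g] by (simp add: power2_eq_square[symmetric] power2_norm_eq_inner)

lemma I_sum:
  assumes "finite F"
  shows "AE \<omega> in M. I (\<Sum>t\<in>F. c t *\<^sub>R x t) \<omega> = (\<Sum>t\<in>F. c t * I (x t) \<omega>)"
  using assms
proof (induction F rule: finite_induct)
  case empty
  show ?case using I_linear[of 0 0 0 0] by simp
next
  case (insert s F)
  have "AE \<omega> in M. I (c s *\<^sub>R x s + 1 *\<^sub>R (\<Sum>t\<in>F. c t *\<^sub>R x t)) \<omega>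
      = c s * I (x s) \<omega> + 1 * I (\<Sum>t\<in>F. c t *\<^sub>R x t) \<omega>"
    by (rule I_linear)
  with insert.IH show ?case
    using insert.hyps by (auto elim!: eventually_elim2)
qed

text \<open>On the span, \<open>I g\<close> is almost surely a finite combination of values of
  \<open>G\<close>, hence Gaussian by hypothesis.\<close>

lemma char_I_span:
  assumes "g \<in> span (e ` {0..})"
  shows "(CLINT \<omega>|M. iexp (s * I g \<omega>)) = exp (- (s\<^sup>2 * (norm g)\<^sup>2 / 2))"
proof -
  obtain T r where T: "finite T" "T \<subseteq> e ` {0..}" "g = (\<Sum>a\<in>T. r a *\<^sub>R a)"
    using assms by (auto simp: span_explicit)
  \<comment> \<open>\<open>e\<close> need not be injective. One time per vector is selected, so that
    no coefficient is counted twice.\<close>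
  from T(2) obtain F where F: "F \<subseteq> {0..}" "inj_on e F" "T = e ` F"
    unfolding subset_image_inj by blast
  with \<open>finite T\<close> have fin: "finite F" by (simp add: finite_image_iff)
  define c where "c = (\<lambda>t. r (e t))"
  define Y where "Y = (\<lambda>\<omega>. \<Sum>t\<in>F. c t * G t \<omega>)"
  have Y: "centered_gaussian M Y"
    using gaussian F(1) fin by (simp add: centered_gaussian_process_def Y_def)
  then have [measurable]: "Y \<in> borel_measurable M" by (simp add: centered_gaussian_def)
  have g: "g = (\<Sum>t\<in>F. c t *\<^sub>R e t)"
    using T F by (simp add: sum.reindex c_def)
  have "AE \<omega> in M. \<forall>t\<in>F. I (e t) \<omega> = G t \<omega>"
    using F(1) I_e by (intro AE_finite_allI[OF fin]) auto
  with I_sum[OF fin, of c e] have AE: "AE \<omega> in M. I g \<omega> = Y \<omega>"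
    by eventually_elim (simp add: g Y_def)
  have "(CLINT \<omega>|M. iexp (s * I g \<omega>)) = (CLINT \<omega>|M. iexp (s * Y \<omega>))"
    by (rule integral_cong_AE) (use AE in auto)
  moreover have "expectation (\<lambda>\<omega>. (I g \<omega>)\<^sup>2) = expectation (\<lambda>\<omega>. (Y \<omega>)\<^sup>2)"
    by (rule integral_cong_AE) (use AE in auto)
  ultimately show ?thesis
    using char_centered_gaussian[OF Y, of s] by (simp add: I_norm)
qed

text \<open>The span is dense, and the characteristic function at \<open>s\<close> is Lipschitz in
  \<open>g\<close> with constant \<open>\<bar>s\<bar>\<close>, because
  \<open>x \<mapsto> exp (i x)\<close> is 1-Lipschitz and the L1 norm of \<open>I (x n - g)\<close>
  is at most its L2 norm, which is \<open>norm (x n - g)\<close>.\<close>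

lemma char_I: "(CLINT \<omega>|M. iexp (s * I g \<omega>)) = exp (- (s\<^sup>2 * (norm g)\<^sup>2 / 2))"
proof -
  have "g \<in> closure (span (e ` {0..}))"
    using hilbert by (simp add: associated_hilbert_space_def)
  then obtain x where x: "\<And>n. x n \<in> span (e ` {0..})" and lim: "x \<longlonglongrightarrow> g"
    by (auto simp: closure_sequential)
  define \<phi> where "\<phi> = (\<lambda>g. CLINT \<omega>|M. iexp (s * I g \<omega>))"
  have bound: "norm (\<phi> (x n) - \<phi> g) \<le> \<bar>s\<bar> * norm (x n - g)" for n
  proof -
    have int: "integrable M (\<lambda>\<omega>. iexp (s * I g \<omega>))" for g
      by (rule integrable_bounded_measurable[of _ 1]) auto
    have int_I: "integrable M (I g)" for g by (rule L1_le_L2 I_measurable I_square_integrable)+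
    have "\<phi> (x n) - \<phi> g = (CLINT \<omega>|M. iexp (s * I (x n) \<omega>) - iexp (s * I g \<omega>))"
      unfolding \<phi>_def using int by (subst Bochner_Integration.integral_diff) auto
    also have "norm \<dots> \<le> (\<integral>\<omega>. norm (iexp (s * I (x n) \<omega>) - iexp (s * I g \<omega>)) \<partial>M)"
      by (rule integral_norm_bound)
    also have "\<dots> \<le> (\<integral>\<omega>. \<bar>s\<bar> * \<bar>I (x n - g) \<omega>\<bar> \<partial>M)"
    proof (rule integral_mono_AE)
      show "integrable M (\<lambda>\<omega>. norm (iexp (s * I (x n) \<omega>) - iexp (s * I g \<omega>)))"
        by (intro integrable_norm Bochner_Integration.integrable_diff int)
      show "integrable M (\<lambda>\<omega>. \<bar>s\<bar> * \<bar>I (x n - g) \<omega>\<bar>)" using int_I by simp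
      show "AE \<omega> in M. norm (iexp (s * I (x n) \<omega>) - iexp (s * I g \<omega>)) \<le> \<bar>s\<bar> * \<bar>I (x n - g) \<omega>\<bar>"
        using I_linear[of 1 "x n" "-1" g]
      proof eventually_elim
        case (elim \<omega>)
        then have "I (x n - g) \<omega> = I (x n) \<omega> - I g \<omega>" by simp
        then show ?case
          using iexp_lipschitz[of "s * I (x n) \<omega>" "s * I g \<omega>"]
          by (simp only: right_diff_distrib[symmetric] abs_mult)
      qed
    qed
    also have "\<dots> = \<bar>s\<bar> * expectation (\<lambda>\<omega>. \<bar>I (x n - g) \<omega>\<bar>)" by simp
    also have "\<dots> \<le> \<bar>s\<bar> * norm (x n - g)"
      using L1_le_L2(2)[OF I_measurable I_square_integrable, of "x n - g"]
      by (intro mult_left_mono) (auto simp: I_norm)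
    finally show ?thesis .
  qed
  have "(\<lambda>n. \<bar>s\<bar> * norm (x n - g)) \<longlonglongrightarrow> 0"
    using lim by (intro tendsto_mult_right_zero tendsto_norm_zero) (simp add: LIM_zero_iff)
  then have "(\<lambda>n. \<phi> (x n) - \<phi> g) \<longlonglongrightarrow> 0"
    by (rule Lim_null_comparison[rotated]) (use bound in auto)
  then have 1: "(\<lambda>n. \<phi> (x n)) \<longlonglongrightarrow> \<phi> g" by (simp add: LIM_zero_iff)
  have "(\<lambda>n. complex_of_real (exp (- (s\<^sup>2 * (norm (x n))\<^sup>2 / 2))))
      \<longlonglongrightarrow> complex_of_real (exp (- (s\<^sup>2 * (norm g)\<^sup>2 / 2)))"
    by (intro tendsto_intros lim) simp
  then have 2: "(\<lambda>n. \<phi> (x n)) \<longlonglongrightarrow> complex_of_real (exp (- (s\<^sup>2 * (norm g)\<^sup>2 / 2)))"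
    by (simp only: \<phi>_def char_I_span[OF x])
  show ?thesis using LIMSEQ_unique[OF 1 2] by (simp add: \<phi>_def)
qed

lemma distr_I_unit:
  assumes "norm u = 1"
  shows "distr M borel (I u) = std_normal_distribution"
proof (rule Levy_uniqueness)
  show "real_distribution (distr M borel (I u))" by (rule real_distribution_distr) measurable
  show "char (distr M borel (I u)) = char std_normal_distribution"
  proof
    fix t
    have "char (distr M borel (I u)) t = (CLINT \<omega>|M. iexp (t * I u \<omega>))"
      by (simp add: char_def integral_distr)
    then show "char (distr M borel (I u)) t = char std_normal_distribution t"
      using assms by (simp only: char_I char_std_normal_distribution) simp
  qed
qed (rule real_dist_normal_dist)

text \<open>By linearity the joint characteristic function at \<open>t\<close> is that of the single
  integral \<open>I (\<Sum>u\<in>U. t u *\<^sub>R u)\<close>, and Pythagoras splits the squared norm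
  in its exponent. The vectors of \<open>U\<close> serve as their own indices.\<close>

lemma indep_vars_I_orthonormal:
  assumes fin: "finite U" and orth: "pairwise orthogonal U" and norm: "\<And>u. u \<in> U \<Longrightarrow> norm u = 1"
  shows "indep_vars (\<lambda>_. borel) I U"
proof (rule indep_vars_if_char_factorizes[OF fin])
  fix t
  define g where "g = (\<Sum>u\<in>U. t u *\<^sub>R u)"
  have "(norm g)\<^sup>2 = (\<Sum>u\<in>U. (norm (t u *\<^sub>R u))\<^sup>2)"
    unfolding g_def by (rule norm_sum_Pythagorean[OF fin]) (rule pairwise_ortho_scaleR[OF orth])
  also have "\<dots> = (\<Sum>u\<in>U. (t u)\<^sup>2)" using norm by simp
  finally have g: "(norm g)\<^sup>2 = (\<Sum>u\<in>U. (t u)\<^sup>2)" .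
  have "(CLINT \<omega>|M. (\<Prod>u\<in>U. iexp (t u * I u \<omega>))) = (CLINT \<omega>|M. iexp (1 * I g \<omega>))"
  proof (rule integral_cong_AE)
    show "AE \<omega> in M. (\<Prod>u\<in>U. iexp (t u * I u \<omega>)) = iexp (1 * I g \<omega>)"
      using I_sum[OF fin, of t "\<lambda>u. u"]
      by eventually_elim (simp add: g_def exp_sum[OF fin, symmetric] sum_distrib_left)
  qed measurable
  also have "\<dots> = exp (- (1\<^sup>2 * (\<Sum>u\<in>U. (t u)\<^sup>2) / 2))" by (simp only: char_I g)
  also have "\<dots> = (\<Prod>u\<in>U. exp (- ((t u)\<^sup>2 * (norm u)\<^sup>2 / 2)))"
    using fin norm by (simp add: exp_sum[symmetric] sum_negf sum_divide_distrib)
  also have "\<dots> = (\<Prod>u\<in>U. CLINT \<omega>|M. iexp (t u * I u \<omega>))"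
    by (simp only: char_I of_real_prod)
  finally show "(CLINT \<omega>|M. (\<Prod>u\<in>U. iexp (t u * I u \<omega>))) = (\<Prod>u\<in>U. CLINT \<omega>|M. iexp (t u * I u \<omega>))" .
qed measurable

end

section \<open>Quadratic forms in independent normal variables\<close>

lemma std_normal_polynomial_moments:
  shows "integrable std_normal_distribution (\<lambda>x. \<bar>x\<^sup>2 - 1\<bar> ^ 3)"
    and "(\<integral>x. x\<^sup>2 - 1 \<partial>std_normal_distribution) = 0"
    and "(\<integral>x. (x\<^sup>2 - 1)\<^sup>2 \<partial>std_normal_distribution) = 2"
proof -
  interpret real_distribution std_normal_distribution by (rule real_dist_normal_dist)
  note int = integrable_std_normal_distribution_moment
  have "integrable std_normal_distribution (\<lambda>x. x ^ 6 - 3 * x ^ 4 + 3 * x ^ 2 - 1)"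
    by (intro Bochner_Integration.integrable_add Bochner_Integration.integrable_diff
        integrable_mult_right int) auto
  moreover have "(\<lambda>x. x ^ 6 - 3 * x ^ 4 + 3 * x ^ 2 - 1) = (\<lambda>x::real. (x\<^sup>2 - 1) ^ 3)"
    by (rule ext) (simp add: power3_eq_cube power2_eq_square algebra_simps numeral_eq_Suc)
  ultimately show "integrable std_normal_distribution (\<lambda>x. \<bar>x\<^sup>2 - 1\<bar> ^ 3)"
    by (simp add: integrable_abs power_abs[symmetric])
  have m2: "(\<integral>x. x\<^sup>2 \<partial>std_normal_distribution) = 1"
    using std_normal_distribution_even_moments(1)[of 1] by simp
  have m4: "(\<integral>x. x ^ 4 \<partial>std_normal_distribution) = 3"
    using std_normal_distribution_even_moments(1)[of 2] by (simp add: fact_numeral)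
  show "(\<integral>x. x\<^sup>2 - 1 \<partial>std_normal_distribution) = 0"
    using int[of 2] prob_space by (simp add: m2)
  have "(\<integral>x. (x\<^sup>2 - 1)\<^sup>2 \<partial>std_normal_distribution)
      = (\<integral>x. x ^ 4 - 2 * x\<^sup>2 + 1 \<partial>std_normal_distribution)"
    by (intro Bochner_Integration.integral_cong refl)
       (simp add: power2_eq_square algebra_simps numeral_eq_Suc)
  also have "\<dots> = 2"
    using int[of 2] int[of 4] prob_space by (simp add: m2 m4)
  finally show "(\<integral>x. (x\<^sup>2 - 1)\<^sup>2 \<partial>std_normal_distribution) = 2" .
qed

text \<open>The bound for independent sums evaluated at \<open>N\<^sup>2 - 1\<close> with
  \<open>N\<close> standard normal: 22 is its constant, and the 2 is the variance of
  \<open>N\<^sup>2 - 1\<close>.\<close>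

definition chi_square_constant :: real where
  "chi_square_constant = 22 * ((\<integral>x. \<bar>x\<^sup>2 - 1\<bar> ^ 3 \<partial>std_normal_distribution)
      + 2 * (\<integral>x. \<bar>x\<^sup>2 - 1\<bar> \<partial>std_normal_distribution))"

lemma chi_square_constant_nonneg: "chi_square_constant \<ge> 0"
  by (simp add: chi_square_constant_def)

context prob_space
begin

lemma variance_indep_sum:
  fixes \<xi> :: "'i \<Rightarrow> 'a \<Rightarrow> real"
  assumes "finite I" and "indep_vars (\<lambda>_. borel) \<xi> I"
    and "\<And>i. i \<in> I \<Longrightarrow> integrable M (\<lambda>\<omega>. (\<xi> i \<omega>)\<^sup>2)"
    and "\<And>i. i \<in> I \<Longrightarrow> expectation (\<xi> i) = 0"
  shows "integrable M (\<lambda>\<omega>. (\<Sum>i\<in>I. \<xi> i \<omega>)\<^sup>2) \<and>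
    expectation (\<lambda>\<omega>. (\<Sum>i\<in>I. \<xi> i \<omega>)\<^sup>2) = (\<Sum>i\<in>I. expectation (\<lambda>\<omega>. (\<xi> i \<omega>)\<^sup>2))"
  using assms
proof (induction I rule: finite_induct)
  case empty
  then show ?case by simp
next
  case (insert i I)
  define S where "S = (\<lambda>\<omega>. \<Sum>i\<in>I. \<xi> i \<omega>)"
  have ind: "indep_var borel (\<xi> i) borel S"
    unfolding S_def by (rule indep_vars_sum) (use insert in auto)
  have m[measurable]: "\<xi> j \<in> borel_measurable M" if "j \<in> insert i I" for j
    using insert.prems(1) that by (auto simp: indep_vars_def)
  have [measurable]: "S \<in> borel_measurable M" using indep_var_rv2[OF ind] .
  have IH: "integrable M (\<lambda>\<omega>. (S \<omega>)\<^sup>2)"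
    "expectation (\<lambda>\<omega>. (S \<omega>)\<^sup>2) = (\<Sum>i\<in>I. expectation (\<lambda>\<omega>. (\<xi> i \<omega>)\<^sup>2))"
    using insert.IH indep_vars_subset[OF insert.prems(1), of I] insert.prems by (auto simp: S_def)
  have sq: "integrable M (\<lambda>\<omega>. (\<xi> i \<omega>)\<^sup>2)" using insert.prems by auto
  have int: "integrable M (\<xi> i)" "integrable M S"
    using L1_le_L2(1)[OF _ sq] L1_le_L2(1)[OF _ IH(1)] by auto
  note prod = indep_var_integrable[OF ind int]
  have prod0: "expectation (\<lambda>\<omega>. \<xi> i \<omega> * S \<omega>) = 0"
    using indep_var_lebesgue_integral[OF ind int] insert.prems by simp
  have eq: "(\<Sum>i\<in>insert i I. \<xi> i \<omega>)\<^sup>2 = (\<xi> i \<omega>)\<^sup>2 + 2 * (\<xi> i \<omega> * S \<omega>) + (S \<omega>)\<^sup>2" for \<omega>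
    using insert.hyps by (simp add: S_def power2_sum)
  show ?case
    unfolding eq using sq prod IH(1) prod0 insert.hyps by (simp add: IH(2))
qed

lemma moments_std_normal_square:
  assumes [measurable]: "Z \<in> borel_measurable M" and Z: "distr M borel Z = std_normal_distribution"
  shows "integrable M (\<lambda>\<omega>. \<bar>a * ((Z \<omega>)\<^sup>2 - 1)\<bar> ^ 3)"
    and "expectation (\<lambda>\<omega>. a * ((Z \<omega>)\<^sup>2 - 1)) = 0"
    and "expectation (\<lambda>\<omega>. (a * ((Z \<omega>)\<^sup>2 - 1))\<^sup>2) = 2 * a\<^sup>2"
    and "expectation (\<lambda>\<omega>. \<bar>a * ((Z \<omega>)\<^sup>2 - 1)\<bar> ^ 3)
      = \<bar>a\<bar> ^ 3 * (\<integral>x. \<bar>x\<^sup>2 - 1\<bar> ^ 3 \<partial>std_normal_distribution)"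
    and "expectation (\<lambda>\<omega>. \<bar>a * ((Z \<omega>)\<^sup>2 - 1)\<bar>)
      = \<bar>a\<bar> * (\<integral>x. \<bar>x\<^sup>2 - 1\<bar> \<partial>std_normal_distribution)"
proof -
  have E: "expectation (\<lambda>\<omega>. g (Z \<omega>)) = (\<integral>x. g x \<partial>std_normal_distribution)"
    if "g \<in> borel_measurable borel" for g :: "real \<Rightarrow> real"
    using integral_distr[of Z M borel g] that by (simp add: Z)
  have "integrable (distr M borel Z) (\<lambda>x. \<bar>x\<^sup>2 - 1\<bar> ^ 3)"
    unfolding Z by (rule std_normal_polynomial_moments)
  then have "integrable M (\<lambda>\<omega>. \<bar>(Z \<omega>)\<^sup>2 - 1\<bar> ^ 3)"
    by (subst (asm) integrable_distr_eq) auto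
  then show "integrable M (\<lambda>\<omega>. \<bar>a * ((Z \<omega>)\<^sup>2 - 1)\<bar> ^ 3)"
    by (simp add: abs_mult power_mult_distrib)
  show "expectation (\<lambda>\<omega>. a * ((Z \<omega>)\<^sup>2 - 1)) = 0"
    using E[of "\<lambda>x. x\<^sup>2 - 1"] std_normal_polynomial_moments(2) by simp
  show "expectation (\<lambda>\<omega>. (a * ((Z \<omega>)\<^sup>2 - 1))\<^sup>2) = 2 * a\<^sup>2"
    using E[of "\<lambda>x. (x\<^sup>2 - 1)\<^sup>2"] std_normal_polynomial_moments(3) by (simp add: power_mult_distrib)
  show "expectation (\<lambda>\<omega>. \<bar>a * ((Z \<omega>)\<^sup>2 - 1)\<bar> ^ 3)
      = \<bar>a\<bar> ^ 3 * (\<integral>x. \<bar>x\<^sup>2 - 1\<bar> ^ 3 \<partial>std_normal_distribution)"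
    using E[of "\<lambda>x. \<bar>x\<^sup>2 - 1\<bar> ^ 3"] by (simp add: abs_mult power_mult_distrib)
  show "expectation (\<lambda>\<omega>. \<bar>a * ((Z \<omega>)\<^sup>2 - 1)\<bar>)
      = \<bar>a\<bar> * (\<integral>x. \<bar>x\<^sup>2 - 1\<bar> \<partial>std_normal_distribution)"
    using E[of "\<lambda>x. \<bar>x\<^sup>2 - 1\<bar>"] by (simp add: abs_mult)
qed

context
  fixes Z :: "'i \<Rightarrow> 'a \<Rightarrow> real" and U :: "'i set"
  assumes fin: "finite U" and ind: "indep_vars (\<lambda>_. borel) Z U"
    and Z: "\<And>u. u \<in> U \<Longrightarrow> distr M borel (Z u) = std_normal_distribution"
begin

lemma indep_vars_centered_squares: "indep_vars (\<lambda>_. borel) (\<lambda>u \<omega>. a u * ((Z u \<omega>)\<^sup>2 - 1)) U"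
  by (rule indep_vars_compose2[OF ind, where Y="\<lambda>u x. a u * (x\<^sup>2 - 1)"]) auto

lemma Z_measurable: "u \<in> U \<Longrightarrow> Z u \<in> borel_measurable M"
  using ind by (auto simp: indep_vars_def)

lemmas Z_moments = moments_std_normal_square[OF Z_measurable Z]

lemma variance_quadratic_form:
  shows "integrable M (\<lambda>\<omega>. (\<Sum>u\<in>U. a u * ((Z u \<omega>)\<^sup>2 - 1))\<^sup>2)"
    and "expectation (\<lambda>\<omega>. (\<Sum>u\<in>U. a u * ((Z u \<omega>)\<^sup>2 - 1))\<^sup>2) = 2 * (\<Sum>u\<in>U. (a u)\<^sup>2)"
proof -
  have "integrable M (\<lambda>\<omega>. (a u * ((Z u \<omega>)\<^sup>2 - 1))\<^sup>2)" if u: "u \<in> U" for u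
    using integrable_power_le[OF _ Z_moments(1)[OF u u, of "a u"], of 2] Z_measurable[OF u] by simp
  then have "integrable M (\<lambda>\<omega>. (\<Sum>u\<in>U. a u * ((Z u \<omega>)\<^sup>2 - 1))\<^sup>2) \<and>
    expectation (\<lambda>\<omega>. (\<Sum>u\<in>U. a u * ((Z u \<omega>)\<^sup>2 - 1))\<^sup>2)
      = (\<Sum>u\<in>U. expectation (\<lambda>\<omega>. (a u * ((Z u \<omega>)\<^sup>2 - 1))\<^sup>2))"
    using fin indep_vars_centered_squares Z_moments(2) by (intro variance_indep_sum) auto
  moreover have "(\<Sum>u\<in>U. expectation (\<lambda>\<omega>. (a u * ((Z u \<omega>)\<^sup>2 - 1))\<^sup>2)) = 2 * (\<Sum>u\<in>U. (a u)\<^sup>2)"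
    by (simp add: Z_moments(3) sum_distrib_left)
  ultimately show "integrable M (\<lambda>\<omega>. (\<Sum>u\<in>U. a u * ((Z u \<omega>)\<^sup>2 - 1))\<^sup>2)"
    and "expectation (\<lambda>\<omega>. (\<Sum>u\<in>U. a u * ((Z u \<omega>)\<^sup>2 - 1))\<^sup>2) = 2 * (\<Sum>u\<in>U. (a u)\<^sup>2)"
    by auto
qed

text \<open>Both error terms of a summand, the third absolute moment and the variance times the
  first absolute moment, are homogeneous of degree three in \<open>a u\<close>.\<close>

lemma normal_approximation_quadratic_form:
  fixes h :: "real \<Rightarrow> real"
  assumes var: "2 * (\<Sum>u\<in>U. (a u)\<^sup>2) = 1" and lip: "\<And>x y. \<bar>h x - h y\<bar> \<le> \<bar>x - y\<bar>"
  shows "\<bar>expectation (\<lambda>\<omega>. h (\<Sum>u\<in>U. a u * ((Z u \<omega>)\<^sup>2 - 1)))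
      - (\<integral>x. std_normal_density x * h x \<partial>lborel)\<bar>
    \<le> chi_square_constant * (\<Sum>u\<in>U. \<bar>a u\<bar> ^ 3)"
proof -
  define m where "m = (\<integral>x. \<bar>x\<^sup>2 - 1\<bar> \<partial>std_normal_distribution)"
  define m' where "m' = (\<integral>x. \<bar>x\<^sup>2 - 1\<bar> ^ 3 \<partial>std_normal_distribution)"
  have "\<bar>expectation (\<lambda>\<omega>. h (\<Sum>u\<in>U. a u * ((Z u \<omega>)\<^sup>2 - 1)))
      - (\<integral>x. std_normal_density x * h x \<partial>lborel)\<bar>
    \<le> 22 * (\<Sum>u\<in>U. expectation (\<lambda>\<omega>. \<bar>a u * ((Z u \<omega>)\<^sup>2 - 1)\<bar> ^ 3)
        + expectation (\<lambda>\<omega>. (a u * ((Z u \<omega>)\<^sup>2 - 1))\<^sup>2) * expectation (\<lambda>\<omega>. \<bar>a u * ((Z u \<omega>)\<^sup>2 - 1)\<bar>))"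
    using var by (intro normal_approximation_indep_sum[OF fin indep_vars_centered_squares Z_moments(1,2) _ lip])
      (simp_all only: Z_moments(3) sum_distrib_left cong: sum.cong)
  also have "\<dots> = 22 * (\<Sum>u\<in>U. \<bar>a u\<bar> ^ 3 * m' + 2 * (a u)\<^sup>2 * (\<bar>a u\<bar> * m))"
    by (simp only: Z_moments m_def m'_def cong: sum.cong)
  also have "\<dots> = 22 * (\<Sum>u\<in>U. \<bar>a u\<bar> ^ 3 * (m' + 2 * m))"
    by (intro arg_cong[of _ _ "\<lambda>x. 22 * x"] sum.cong refl)
       (simp add: power3_eq_cube power2_eq_square algebra_simps)
  also have "\<dots> = chi_square_constant * (\<Sum>u\<in>U. \<bar>a u\<bar> ^ 3)"
    by (simp only: chi_square_constant_def m_def m'_def sum_distrib_right[symmetric] mult_ac)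
  finally show ?thesis .
qed

end

end

section \<open>Diagonalization\<close>

text \<open>The ambient space may be infinite-dimensional, so only the sphere inside the span can be
  compact. In an orthogonal basis Pythagoras bounds the coordinates of a unit vector, which places
  it in a compact box of coefficients; the sphere is closed.\<close>

lemma compact_unit_sphere_span:
  fixes B :: "'h::real_inner set"
  assumes "finite B"
  shows "compact (span B \<inter> sphere 0 1)"
proof -
  obtain C where C: "finite C" "span C = span B" "pairwise orthogonal C"
    using basis_orthogonal[OF assms] by blast
  define D where "D = C - {0}"
  have D: "finite D" "span D = span B" "pairwise orthogonal D" "0 \<notin> D"
    using C by (auto simp: D_def span_delete_0 pairwise_def)
  \<comment> \<open>A box of coefficients is a finite sum of segments, and sums of compact sets are
    compact.\<close>
  have cube: "compact {\<Sum>d\<in>F. c d *\<^sub>R d | c. \<forall>d\<in>F. \<bar>c d\<bar> \<le> R d}" if "finite F" for F :: "'h set" and R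
    using that
  proof (induction F rule: finite_induct)
    case (insert x F)
    have eq: "{\<Sum>d\<in>insert x F. c d *\<^sub>R d | c. \<forall>d\<in>insert x F. \<bar>c d\<bar> \<le> R d}
      = {y + z | y z. y \<in> {\<Sum>d\<in>F. c d *\<^sub>R d | c. \<forall>d\<in>F. \<bar>c d\<bar> \<le> R d} \<and> z \<in> (\<lambda>t. t *\<^sub>R x) ` {- R x..R x}}"
      (is "?L = ?R")
    proof (intro subset_antisym subsetI)
      fix v assume "v \<in> ?L"
      then obtain c where c: "v = (\<Sum>d\<in>insert x F. c d *\<^sub>R d)" "\<forall>d\<in>insert x F. \<bar>c d\<bar> \<le> R d" by blast
      have "v = (\<Sum>d\<in>F. c d *\<^sub>R d) + c x *\<^sub>R x"
        using insert.hyps c by (simp add: add.commute)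
      moreover have "c x *\<^sub>R x \<in> (\<lambda>t. t *\<^sub>R x) ` {- R x..R x}"
        using c by (intro imageI) (auto simp: abs_le_iff)
      ultimately show "v \<in> ?R" using c by blast
    next
      fix v assume "v \<in> ?R"
      then obtain c t where c: "v = (\<Sum>d\<in>F. c d *\<^sub>R d) + t *\<^sub>R x" "\<forall>d\<in>F. \<bar>c d\<bar> \<le> R d"
        "- R x \<le> t" "t \<le> R x" by auto
      have "(\<Sum>d\<in>F. (c(x := t)) d *\<^sub>R d) = (\<Sum>d\<in>F. c d *\<^sub>R d)"
        using insert.hyps by (intro sum.cong) auto
      then have "v = (\<Sum>d\<in>insert x F. (c(x := t)) d *\<^sub>R d)"
        using insert.hyps c by (simp add: add.commute)
      moreover have "\<forall>d\<in>insert x F. \<bar>(c(x := t)) d\<bar> \<le> R d"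
        using c by (auto simp: abs_le_iff)
      ultimately show "v \<in> ?L" by blast
    qed
    have "compact ((\<lambda>t. t *\<^sub>R x) ` {- R x..R x})"
      by (intro compact_continuous_image continuous_intros) auto
    then show ?case unfolding eq by (intro compact_sums insert.IH)
  qed simp
  define K where "K = {\<Sum>d\<in>D. c d *\<^sub>R d | c. \<forall>d\<in>D. \<bar>c d\<bar> \<le> 1 / norm d}"
  have "span B \<inter> sphere 0 1 = K \<inter> sphere 0 1"
  proof (intro subset_antisym subsetI IntI)
    fix v assume v: "v \<in> span B \<inter> sphere 0 1"
    then obtain c where c: "v = (\<Sum>d\<in>D. c d *\<^sub>R d)"
      using D span_finite[of D] by auto
    have "\<bar>c d\<bar> \<le> 1 / norm d" if d: "d \<in> D" for d
    proof -
      have "(norm v)\<^sup>2 = (\<Sum>d\<in>D. (norm (c d *\<^sub>R d))\<^sup>2)"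
        unfolding c by (rule norm_sum_Pythagorean[OF D(1)]) (rule pairwise_ortho_scaleR[OF D(3)])
      also have "\<dots> \<ge> (norm (c d *\<^sub>R d))\<^sup>2"
        by (rule member_le_sum[OF d _ D(1)]) auto
      finally have "norm (c d *\<^sub>R d) \<le> norm v"
        by (rule power2_le_imp_le) simp
      then have "\<bar>c d\<bar> * norm d \<le> 1" using v by simp
      moreover have "norm d > 0" using d D by auto
      ultimately show ?thesis by (simp add: field_simps)
    qed
    with c show "v \<in> K" by (auto simp: K_def)
  next
    fix v assume "v \<in> K \<inter> sphere 0 1"
    then show "v \<in> span B"
      unfolding D(2)[symmetric] K_def by (auto intro: span_sum span_scale span_base)
  qed auto
  moreover have "compact K" unfolding K_def by (rule cube[OF D(1)])
  moreover have "closed (sphere (0::'h) 1)"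
    unfolding sphere_def by (intro closed_Collect_eq continuous_intros)
  ultimately show ?thesis using compact_Int_closed[of K "sphere 0 1"] by simp
qed

text \<open>Greedy form of the spectral theorem: each new vector maximizes
  \<open>\<lambda>x. \<Sum>j\<in>J. (h j \<bullet> x)\<^sup>2\<close> on the unit sphere of the orthogonal complement of the previous ones.\<close>

lemma exists_diagonalizing_orthonormal_set:
  fixes h :: "'i \<Rightarrow> 'h::real_inner"
  assumes "finite J"
  obtains U where "finite U" "pairwise orthogonal U" "\<And>u. u \<in> U \<Longrightarrow> norm u = 1"
    "\<And>j. j \<in> J \<Longrightarrow> h j = (\<Sum>u\<in>U. (h j \<bullet> u) *\<^sub>R u)"
    "\<And>u v. u \<in> U \<Longrightarrow> v \<in> U \<Longrightarrow> u \<noteq> v \<Longrightarrow> (\<Sum>j\<in>J. (h j \<bullet> u) * (h j \<bullet> v)) = 0"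
proof -
  define S where "S = span (h ` J)"
  define b where "b = (\<lambda>x y. \<Sum>j\<in>J. (h j \<bullet> x) * (h j \<bullet> y))"
  have b_sym: "b x y = b y x" and b_scale2: "b (c *\<^sub>R x) (c *\<^sub>R x) = c\<^sup>2 * b x x" for x y c
    by (simp_all add: b_def inner_add_right algebra_simps sum.distrib sum_distrib_left power2_eq_square)
  have b_expand: "b (v + t *\<^sub>R y) (v + t *\<^sub>R y) = b v v + 2 * t * b v y + t\<^sup>2 * b y y" for v y t
    by (simp add: b_def inner_add_right sum.distrib sum_distrib_left power2_eq_square algebra_simps)
  \<comment> \<open>The last conjunct is the invariant: whatever is orthogonal to \<open>U\<close>
    in the inner product is also orthogonal to it for \<open>b\<close>. It makes every vector chosen
    later \<open>b\<close>-orthogonal to the present ones.\<close>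
  define P where "P = (\<lambda>U. U \<subseteq> S \<and> finite U \<and> pairwise orthogonal U \<and> (\<forall>u\<in>U. norm u = 1)
    \<and> (\<forall>u\<in>U. \<forall>v\<in>U. u \<noteq> v \<longrightarrow> b u v = 0)
    \<and> (\<forall>w\<in>S. (\<forall>u\<in>U. u \<bullet> w = 0) \<longrightarrow> (\<forall>u\<in>U. b u w = 0)))"
  \<comment> \<open>Orthonormal vectors are independent, which caps their number. A set
    \<open>U\<close> of largest size therefore exists, and extending it contradicts maximality, so
    no recursion has to be defined.\<close>
  have card_le: "card U < Suc (card (h ` J))" if "P U" for U
  proof -
    have "0 \<notin> U" using that by (auto simp: P_def)
    then have "independent U"
      using that by (intro pairwise_orthogonal_independent) (auto simp: P_def)
    then show ?thesis
      using independent_span_bound[of "h ` J" U] that assms by (auto simp: P_def S_def)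
  qed
  have "P {}" by (simp add: P_def)
  then obtain U where U: "P U" and max: "\<And>V. P V \<Longrightarrow> card V \<le> card U"
    using ex_has_greatest_nat[of P "{}" card "Suc (card (h ` J))"] card_le less_imp_le by blast
  have complement: "w = 0" if w: "w \<in> S" "\<forall>u\<in>U. u \<bullet> w = 0" for w
  proof (rule ccontr)
    assume "w \<noteq> 0"
    define K where "K = (span (h ` J) \<inter> sphere 0 1) \<inter> (\<Inter>u\<in>U. {x. u \<bullet> x = 0})"
    have K: "x \<in> K \<longleftrightarrow> x \<in> S \<and> norm x = 1 \<and> (\<forall>u\<in>U. u \<bullet> x = 0)" for x
      by (auto simp: K_def S_def)
    have "compact K"
      unfolding K_def
      by (intro compact_Int_closed compact_unit_sphere_span closed_INT ballI closed_hyperplane)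
         (use assms in auto)
    moreover have "(1 / norm w) *\<^sub>R w \<in> K"
      using w \<open>w \<noteq> 0\<close> by (auto simp: K S_def span_scale)
    then have "K \<noteq> {}" by blast
    moreover have "continuous_on K (\<lambda>x. b x x)"
      unfolding b_def by (intro continuous_intros)
    ultimately obtain v where v: "v \<in> K" and v_max: "\<And>x. x \<in> K \<Longrightarrow> b x x \<le> b v v"
      using continuous_attains_sup[of K "\<lambda>x. b x x"] by blast
    have scaled: "b x x \<le> b v v * (norm x)\<^sup>2" if x: "x \<in> S" "\<forall>u\<in>U. u \<bullet> x = 0" for x
    proof (cases "x = 0")
      case True
      then show ?thesis by (simp add: b_def)
    next
      case False
      have "(1 / norm x) *\<^sub>R x \<in> K"
        using x False by (auto simp: K S_def span_scale)
      from v_max[OF this] have "b x x / (norm x)\<^sup>2 \<le> b v v"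
        by (simp add: b_scale2 power_divide)
      then show ?thesis using False by (simp add: field_simps)
    qed
    have v': "v \<in> S" "norm v = 1" "\<forall>u\<in>U. u \<bullet> v = 0" using v by (auto simp: K)
    \<comment> \<open>First-order condition at the maximizer \<open>v\<close>: moving along
      \<open>y\<close> perturbs \<open>b\<close> linearly in \<open>t\<close>, but the allowed
      growth is only quadratic in \<open>t\<close>.\<close>
    have stationary: "b v y = 0" if y: "y \<in> S" "\<forall>u\<in>insert v U. u \<bullet> y = 0" for y
    proof -
      have ineq: "2 * t * b v y \<le> t\<^sup>2 * (b v v * (norm y)\<^sup>2 - b y y)" for t
      proof -
        have "v + t *\<^sub>R y \<in> S" using v' y by (simp add: S_def span_add span_scale)
        moreover have "\<forall>u\<in>U. u \<bullet> (v + t *\<^sub>R y) = 0" using v' y by (simp add: inner_add_right)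
        ultimately have "b (v + t *\<^sub>R y) (v + t *\<^sub>R y) \<le> b v v * (norm (v + t *\<^sub>R y))\<^sup>2"
          by (rule scaled)
        moreover have "(norm (v + t *\<^sub>R y))\<^sup>2 = 1 + t\<^sup>2 * (norm y)\<^sup>2"
        proof -
          have "v \<bullet> v = 1" "v \<bullet> y = 0" "y \<bullet> v = 0"
            using v' y by (simp_all add: norm_eq_1 inner_commute)
          then show ?thesis
            unfolding power2_norm_eq_inner by (simp add: inner_add_left inner_add_right power2_eq_square)
        qed
        ultimately show ?thesis unfolding b_expand by (simp add: algebra_simps)
      qed
      define \<alpha> where "\<alpha> = b v v * (norm y)\<^sup>2 - b y y"
      \<comment> \<open>With this \<open>t\<close> the quadratic term is at most
        \<open>t * b v y\<close>, half of the linear one, which forces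
        \<open>t * b v y \<le> 0\<close>; but this number is a nonnegative multiple of
        \<open>(b v y)\<^sup>2\<close>. The 1 keeps the denominator positive.\<close>
      define t where "t = b v y / (\<bar>\<alpha>\<bar> + 1)"
      have "2 * t * b v y \<le> t\<^sup>2 * \<alpha>" using ineq[of t] by (simp add: \<alpha>_def)
      also have "\<dots> \<le> t\<^sup>2 * (\<bar>\<alpha>\<bar> + 1)" by (intro mult_left_mono) auto
      also have "\<dots> = t * b v y" by (simp add: t_def power2_eq_square)
      finally have "t * b v y \<le> 0" by simp
      moreover have "t * b v y = (b v y)\<^sup>2 / (\<bar>\<alpha>\<bar> + 1)" by (simp add: t_def power2_eq_square)
      ultimately have "(b v y)\<^sup>2 \<le> 0"
        using abs_ge_zero[of \<alpha>] by (auto simp: divide_le_0_iff)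
      then show ?thesis by simp
    qed
    have "v \<notin> U" using v' by auto
    have bv: "b u v = 0" "b v u = 0" if "u \<in> U" for u
    proof -
      show "b u v = 0" using U v' that by (simp add: P_def)
      then show "b v u = 0" by (simp add: b_sym[of v u])
    qed
    have bU: "b u z = 0" if "u \<in> U" "z \<in> U" "u \<noteq> z" for u z
      using U that by (simp add: P_def)
    have "P (insert v U)"
      unfolding P_def
    proof (intro conjI)
      show "insert v U \<subseteq> S" "finite (insert v U)" "\<forall>u\<in>insert v U. norm u = 1"
        using U v' by (auto simp: P_def)
      show "pairwise orthogonal (insert v U)"
        using U v' by (auto simp: P_def pairwise_insert orthogonal_def inner_commute)
      show "\<forall>u\<in>insert v U. \<forall>z\<in>insert v U. u \<noteq> z \<longrightarrow> b u z = 0"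
        using bv bU by blast
      show "\<forall>z\<in>S. (\<forall>u\<in>insert v U. u \<bullet> z = 0) \<longrightarrow> (\<forall>u\<in>insert v U. b u z = 0)"
        using U stationary by (auto simp: P_def)
    qed
    from max[OF this] show False using \<open>v \<notin> U\<close> U by (simp add: P_def)
  qed
  show ?thesis
  proof (rule that)
    show "finite U" "pairwise orthogonal U" "\<And>u. u \<in> U \<Longrightarrow> norm u = 1"
      using U by (auto simp: P_def)
    show "(\<Sum>j\<in>J. (h j \<bullet> u) * (h j \<bullet> v)) = 0" if "u \<in> U" "v \<in> U" "u \<noteq> v" for u v
      using U that by (auto simp: P_def b_def)
    fix j assume j: "j \<in> J"
    \<comment> \<open>The residual of the projection onto \<open>U\<close> lies in \<open>S\<close>
      and is orthogonal to \<open>U\<close>, so \<open>complement\<close> annihilates it.\<close>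
    define w where "w = h j - (\<Sum>u\<in>U. (h j \<bullet> u) *\<^sub>R u)"
    have "w \<in> S"
      unfolding w_def S_def
    proof (intro span_diff span_sum span_scale)
      show "h j \<in> span (h ` J)" using j by (auto intro: span_base)
      show "u \<in> span (h ` J)" if "u \<in> U" for u using U that by (auto simp: P_def S_def)
    qed
    moreover have "u \<bullet> w = 0" if u: "u \<in> U" for u
    proof -
      have "u \<bullet> (\<Sum>z\<in>U. (h j \<bullet> z) *\<^sub>R z) = (\<Sum>z\<in>U. (h j \<bullet> z) * (u \<bullet> z))"
        by (simp add: inner_sum_right)
      also have "\<dots> = (\<Sum>z\<in>U. if z = u then h j \<bullet> u else 0)"
      proof (rule sum.cong)
        fix z assume "z \<in> U"
        then show "(h j \<bullet> z) * (u \<bullet> z) = (if z = u then h j \<bullet> u else 0)"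
          using U u by (auto simp: P_def pairwise_def orthogonal_def norm_eq_1)
      qed simp
      also have "\<dots> = h j \<bullet> u" using U u by (simp add: P_def)
      finally show ?thesis by (simp add: w_def inner_diff_right inner_commute)
    qed
    ultimately have "w = 0" using complement by blast
    then show "h j = (\<Sum>u\<in>U. (h j \<bullet> u) *\<^sub>R u)" by (simp add: w_def)
  qed
qed

text \<open>In matrix terms \<open>r\<close> is \<open>c\<close> times its transpose and the columns
  of \<open>c\<close> are orthogonal. Hence each column is an eigenvector of \<open>r\<close> whose
  eigenvalue is its squared length, which is the fact \<open>contract\<close>. One factor
  \<open>r\<close> is expanded and the other two are absorbed by \<open>contract\<close>.\<close>

lemma trace_cube_diagonalized:
  fixes c :: "'i \<Rightarrow> 'u \<Rightarrow> real"
  assumes "finite U"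
    and diag: "\<And>u v. u \<in> U \<Longrightarrow> v \<in> U \<Longrightarrow> u \<noteq> v \<Longrightarrow> (\<Sum>j\<in>J. c j u * c j v) = 0"
    and r: "\<And>i j. i \<in> J \<Longrightarrow> j \<in> J \<Longrightarrow> r i j = (\<Sum>u\<in>U. c i u * c j u)"
  shows "(\<Sum>i\<in>J. \<Sum>j\<in>J. \<Sum>k\<in>J. r i j * r j k * r k i) = (\<Sum>u\<in>U. (\<Sum>j\<in>J. (c j u)\<^sup>2) ^ 3)"
proof -
  define l where "l = (\<lambda>u. \<Sum>j\<in>J. (c j u)\<^sup>2)"
  have diag': "(\<Sum>j\<in>J. c j u * c j v) = (if u = v then l u else 0)" if "u \<in> U" "v \<in> U" for u v
    using diag that by (auto simp: l_def power2_eq_square)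
  have contract: "(\<Sum>i\<in>J. r k i * c i u) = l u * c k u" if k: "k \<in> J" and u: "u \<in> U" for k u
  proof -
    have "(\<Sum>i\<in>J. r k i * c i u) = (\<Sum>i\<in>J. \<Sum>v\<in>U. c k v * (c i v * c i u))"
      using k by (intro sum.cong) (simp_all add: r sum_distrib_left sum_distrib_right mult_ac)
    also have "\<dots> = (\<Sum>v\<in>U. c k v * (\<Sum>i\<in>J. c i v * c i u))"
      by (subst sum.swap) (simp add: sum_distrib_left)
    also have "\<dots> = (\<Sum>v\<in>U. if v = u then l u * c k u else 0)"
      using u by (intro sum.cong refl) (simp add: diag')
    also have "\<dots> = l u * c k u" using u assms(1) by simp
    finally show ?thesis .
  qed
  have "(\<Sum>i\<in>J. \<Sum>j\<in>J. \<Sum>k\<in>J. r i j * r j k * r k i)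
      = (\<Sum>i\<in>J. \<Sum>j\<in>J. \<Sum>k\<in>J. \<Sum>u\<in>U. r i j * (r j k * c k u) * c i u)"
  proof (intro sum.cong refl)
    fix i j k assume "i \<in> J" "k \<in> J"
    then have "r k i = (\<Sum>u\<in>U. c k u * c i u)" by (intro r)
    then show "r i j * r j k * r k i = (\<Sum>u\<in>U. r i j * (r j k * c k u) * c i u)"
      by (simp only: sum_distrib_left mult.assoc)
  qed
  also have "\<dots> = (\<Sum>i\<in>J. \<Sum>j\<in>J. \<Sum>u\<in>U. r i j * (\<Sum>k\<in>J. r j k * c k u) * c i u)"
    by (intro sum.cong refl, subst sum.swap) (simp add: sum_distrib_left sum_distrib_right)
  also have "\<dots> = (\<Sum>i\<in>J. \<Sum>j\<in>J. \<Sum>u\<in>U. l u * (r i j * c j u) * c i u)"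
    by (intro sum.cong refl; simp only: contract; simp only: mult_ac)
  also have "\<dots> = (\<Sum>i\<in>J. \<Sum>u\<in>U. l u * (\<Sum>j\<in>J. r i j * c j u) * c i u)"
    by (intro sum.cong refl, subst sum.swap) (simp add: sum_distrib_left sum_distrib_right)
  also have "\<dots> = (\<Sum>i\<in>J. \<Sum>u\<in>U. l u * l u * (c i u * c i u))"
    by (intro sum.cong refl; simp only: contract; simp only: mult_ac)
  also have "\<dots> = (\<Sum>u\<in>U. l u * l u * (\<Sum>i\<in>J. c i u * c i u))"
    by (subst sum.swap) (simp add: sum_distrib_left)
  also have "\<dots> = (\<Sum>u\<in>U. l u ^ 3)"
    by (intro sum.cong refl) (simp add: diag' power3_eq_cube mult.assoc)
  finally show ?thesis by (simp add: l_def)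
qed

section \<open>Trace of the cubed covariance matrix\<close>

lemma am_gm_triple:
  fixes x y z :: real
  assumes "x \<ge> 0" "y \<ge> 0" "z \<ge> 0"
  shows "3 * (x * y * z) \<le> x ^ 3 + y ^ 3 + z ^ 3"
proof -
  have "x ^ 3 + y ^ 3 + z ^ 3 - 3 * (x * y * z)
      = (x + y + z) * ((x - y)\<^sup>2 + (y - z)\<^sup>2 + (z - x)\<^sup>2) / 2"
    by (simp add: power2_eq_square power3_eq_cube algebra_simps)
  also have "\<dots> \<ge> 0" using assms by simp
  finally show ?thesis by simp
qed

text \<open>In a row each distance occurs at most once on either side of the diagonal, and all
  distances are below \<open>n\<close>.\<close>

lemma sum_toeplitz_row_le:
  fixes w :: "nat \<Rightarrow> real"
  assumes w: "\<And>k. w k \<ge> 0" and j: "j \<in> {1..n}"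
  shows "(\<Sum>i=1..n. w (if i \<le> j then j - i else i - j)) \<le> 2 * (\<Sum>k<n. w k)"
proof -
  have "(\<Sum>i=1..n. w (if i \<le> j then j - i else i - j))
      = (\<Sum>i\<in>{1..j} \<union> {j<..n}. w (if i \<le> j then j - i else i - j))"
    using j by (intro sum.cong) auto
  also have "\<dots> = (\<Sum>i\<in>{1..j}. w (j - i)) + (\<Sum>i\<in>{j<..n}. w (i - j))"
    by (subst sum.union_disjoint) auto
  also have "(\<Sum>i\<in>{1..j}. w (j - i)) = sum w ((\<lambda>i. j - i) ` {1..j})"
    by (subst sum.reindex) (auto simp: inj_on_def)
  also have "\<dots> \<le> (\<Sum>k<n. w k)"
    using j w by (intro sum_mono2) auto
  also have "(\<Sum>i\<in>{j<..n}. w (i - j)) = sum w ((\<lambda>i. i - j) ` {j<..n})"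
    by (subst sum.reindex) (auto simp: inj_on_def)
  also have "\<dots> \<le> (\<Sum>k<n. w k)"
    using j w by (intro sum_mono2) auto
  finally show ?thesis by simp
qed

text \<open>AM-GM is applied to \<open>x y z = sqrt (x y) * sqrt (y z) * sqrt (z x)\<close>, which decouples the
  three entries and leaves the power \<open>3/2\<close> of \<open>\<rho>\<close>.\<close>

lemma trace_cube_le:
  fixes r :: "nat \<Rightarrow> nat \<Rightarrow> real" and \<rho> :: "nat \<Rightarrow> real"
  assumes r: "\<And>i j. \<bar>r i j\<bar> \<le> C * \<rho> (if i \<le> j then j - i else i - j)"
    and "C \<ge> 0" and \<rho>: "\<And>k. \<rho> k \<ge> 0"
  shows "(\<Sum>i=1..n. \<Sum>j=1..n. \<Sum>k=1..n. r i j * r j k * r k i)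
    \<le> C ^ 3 * (real n * (2 * (\<Sum>k<n. sqrt (\<rho> k) ^ 3))\<^sup>2)"
proof -
  define d where "d = (\<lambda>i j :: nat. if i \<le> j then j - i else i - j)"
  define s where "s = (\<lambda>i j. sqrt (\<rho> (d i j)))"
  define J where "J = {1..n}"
  define W where "W = 2 * (\<Sum>k<n. sqrt (\<rho> k) ^ 3)"
  have d_sym: "d i j = d j i" for i j by (auto simp: d_def)
  have s_sym: "s i j = s j i" for i j by (simp add: s_def d_sym)
  have s_nn: "s i j \<ge> 0" for i j using \<rho> by (simp add: s_def)
  have s_sq: "s i j * s i j = \<rho> (d i j)" for i j using \<rho> by (simp add: s_def)
  have W_nn: "W \<ge> 0" unfolding W_def using \<rho> by (simp add: sum_nonneg)
  have r': "\<bar>r i j\<bar> \<le> C * (s i j * s i j)" for i j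
    using r[of i j] unfolding s_sq by (simp add: d_def)
  have pointwise: "r i j * r j k * r k i
      \<le> C ^ 3 / 3 * (s j i ^ 3 * s j k ^ 3 + s k j ^ 3 * s k i ^ 3 + s i k ^ 3 * s i j ^ 3)" for i j k
  proof -
    have "r i j * r j k * r k i \<le> \<bar>r i j\<bar> * \<bar>r j k\<bar> * \<bar>r k i\<bar>"
      by (metis abs_ge_self abs_mult)
    also have "\<dots> \<le> (C * (s i j * s i j)) * (C * (s j k * s j k)) * (C * (s k i * s k i))"
      using r' s_nn \<open>C \<ge> 0\<close> by (intro mult_mono) auto
    also have "\<dots> = C ^ 3 / 3 * (3 * ((s j i * s j k) * (s k j * s k i) * (s i k * s i j)))"
      by (simp add: s_sym[of j i] s_sym[of k j] s_sym[of i k] power3_eq_cube)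
    also have "\<dots> \<le> C ^ 3 / 3 * ((s j i * s j k) ^ 3 + (s k j * s k i) ^ 3 + (s i k * s i j) ^ 3)"
      using \<open>C \<ge> 0\<close> s_nn by (intro mult_left_mono am_gm_triple) auto
    finally show ?thesis by (simp add: power_mult_distrib)
  qed
  have row: "(\<Sum>i\<in>J. s j i ^ 3) \<le> W" if "j \<in> J" for j
  proof -
    have "s j i = sqrt (\<rho> (if i \<le> j then j - i else i - j))" for i
      by (simp only: s_def d_sym[of j i]) (simp only: d_def)
    then show ?thesis
      using sum_toeplitz_row_le[of "\<lambda>k. sqrt (\<rho> k) ^ 3" j n] that \<rho> by (simp add: W_def J_def)
  qed
  \<comment> \<open>Each of the three AM-GM terms is a product of two entries sharing an index.
    Summed over the other two indices it becomes a product of two row sums, each at most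
    \<open>W\<close>. The three terms differ only by relabelling and give the same total.\<close>
  have "(\<Sum>j\<in>J. (\<Sum>i\<in>J. s j i ^ 3) * (\<Sum>k\<in>J. s j k ^ 3)) \<le> (\<Sum>j\<in>J. W * W)"
    using row s_nn W_nn by (intro sum_mono mult_mono) (auto intro: sum_nonneg)
  then have T: "(\<Sum>j\<in>J. (\<Sum>i\<in>J. s j i ^ 3) * (\<Sum>k\<in>J. s j k ^ 3)) \<le> real n * W\<^sup>2"
    by (simp add: J_def power2_eq_square)
  define T where "T = (\<Sum>j\<in>J. (\<Sum>i\<in>J. s j i ^ 3) * (\<Sum>k\<in>J. s j k ^ 3))"
  have 1: "(\<Sum>i\<in>J. \<Sum>j\<in>J. \<Sum>k\<in>J. s j i ^ 3 * s j k ^ 3) = T"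
    unfolding T_def by (subst sum.swap) (simp add: sum_product)
  have 2: "(\<Sum>i\<in>J. \<Sum>j\<in>J. \<Sum>k\<in>J. s k j ^ 3 * s k i ^ 3) = T"
  proof -
    have "(\<Sum>i\<in>J. \<Sum>j\<in>J. \<Sum>k\<in>J. s k j ^ 3 * s k i ^ 3) = (\<Sum>i\<in>J. \<Sum>k\<in>J. \<Sum>j\<in>J. s k j ^ 3 * s k i ^ 3)"
      by (intro sum.cong refl sum.swap)
    also have "\<dots> = (\<Sum>k\<in>J. \<Sum>i\<in>J. \<Sum>j\<in>J. s k j ^ 3 * s k i ^ 3)"
      by (rule sum.swap)
    finally show ?thesis by (simp add: T_def sum_product mult.commute)
  qed
  have 3: "(\<Sum>i\<in>J. \<Sum>j\<in>J. \<Sum>k\<in>J. s i k ^ 3 * s i j ^ 3) = T"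
    by (simp add: T_def sum_product mult.commute)
  have "(\<Sum>i\<in>J. \<Sum>j\<in>J. \<Sum>k\<in>J. r i j * r j k * r k i) \<le> (\<Sum>i\<in>J. \<Sum>j\<in>J. \<Sum>k\<in>J.
      C ^ 3 / 3 * (s j i ^ 3 * s j k ^ 3 + s k j ^ 3 * s k i ^ 3 + s i k ^ 3 * s i j ^ 3))"
    by (intro sum_mono pointwise)
  also have "\<dots> = C ^ 3 / 3 * (\<Sum>i\<in>J. \<Sum>j\<in>J. \<Sum>k\<in>J.
      s j i ^ 3 * s j k ^ 3 + s k j ^ 3 * s k i ^ 3 + s i k ^ 3 * s i j ^ 3)"
    by (simp only: sum_distrib_left)
  also have "\<dots> = C ^ 3 / 3 * (T + T + T)"
    by (simp only: sum.distrib 1 2 3)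
  also have "\<dots> = C ^ 3 * T" by simp
  also have "\<dots> \<le> C ^ 3 * (real n * W\<^sup>2)"
    using T \<open>C \<ge> 0\<close> by (intro mult_left_mono) (auto simp: T_def)
  finally show ?thesis by (simp only: J_def W_def)
qed

section \<open>Growth of the partial sums of \<rho>^(3/2) and the resulting rates\<close>

lemma sum_powr_le:
  assumes "0 < s" "s < 1"
  shows "(\<Sum>k=1..m. real k powr (-s)) \<le> real m powr (1 - s) / (1 - s)"
proof (induction m)
  case (Suc m)
  \<comment> \<open>By the mean value theorem each term is at most the increment of
    \<open>x powr (1 - s) / (1 - s)\<close>, so the sum telescopes. The theorem is not applied at 0;
    there \<open>0 powr (1 - s) = 0\<close> settles the claim directly.\<close>
  have step: "(1 - s) * real (Suc m) powr (-s) \<le> real (Suc m) powr (1 - s) - real m powr (1 - s)"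
  proof (cases "m = 0")
    case False
    have "\<exists>z. real m < z \<and> z < real (Suc m) \<and> real (Suc m) powr (1 - s) - real m powr (1 - s)
        = (real (Suc m) - real m) * ((1 - s) * z powr (1 - s - 1))"
    proof (rule MVT2)
      fix x assume "real m \<le> x"
      with False have "0 < x" by simp
      then show "((\<lambda>z. z powr (1 - s)) has_real_derivative (1 - s) * x powr (1 - s - 1)) (at x)"
        by (rule has_real_derivative_powr)
    qed simp
    then obtain z where z: "real m < z" "z < real (Suc m)"
      "real (Suc m) powr (1 - s) - real m powr (1 - s) = (1 - s) * z powr (- s)"
      by auto
    have "real (Suc m) powr (-s) \<le> z powr (-s)"
      using z False assms by (intro powr_mono2') auto
    then show ?thesis using z assms by (simp add: mult_left_mono)
  qed (use assms in simp)
  have "(\<Sum>k=1..Suc m. real k powr (-s)) \<le> real m powr (1 - s) / (1 - s) + real (Suc m) powr (-s)"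
    using Suc.IH by simp
  also have "real (Suc m) powr (-s) \<le> (real (Suc m) powr (1 - s) - real m powr (1 - s)) / (1 - s)"
    using step assms by (simp add: pos_le_divide_eq mult.commute)
  also have "real m powr (1 - s) / (1 - s) + \<dots> = real (Suc m) powr (1 - s) / (1 - s)"
    by (simp add: diff_divide_distrib)
  finally show ?case by simp
qed simp

text \<open>\<open>ln x \<le> x - 1\<close> at \<open>x = m / (m + 1)\<close> shows that each new
  term is at most the increment of the logarithm.\<close>

lemma sum_inverse_le:
  assumes "m \<ge> 1"
  shows "(\<Sum>k=1..m. real k powr (-1)) \<le> 1 + ln (real m)"
  using assms
proof (induction m rule: dec_induct)
  case (step m)
  have "ln (real m / real (Suc m)) \<le> real m / real (Suc m) - 1"
    using step by (intro ln_le_minus_one) auto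
  also have "real m / real (Suc m) - 1 = - (1 / real (Suc m))" by (simp add: field_simps)
  finally have "ln (real m) + 1 / real (Suc m) \<le> ln (real (Suc m))"
    using step by (simp add: ln_div)
  then show ?case using step.IH by (simp add: powr_minus inverse_eq_divide)
qed simp

lemma bigo_powr_bound_nat:
  fixes \<rho> :: "real \<Rightarrow> real"
  assumes O: "\<rho> \<in> O[at_infinity](\<lambda>t. \<bar>t\<bar> powr (-\<beta>))" and pos: "\<And>t. \<rho> t > 0"
  obtains A where "A > 0" "\<And>k. k \<ge> 1 \<Longrightarrow> \<rho> (real k) \<le> A * real k powr (-\<beta>)"
proof -
  obtain c where "c > 0" and c: "\<forall>\<^sub>F t in at_infinity. norm (\<rho> t) \<le> c * norm (\<bar>t\<bar> powr (-\<beta>))"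
    using landau_o.bigE[OF O] by blast
  then obtain b where b: "\<And>t. b \<le> \<bar>t\<bar> \<Longrightarrow> \<bar>\<rho> t\<bar> \<le> c * \<bar>t\<bar> powr (-\<beta>)"
    by (auto simp: eventually_at_infinity)
  define N where "N = nat \<lceil>b\<rceil>"
  \<comment> \<open>The asymptotic bound holds from \<open>N\<close> on. The finitely many earlier
    indices are absorbed into the constant, since each product
    \<open>\<rho> k * k powr \<beta>\<close> is at most the sum of all of them.\<close>
  define S where "S = (\<Sum>k<N. \<rho> (real k) * real k powr \<beta>)"
  have "S \<ge> 0" unfolding S_def using pos by (intro sum_nonneg) (simp add: less_imp_le)
  show ?thesis
  proof (rule that[of "c + S"])
    fix k :: nat assume k: "k \<ge> 1"
    have p: "real k powr (-\<beta>) > 0" using k by simp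
    show "\<rho> (real k) \<le> (c + S) * real k powr (-\<beta>)"
    proof (cases "k < N")
      case True
      have "\<rho> (real k) * real k powr \<beta> \<le> S"
        unfolding S_def using True pos by (intro member_le_sum) (auto simp: less_imp_le)
      then have "\<rho> (real k) * real k powr \<beta> * real k powr (-\<beta>) \<le> S * real k powr (-\<beta>)"
        by (intro mult_right_mono) auto
      moreover have "real k powr \<beta> * real k powr (-\<beta>) = 1"
        using k by (simp add: powr_add[symmetric])
      ultimately have "\<rho> (real k) \<le> S * real k powr (-\<beta>)"
        by (simp add: mult.assoc)
      also have "\<dots> \<le> (c + S) * real k powr (-\<beta>)"
        using \<open>c > 0\<close> by (intro mult_right_mono) auto
      finally show ?thesis .
    next
      case False
      then have "b \<le> \<bar>real k\<bar>" by (simp add: N_def) linarith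
      then have "\<rho> (real k) \<le> c * real k powr (-\<beta>)" using b[of "real k"] by simp
      also have "\<dots> \<le> (c + S) * real k powr (-\<beta>)"
        using \<open>S \<ge> 0\<close> by (intro mult_right_mono) auto
      finally show ?thesis .
    qed
  qed (use \<open>c > 0\<close> \<open>S \<ge> 0\<close> in simp)
qed

text \<open>The terms decay like k^(-s) with \<open>s = 3 * \<beta> / 2\<close>, so the threshold
  \<open>\<beta> = 2/3\<close> is \<open>s = 1\<close>. The sum is at most of order n^(1 - s), log n
  or 1 for \<open>s\<close> below, at or above 1. The value \<open>\<beta> = 1/2\<close> belongs to
  the first case, where the exponent \<open>3/2 - 3 * \<beta>\<close> is 0.\<close>

lemma partial_sum_rate:
  fixes \<rho> :: "real \<Rightarrow> real"
  assumes O: "\<rho> \<in> O[at_infinity](\<lambda>t. \<bar>t\<bar> powr (-\<beta>))" and pos: "\<And>t. \<rho> t > 0" and \<rho>0: "\<rho> 0 = 1"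
    and \<beta>: "\<beta> \<ge> 1/2"
  obtains K where "K > 0"
    "\<And>n. n > 1 \<Longrightarrow> real n powr (-1/2) * (\<Sum>k<n. sqrt (\<rho> (real k)) ^ 3)\<^sup>2 \<le> K * rate \<beta> n"
proof -
  define W where "W = (\<lambda>n :: nat. \<Sum>k<n. sqrt (\<rho> (real k)) ^ 3)"
  obtain A where A: "A > 0" "\<And>k. k \<ge> 1 \<Longrightarrow> \<rho> (real k) \<le> A * real k powr (-\<beta>)"
    using bigo_powr_bound_nat[OF O pos] by blast
  define s where "s = 3 * \<beta> / 2"
  define D where "D = sqrt A ^ 3"
  have "D > 0" using A by (simp add: D_def)
  have term_le: "sqrt (\<rho> (real k)) ^ 3 \<le> D * real k powr (-s)" if k: "k \<ge> 1" for k
  proof -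
    have "sqrt (\<rho> (real k)) ^ 3 \<le> sqrt (A * real k powr (-\<beta>)) ^ 3"
      using A(2)[OF k] pos[of "real k"] by (intro power_mono real_sqrt_le_mono) auto
    also have "\<dots> = D * sqrt (real k powr (-\<beta>)) ^ 3"
      by (simp add: D_def real_sqrt_mult power_mult_distrib)
    also have "sqrt (real k powr (-\<beta>)) ^ 3 = real k powr (-s)"
      using k by (simp add: powr_half_sqrt[symmetric] powr_powr powr_power s_def)
    finally show ?thesis .
  qed
  have W_le: "W n \<le> 1 + D * (\<Sum>k=1..n-1. real k powr (-s))" if "n > 1" for n
  proof -
    have "{..<n} = insert 0 {1..n-1}" using that by auto
    then have "W n = 1 + (\<Sum>k=1..n-1. sqrt (\<rho> (real k)) ^ 3)"
      by (simp add: W_def \<rho>0)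
    also have "(\<Sum>k=1..n-1. sqrt (\<rho> (real k)) ^ 3) \<le> (\<Sum>k=1..n-1. D * real k powr (-s))"
      by (intro sum_mono term_le) auto
    finally show ?thesis by (simp add: sum_distrib_left)
  qed
  have W_nn: "W n \<ge> 0" for n
    unfolding W_def using pos by (intro sum_nonneg) (simp add: less_imp_le)
  \<comment> \<open>The profile \<open>g\<close> carries the growth and \<open>c\<close> the
    constant; \<open>g\<close> is chosen so that n^(-1/2) times its square is exactly the
    rate.\<close>
  have "\<exists>c>0. \<exists>g. \<forall>n>1. W n \<le> c * g n \<and> real n powr (-1/2) * (g n)\<^sup>2 = rate \<beta> n"
  proof -
    consider "\<beta> < 2/3" | "\<beta> = 2/3" | "\<beta> > 2/3" by linarith
    then show ?thesis
    proof cases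
      case 1
      have s: "0 < s" "s < 1" using 1 \<beta> by (auto simp: s_def)
      show ?thesis
      proof (intro exI[of _ "1 + D / (1 - s)"] exI[of _ "\<lambda>n. real n powr (1 - s)"] conjI allI impI)
        show "1 + D / (1 - s) > 0" using \<open>D > 0\<close> s by (simp add: add_pos_pos)
        fix n :: nat assume n: "n > 1"
        have "(\<Sum>k=1..n-1. real k powr (-s)) \<le> real (n - 1) powr (1 - s) / (1 - s)"
          by (rule sum_powr_le[OF s])
        also have "\<dots> \<le> real n powr (1 - s) / (1 - s)"
          using s by (intro divide_right_mono powr_mono2) auto
        finally have "D * (\<Sum>k=1..n-1. real k powr (-s)) \<le> D * (real n powr (1 - s) / (1 - s))"
          using \<open>D > 0\<close> by (intro mult_left_mono) auto
        moreover have "1 \<le> real n powr (1 - s)"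
          using n s by (intro ge_one_powr_ge_zero) auto
        ultimately show "W n \<le> (1 + D / (1 - s)) * real n powr (1 - s)"
          using W_le[OF n] by (simp add: algebra_simps)
        have "real n powr (-1/2) * (real n powr (1 - s))\<^sup>2 = real n powr (3/2 - 3 * \<beta>)"
          using n by (simp add: powr_power powr_add[symmetric] s_def algebra_simps)
        then show "real n powr (-1/2) * (real n powr (1 - s))\<^sup>2 = rate \<beta> n"
          using 1 n by (auto simp: rate_def)
      qed
    next
      case 2
      then have s: "s = 1" by (simp add: s_def)
      show ?thesis
      proof (intro exI[of _ "(1 + D) / ln 2 + D"] exI[of _ "\<lambda>n. ln (real n)"] conjI allI impI)
        show "(1 + D) / ln 2 + D > 0" using \<open>D > 0\<close> by (simp add: add_pos_pos)
        fix n :: nat assume n: "n > 1"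
        have "(\<Sum>k=1..n-1. real k powr (-s)) \<le> 1 + ln (real (n - 1))"
          unfolding s by (rule sum_inverse_le) (use n in auto)
        also have "\<dots> \<le> 1 + ln (real n)" using n by simp
        finally have "D * (\<Sum>k=1..n-1. real k powr (-s)) \<le> D * (1 + ln (real n))"
          using \<open>D > 0\<close> by (intro mult_left_mono) auto
        then have "W n \<le> (1 + D) * 1 + D * ln (real n)"
          using W_le[OF n] by (simp add: algebra_simps)
        \<comment> \<open>From \<open>n \<ge> 2\<close> the additive constant is absorbed by the
          logarithm. At \<open>n = 1\<close> this would fail, as the rate vanishes there.\<close>
        also have "1 \<le> ln (real n) / ln 2" using n by simp
        then have "(1 + D) * 1 \<le> (1 + D) * (ln (real n) / ln 2)"
          using \<open>D > 0\<close> by (intro mult_left_mono) auto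
        finally show "W n \<le> ((1 + D) / ln 2 + D) * ln (real n)"
          by (simp add: algebra_simps)
        show "real n powr (-1/2) * (ln (real n))\<^sup>2 = rate \<beta> n"
          using 2 by (simp add: rate_def)
      qed
    next
      case 3
      then have s: "s > 1" by (simp add: s_def)
      then have summ: "summable (\<lambda>k. real k powr (-s))" by (simp add: summable_real_powr_iff)
      define B where "B = (\<Sum>k. real k powr (-s))"
      have "B \<ge> 0" unfolding B_def by (intro suminf_nonneg summ) auto
      show ?thesis
      proof (intro exI[of _ "1 + D * B"] exI[of _ "\<lambda>n. 1"] conjI allI impI)
        show "1 + D * B > 0" using \<open>D > 0\<close> \<open>B \<ge> 0\<close> by (simp add: add_pos_nonneg)
        fix n :: nat assume n: "n > 1"
        have "(\<Sum>k=1..n-1. real k powr (-s)) \<le> B"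
          unfolding B_def by (intro sum_le_suminf summ) auto
        then have "D * (\<Sum>k=1..n-1. real k powr (-s)) \<le> D * B"
          using \<open>D > 0\<close> by (intro mult_left_mono) auto
        then show "W n \<le> (1 + D * B) * 1" using W_le[OF n] by simp
        show "real n powr (-1/2) * 1\<^sup>2 = rate \<beta> n" using 3 by (simp add: rate_def)
      qed
    qed
  qed
  then obtain c g where c: "c > 0" "\<And>n. n > 1 \<Longrightarrow> W n \<le> c * g n"
    "\<And>n. n > 1 \<Longrightarrow> real n powr (-1/2) * (g n)\<^sup>2 = rate \<beta> n" by blast
  show ?thesis
  proof (rule that[of "c\<^sup>2"])
    fix n :: nat assume n: "n > 1"
    have "(W n)\<^sup>2 \<le> (c * g n)\<^sup>2" using c(2)[OF n] W_nn by (intro power_mono) auto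
    then have "real n powr (-1/2) * (W n)\<^sup>2 \<le> real n powr (-1/2) * (c * g n)\<^sup>2"
      by (intro mult_left_mono) auto
    also have "\<dots> = c\<^sup>2 * rate \<beta> n"
      using c(3)[OF n] by (simp add: power_mult_distrib)
    finally show "real n powr (-1/2) * (\<Sum>k<n. sqrt (\<rho> (real k)) ^ 3)\<^sup>2 \<le> c\<^sup>2 * rate \<beta> n"
      by (simp add: W_def)
  qed (use c in simp)
qed

lemma rate_nonneg: "rate \<beta> n \<ge> 0"
  by (simp add: rate_def)

lemma rate_tendsto_0:
  assumes "\<beta> > 1/2"
  shows "rate \<beta> \<longlonglongrightarrow> 0"
proof -
  have powr: "(\<lambda>n. real n powr a) \<longlonglongrightarrow> 0" if "a < 0" for a
    by (rule tendsto_neg_powr[OF that filterlim_real_sequentially])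
  consider "\<beta> < 2/3" | "\<beta> = 2/3" | "\<beta> > 2/3" by linarith
  then show ?thesis
  proof cases
    case 1
    then have "rate \<beta> = (\<lambda>n. real n powr (3/2 - 3 * \<beta>))"
      using assms by (auto simp: rate_def)
    then show ?thesis using powr[of "3/2 - 3 * \<beta>"] assms by simp
  next
    case 2
    have quarter: "(real n powr (1/4))\<^sup>2 = real n powr (1/2)" for n
      by (simp add: power2_eq_square powr_add[symmetric])
    \<comment> \<open>At the threshold the rate is the square of \<open>ln n\<close> over the fourth
      root of \<open>n\<close>.\<close>
    have "(\<lambda>n. (ln (real n) / real n powr (1/4))\<^sup>2) \<longlonglongrightarrow> 0\<^sup>2"
      by (intro tendsto_power lim_ln_over_power) simp
    moreover have "(ln (real n) / real n powr (1/4))\<^sup>2 = rate \<beta> n" for n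
      using 2 by (simp add: rate_def power_divide quarter powr_minus field_simps)
    ultimately show ?thesis by simp
  next
    case 3
    then have "rate \<beta> = (\<lambda>n. real n powr (-1/2))" by (auto simp: rate_def)
    then show ?thesis using powr[of "-1/2"] by simp
  qed
qed

section \<open>The sample second moment\<close>

lemma (in prob_space) wasserstein_std_normal_le:
  fixes Y :: "'a \<Rightarrow> real"
  assumes [measurable]: "Y \<in> borel_measurable M"
    and bound: "\<And>g. (\<And>x y. \<bar>g x - g y\<bar> \<le> \<bar>x - y\<bar>) \<Longrightarrow>
      \<bar>expectation (\<lambda>\<omega>. g (Y \<omega>)) - (\<integral>x. std_normal_density x * g x \<partial>lborel)\<bar> \<le> B"
  shows "wasserstein (distr M borel Y) std_normal_distribution \<le> ereal B"
  unfolding wasserstein_def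
proof (rule SUP_least)
  fix g :: "real \<Rightarrow> real" assume "g \<in> {f. 1-lipschitz_on UNIV f}"
  then have lip: "\<bar>g x - g y\<bar> \<le> \<bar>x - y\<bar>" for x y
    by (auto simp: lipschitz_on_def dist_real_def)
  have [measurable]: "g \<in> borel_measurable borel"
    by (rule borel_measurable_lipschitz[of g 1]) (simp add: lip)
  have "(\<integral>x. g x \<partial>distr M borel Y) = expectation (\<lambda>\<omega>. g (Y \<omega>))"
    by (rule integral_distr) measurable
  moreover have "(\<integral>x. g x \<partial>std_normal_distribution) = (\<integral>x. std_normal_density x * g x \<partial>lborel)"
    by (subst integral_density) auto
  ultimately show "ereal \<bar>(\<integral>x. g x \<partial>distr M borel Y) - (\<integral>x. g x \<partial>std_normal_distribution)\<bar> \<le> ereal B"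
    using bound[OF lip] by simp
qed

text \<open>Covers three comparisons: a pure shift for \<open>a = a'\<close>, a change of scale
  together with a shift, and, for \<open>a' = 0\<close>, the comparison with a constant.\<close>

lemma (in prob_space) lipschitz_affine_difference:
  fixes V :: "'a \<Rightarrow> real" and g :: "real \<Rightarrow> real"
  assumes V: "integrable M V" and lip: "\<And>x y. \<bar>g x - g y\<bar> \<le> \<bar>x - y\<bar>"
  shows "\<bar>expectation (\<lambda>\<omega>. g (a * V \<omega> + b)) - expectation (\<lambda>\<omega>. g (a' * V \<omega>))\<bar>
    \<le> \<bar>a - a'\<bar> * expectation (\<lambda>\<omega>. \<bar>V \<omega>\<bar>) + \<bar>b\<bar>"
proof -
  have lip1: "\<bar>g x - g y\<bar> \<le> 1 * \<bar>x - y\<bar>" for x y using lip by simp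
  have int: "integrable M (\<lambda>\<omega>. g (a * V \<omega> + b))" "integrable M (\<lambda>\<omega>. g (a' * V \<omega>))"
    using V by (auto intro!: integrable_lipschitz[OF lip1])
  have "\<bar>expectation (\<lambda>\<omega>. g (a * V \<omega> + b)) - expectation (\<lambda>\<omega>. g (a' * V \<omega>))\<bar>
      = \<bar>expectation (\<lambda>\<omega>. g (a * V \<omega> + b) - g (a' * V \<omega>))\<bar>"
    using int by simp
  also have "\<dots> \<le> expectation (\<lambda>\<omega>. \<bar>g (a * V \<omega> + b) - g (a' * V \<omega>)\<bar>)"
    by (rule integral_abs_bound)
  also have "\<dots> \<le> expectation (\<lambda>\<omega>. \<bar>a - a'\<bar> * \<bar>V \<omega>\<bar> + \<bar>b\<bar>)"
  proof (rule integral_mono)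
    fix \<omega>
    have "\<bar>g (a * V \<omega> + b) - g (a' * V \<omega>)\<bar> \<le> \<bar>(a - a') * V \<omega> + b\<bar>"
      using lip[of "a * V \<omega> + b" "a' * V \<omega>"] by (simp add: algebra_simps)
    also have "\<dots> \<le> \<bar>a - a'\<bar> * \<bar>V \<omega>\<bar> + \<bar>b\<bar>"
      by (rule order_trans[OF abs_triangle_ineq]) (simp add: abs_mult)
    finally show "\<bar>g (a * V \<omega> + b) - g (a' * V \<omega>)\<bar> \<le> \<bar>a - a'\<bar> * \<bar>V \<omega>\<bar> + \<bar>b\<bar>" .
  qed (use int V in auto)
  also have "\<dots> = \<bar>a - a'\<bar> * expectation (\<lambda>\<omega>. \<bar>V \<omega>\<bar>) + \<bar>b\<bar>"
    using V by (simp add: prob_space)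
  finally show ?thesis .
qed

locale wiener_sequence = wiener_integral_gaussian M G e I
  for M :: "'w measure" and G :: "real \<Rightarrow> 'w \<Rightarrow> real"
    and e :: "real \<Rightarrow> 'h :: {real_inner, complete_space}" and I :: "'h \<Rightarrow> 'w \<Rightarrow> real" +
  fixes h :: "nat \<Rightarrow> 'h" and X :: "nat \<Rightarrow> 'w \<Rightarrow> real"
  assumes X: "X n = I (h n)"
begin

abbreviation V where "V \<equiv> fluct_V M X"
abbreviation v where "v \<equiv> var_v M X"
abbreviation A where "A \<equiv> mean_A M X"

lemma X_measurable[measurable]: "X n \<in> borel_measurable M"
  by (simp add: X)

lemma V_measurable[measurable]: "V n \<in> borel_measurable M"
  unfolding fluct_V_def[abs_def] by measurable

lemma f_hat_measurable[measurable]: "f_hat X n \<in> borel_measurable M"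
  unfolding f_hat_def[abs_def] by measurable

lemma f_hat_eq: "n > 0 \<Longrightarrow> f_hat X n \<omega> = A n + V n \<omega> / sqrt (real n)"
  by (simp add: f_hat_def mean_A_def fluct_V_def sum_subtractf diff_divide_distrib)

text \<open>Each \<open>X j\<close> is the combination of the \<open>I u\<close> with coefficients
  \<open>h j \<bullet> u\<close>, and the choice of \<open>U\<close> removes the cross terms from
  the sum of squares. The \<open>l u\<close> are the eigenvalues of the covariance matrix on
  \<open>U\<close>. The identity is only almost sure because \<open>I\<close> is only almost surely
  linear.\<close>

lemma quadratic_form_diagonalization:
  obtains U l where "finite U" "indep_vars (\<lambda>_. borel) I U"
    "\<And>u. u \<in> U \<Longrightarrow> distr M borel (I u) = std_normal_distribution"
    "\<And>u. u \<in> U \<Longrightarrow> l u \<ge> 0"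
    "AE \<omega> in M. V n \<omega> = (\<Sum>u\<in>U. l u / sqrt (real n) * ((I u \<omega>)\<^sup>2 - 1))"
    "(\<Sum>u\<in>U. l u ^ 3) = (\<Sum>i=1..n. \<Sum>j=1..n. \<Sum>k=1..n.
        (h i \<bullet> h j) * (h j \<bullet> h k) * (h k \<bullet> h i))"
proof -
  define J where "J = {1..n}"
  have "finite J" by (simp add: J_def)
  then obtain U where U: "finite U" "pairwise orthogonal U" "\<And>u. u \<in> U \<Longrightarrow> norm u = 1"
    and hU: "\<And>j. j \<in> J \<Longrightarrow> h j = (\<Sum>u\<in>U. (h j \<bullet> u) *\<^sub>R u)"
    and diag: "\<And>u w. u \<in> U \<Longrightarrow> w \<in> U \<Longrightarrow> u \<noteq> w \<Longrightarrow> (\<Sum>j\<in>J. (h j \<bullet> u) * (h j \<bullet> w)) = 0"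
    by (rule exists_diagonalizing_orthonormal_set[of J h]) blast
  define l where "l = (\<lambda>u. \<Sum>j\<in>J. (h j \<bullet> u)\<^sup>2)"
  have inner: "h i \<bullet> h j = (\<Sum>u\<in>U. (h i \<bullet> u) * (h j \<bullet> u))" if "j \<in> J" for i j
  proof -
    have "h i \<bullet> h j = h i \<bullet> (\<Sum>u\<in>U. (h j \<bullet> u) *\<^sub>R u)" by (subst hU[OF that]) simp
    then show ?thesis by (simp add: inner_sum_right mult.commute)
  qed
  have trace: "(\<Sum>i\<in>J. \<Sum>j\<in>J. \<Sum>k\<in>J. (h i \<bullet> h j) * (h j \<bullet> h k) * (h k \<bullet> h i)) = (\<Sum>u\<in>U. l u ^ 3)"
    unfolding l_def by (rule trace_cube_diagonalized[OF U(1) diag inner])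
  have square: "(\<Sum>j\<in>J. (\<Sum>u\<in>U. (h j \<bullet> u) * z u)\<^sup>2) = (\<Sum>u\<in>U. l u * (z u)\<^sup>2)" for z :: "'h \<Rightarrow> real"
  proof -
    have "(\<Sum>j\<in>J. (\<Sum>u\<in>U. (h j \<bullet> u) * z u)\<^sup>2)
        = (\<Sum>j\<in>J. \<Sum>u\<in>U. \<Sum>w\<in>U. (z u * z w) * ((h j \<bullet> u) * (h j \<bullet> w)))"
      by (simp add: power2_eq_square sum_product mult_ac)
    also have "\<dots> = (\<Sum>u\<in>U. \<Sum>j\<in>J. \<Sum>w\<in>U. (z u * z w) * ((h j \<bullet> u) * (h j \<bullet> w)))"
      by (rule sum.swap)
    also have "\<dots> = (\<Sum>u\<in>U. \<Sum>w\<in>U. (z u * z w) * (\<Sum>j\<in>J. (h j \<bullet> u) * (h j \<bullet> w)))"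
      by (intro sum.cong refl, subst sum.swap) (simp add: sum_distrib_left)
    also have "\<dots> = (\<Sum>u\<in>U. \<Sum>w\<in>U. if w = u then l u * (z u)\<^sup>2 else 0)"
      by (intro sum.cong refl) (auto simp: diag l_def power2_eq_square)
    also have "\<dots> = (\<Sum>u\<in>U. l u * (z u)\<^sup>2)" using U(1) by simp
    finally show ?thesis .
  qed
  \<comment> \<open>Both sides sum \<open>(h i \<bullet> u)\<^sup>2\<close> over all pairs, so the
    trace supplies exactly the constants that turn squares into centered squares.\<close>
  have mean: "(\<Sum>i\<in>J. expectation (\<lambda>\<omega>. (X i \<omega>)\<^sup>2)) = (\<Sum>u\<in>U. l u)"
  proof -
    have "(\<Sum>i\<in>J. expectation (\<lambda>\<omega>. (X i \<omega>)\<^sup>2)) = (\<Sum>i\<in>J. \<Sum>u\<in>U. (h i \<bullet> u)\<^sup>2)"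
      by (intro sum.cong refl) (simp only: X I_norm power2_norm_eq_inner inner, simp only: power2_eq_square)
    also have "\<dots> = (\<Sum>u\<in>U. l u)" unfolding l_def by (rule sum.swap)
    finally show ?thesis .
  qed
  have "AE \<omega> in M. \<forall>j\<in>J. X j \<omega> = (\<Sum>u\<in>U. (h j \<bullet> u) * I u \<omega>)"
  proof (intro AE_finite_allI)
    fix j assume "j \<in> J"
    then show "AE \<omega> in M. X j \<omega> = (\<Sum>u\<in>U. (h j \<bullet> u) * I u \<omega>)"
      using I_sum[OF U(1), of "\<lambda>u. h j \<bullet> u" "\<lambda>u. u"] hU[of j] by (simp add: X)
  qed (simp add: J_def)
  then have AE: "AE \<omega> in M. V n \<omega> = (\<Sum>u\<in>U. l u / sqrt (real n) * ((I u \<omega>)\<^sup>2 - 1))"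
  proof eventually_elim
    case (elim \<omega>)
    have "(\<Sum>j\<in>J. (X j \<omega>)\<^sup>2) = (\<Sum>j\<in>J. (\<Sum>u\<in>U. (h j \<bullet> u) * I u \<omega>)\<^sup>2)"
      using elim by (intro sum.cong) auto
    also have "\<dots> = (\<Sum>u\<in>U. l u * (I u \<omega>)\<^sup>2)" by (rule square)
    finally have "(\<Sum>j\<in>J. (X j \<omega>)\<^sup>2 - expectation (\<lambda>\<omega>. (X j \<omega>)\<^sup>2)) = (\<Sum>u\<in>U. l u * ((I u \<omega>)\<^sup>2 - 1))"
      by (simp only: sum_subtractf mean) (simp add: right_diff_distrib sum_subtractf)
    then show ?case
      by (simp add: fluct_V_def J_def sum_distrib_left sum_divide_distrib)
  qed
  show ?thesis
  proof (rule that[of U l])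
    show "indep_vars (\<lambda>_. borel) I U" by (rule indep_vars_I_orthonormal[OF U])
    show "distr M borel (I u) = std_normal_distribution" if "u \<in> U" for u
      by (rule distr_I_unit[OF U(3)[OF that]])
    show "l u \<ge> 0" for u by (simp add: l_def sum_nonneg)
  qed (use U AE trace in \<open>simp_all add: J_def\<close>)
qed

text \<open>The definition of the Wiener integral provides second moments of \<open>X\<close>,
  whereas this needs fourth ones; they come from the diagonal form in standard normal
  variables.\<close>

lemma V_moments:
  shows "integrable M (V n)" "expectation (\<lambda>\<omega>. \<bar>V n \<omega>\<bar>) \<le> sqrt (v n)"
proof -
  obtain U l where U: "finite U" "indep_vars (\<lambda>_. borel) I U"
    "\<And>u. u \<in> U \<Longrightarrow> distr M borel (I u) = std_normal_distribution"
    and AE: "AE \<omega> in M. V n \<omega> = (\<Sum>u\<in>U. l u / sqrt (real n) * ((I u \<omega>)\<^sup>2 - 1))"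
    by (rule quadratic_form_diagonalization[of n]) blast
  have "integrable M (\<lambda>\<omega>. (\<Sum>u\<in>U. l u / sqrt (real n) * ((I u \<omega>)\<^sup>2 - 1))\<^sup>2)"
    by (rule variance_quadratic_form[OF U])
  moreover have "AE \<omega> in M. (V n \<omega>)\<^sup>2 = (\<Sum>u\<in>U. l u / sqrt (real n) * ((I u \<omega>)\<^sup>2 - 1))\<^sup>2"
    using AE by eventually_elim simp
  ultimately have "integrable M (\<lambda>\<omega>. (V n \<omega>)\<^sup>2)"
    by (subst integrable_cong_AE) auto
  from L1_le_L2[OF V_measurable this]
  show "integrable M (V n)" "expectation (\<lambda>\<omega>. \<bar>V n \<omega>\<bar>) \<le> sqrt (v n)"
    by (simp_all add: var_v_def)
qed

text \<open>Dividing by \<open>sqrt (v n)\<close> turns the eigenvalues into weights with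
  \<open>2 * (\<Sum>u\<in>U. (a u)\<^sup>2) = 1\<close>, as the quadratic form bound requires. The
  sum of their cubes is the trace of the cubed covariance matrix divided by
  \<open>(n * v n) powr (3/2)\<close>, and the factor 4 comes from squaring
  \<open>2 * W\<close>.\<close>

lemma normal_approximation_V:
  fixes g :: "real \<Rightarrow> real" and r :: "nat \<Rightarrow> real"
  assumes cov: "\<And>i j. \<bar>expectation (\<lambda>\<omega>. X i \<omega> * X j \<omega>)\<bar> \<le> C * r (if i \<le> j then j - i else i - j)"
    and "C \<ge> 0" and r: "\<And>k. r k \<ge> 0"
    and "v n > 0" and "n > 0" and lip: "\<And>x y. \<bar>g x - g y\<bar> \<le> \<bar>x - y\<bar>"
  shows "\<bar>expectation (\<lambda>\<omega>. g (V n \<omega> / sqrt (v n))) - (\<integral>x. std_normal_density x * g x \<partial>lborel)\<bar>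
    \<le> 4 * chi_square_constant * C ^ 3 * (real n powr (-1/2) * (\<Sum>k<n. sqrt (r k) ^ 3)\<^sup>2)
      / v n powr (3/2)"
proof -
  define W where "W = (\<Sum>k<n. sqrt (r k) ^ 3)"
  obtain U l where U: "finite U" "indep_vars (\<lambda>_. borel) I U"
    "\<And>u. u \<in> U \<Longrightarrow> distr M borel (I u) = std_normal_distribution"
    and l: "\<And>u. u \<in> U \<Longrightarrow> l u \<ge> 0"
    and AE: "AE \<omega> in M. V n \<omega> = (\<Sum>u\<in>U. l u / sqrt (real n) * ((I u \<omega>)\<^sup>2 - 1))"
    and trace: "(\<Sum>u\<in>U. l u ^ 3) = (\<Sum>i=1..n. \<Sum>j=1..n. \<Sum>k=1..n.
        (h i \<bullet> h j) * (h j \<bullet> h k) * (h k \<bullet> h i))"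
    by (rule quadratic_form_diagonalization[of n]) blast
  have [measurable]: "g \<in> borel_measurable borel"
    by (rule borel_measurable_lipschitz[of g 1]) (simp add: lip)
  have trace_le: "(\<Sum>u\<in>U. l u ^ 3) \<le> C ^ 3 * (real n * (2 * W)\<^sup>2)"
    unfolding trace W_def using cov \<open>C \<ge> 0\<close> r by (intro trace_cube_le) (simp_all add: X I_isometry)
  have v: "v n = 2 * (\<Sum>u\<in>U. (l u / sqrt (real n))\<^sup>2)"
  proof -
    have "v n = expectation (\<lambda>\<omega>. (\<Sum>u\<in>U. l u / sqrt (real n) * ((I u \<omega>)\<^sup>2 - 1))\<^sup>2)"
      unfolding var_v_def by (rule integral_cong_AE) (use AE in auto)
    then show ?thesis by (simp only: variance_quadratic_form[OF U])
  qed
  define a where "a = (\<lambda>u. l u / (sqrt (real n) * sqrt (v n)))"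
  have a1: "2 * (\<Sum>u\<in>U. (a u)\<^sup>2) = 1"
  proof -
    have "(a u)\<^sup>2 = (l u / sqrt (real n))\<^sup>2 / v n" for u
      using \<open>v n > 0\<close> by (simp add: a_def power_divide power_mult_distrib)
    then have "2 * (\<Sum>u\<in>U. (a u)\<^sup>2) = 2 * (\<Sum>u\<in>U. (l u / sqrt (real n))\<^sup>2) / v n"
      by (simp only: sum_divide_distrib[symmetric] times_divide_eq_right)
    also have "\<dots> = 1" unfolding v[symmetric] using \<open>v n > 0\<close> by simp
    finally show ?thesis .
  qed
  have sqrt3: "sqrt (real n) ^ 3 = real n * sqrt (real n)"
    by (simp add: power3_eq_cube)
  have v32: "sqrt (v n) ^ 3 = v n powr (3/2)"
    using \<open>v n > 0\<close> by (simp add: powr_half_sqrt[symmetric] powr_power)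
  have "(\<Sum>u\<in>U. \<bar>a u\<bar> ^ 3) = (\<Sum>u\<in>U. l u ^ 3) / (real n * sqrt (real n) * v n powr (3/2))"
    using l \<open>v n > 0\<close> by (simp add: a_def power_divide power_mult_distrib sqrt3 v32 sum_divide_distrib)
  also have "\<dots> \<le> C ^ 3 * (real n * (2 * W)\<^sup>2) / (real n * sqrt (real n) * v n powr (3/2))"
    using trace_le by (intro divide_right_mono) auto
  also have "\<dots> = 4 * C ^ 3 * (real n powr (-1/2) * W\<^sup>2) / v n powr (3/2)"
    using \<open>n > 0\<close> by (simp add: powr_minus powr_half_sqrt power_mult_distrib field_simps)
  finally have a3: "(\<Sum>u\<in>U. \<bar>a u\<bar> ^ 3) \<le> 4 * C ^ 3 * (real n powr (-1/2) * W\<^sup>2) / v n powr (3/2)" .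
  have "expectation (\<lambda>\<omega>. g (V n \<omega> / sqrt (v n)))
      = expectation (\<lambda>\<omega>. g (\<Sum>u\<in>U. a u * ((I u \<omega>)\<^sup>2 - 1)))"
  proof (rule integral_cong_AE)
    show "AE \<omega> in M. g (V n \<omega> / sqrt (v n)) = g (\<Sum>u\<in>U. a u * ((I u \<omega>)\<^sup>2 - 1))"
      using AE by eventually_elim (simp add: a_def sum_divide_distrib)
  qed measurable
  then have "\<bar>expectation (\<lambda>\<omega>. g (V n \<omega> / sqrt (v n))) - (\<integral>x. std_normal_density x * g x \<partial>lborel)\<bar>
      \<le> chi_square_constant * (\<Sum>u\<in>U. \<bar>a u\<bar> ^ 3)"
    using normal_approximation_quadratic_form[OF U a1 lip] by simp
  also have "\<dots> \<le> chi_square_constant * (4 * C ^ 3 * (real n powr (-1/2) * W\<^sup>2) / v n powr (3/2))"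
    by (intro mult_left_mono a3 chi_square_constant_nonneg)
  finally show ?thesis by (simp add: W_def mult_ac)
qed

end

text \<open>A continuous step is an affine function of slope \<open>- 1 / (b - a)\<close> clamped to
  [0, 1], and clamping increases no distance.\<close>

lemma cts_step_lipschitz:
  assumes "a < b"
  shows "\<bar>cts_step a b x - cts_step a b y\<bar> \<le> \<bar>x - y\<bar> / (b - a)"
proof -
  have eq: "cts_step a b u = max 0 (min 1 ((b - u) / (b - a)))" for u
    using assms by (auto simp: cts_step_def max_def min_def field_simps)
  have "\<bar>cts_step a b x - cts_step a b y\<bar> \<le> \<bar>(b - x) / (b - a) - (b - y) / (b - a)\<bar>"
    unfolding eq by (auto simp: max_def min_def)
  also have "\<dots> = \<bar>x - y\<bar> / (b - a)"
    using assms by (simp add: diff_divide_distrib[symmetric] abs_minus_commute)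
  finally show ?thesis .
qed

lemma integral_normal_scale:
  fixes g :: "real \<Rightarrow> real"
  assumes "\<sigma> > 0" and [measurable]: "g \<in> borel_measurable borel"
  shows "(\<integral>x. g x \<partial>density lborel (normal_density 0 \<sigma>))
    = (\<integral>x. std_normal_density x * g (\<sigma> * x) \<partial>lborel)"
proof -
  interpret N: prob_space std_normal_distribution by (simp add: prob_space_normal_density)
  have "distributed std_normal_distribution lborel (\<lambda>x. x) std_normal_density"
    by (auto simp: distributed_def intro!: distr_id2)
  then have "distributed std_normal_distribution lborel (\<lambda>x. 0 + \<sigma> * x) (normal_density (0 + \<sigma> * 0) (\<bar>\<sigma>\<bar> * 1))"
    using assms(1) by (intro N.normal_density_affine) auto
  then have "density lborel (normal_density 0 \<sigma>) = distr std_normal_distribution lborel (\<lambda>x. \<sigma> * x)"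
    using assms(1) by (simp add: distributed_def)
  then have "(\<integral>x. g x \<partial>density lborel (normal_density 0 \<sigma>)) = (\<integral>x. g (\<sigma> * x) \<partial>std_normal_distribution)"
    by (simp add: integral_distr)
  also have "\<dots> = (\<integral>x. std_normal_density x * g (\<sigma> * x) \<partial>lborel)"
    by (subst integral_density) auto
  finally show ?thesis .
qed

section \<open>Rates under polynomial decay of the covariance bound\<close>

context wiener_sequence
begin

context
  fixes C\<^sub>0 \<beta> :: real and \<rho> :: "real \<Rightarrow> real"
  assumes \<rho>_pos: "\<And>t. \<rho> t > 0" and \<rho>_0: "\<rho> 0 = 1" and C\<^sub>0: "C\<^sub>0 > 0"
    and cov: "\<And>t s. \<bar>\<integral>\<omega>. X t \<omega> * X s \<omega> \<partial>M\<bar> \<le> C\<^sub>0 * \<rho> \<bar>real t - real s\<bar>"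
    and \<rho>_O: "\<rho> \<in> O[at_infinity](\<lambda>t. \<bar>t\<bar> powr (-\<beta>))" and \<beta>: "\<beta> \<ge> 1/2"
begin

lemma normal_approximation_rate:
  obtains K where "K > 0"
    "\<And>n g. n > 1 \<Longrightarrow> v n > 0 \<Longrightarrow> (\<And>x y. \<bar>g x - g y\<bar> \<le> \<bar>x - y\<bar>) \<Longrightarrow>
      \<bar>expectation (\<lambda>\<omega>. g (V n \<omega> / sqrt (v n))) - (\<integral>x. std_normal_density x * g x \<partial>lborel)\<bar>
      \<le> K * rate \<beta> n / v n powr (3/2)"
proof -
  obtain K where K: "K > 0"
    "\<And>n. n > 1 \<Longrightarrow> real n powr (-1/2) * (\<Sum>k<n. sqrt (\<rho> (real k)) ^ 3)\<^sup>2 \<le> K * rate \<beta> n"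
    using partial_sum_rate[OF \<rho>_O \<rho>_pos \<rho>_0 \<beta>] by blast
  define c where "c = 4 * chi_square_constant * C\<^sub>0 ^ 3"
  have "c \<ge> 0" using C\<^sub>0 chi_square_constant_nonneg by (simp add: c_def)
  show ?thesis
  \<comment> \<open>Only \<open>c \<ge> 0\<close> has been established; the 1 makes the final
    constant strictly positive.\<close>
  proof (rule that[of "(c + 1) * K"])
    show "(c + 1) * K > 0" using \<open>c \<ge> 0\<close> K by simp
    fix n and g :: "real \<Rightarrow> real"
    assume n: "n > 1" and vn: "v n > 0" and lip: "\<And>x y. \<bar>g x - g y\<bar> \<le> \<bar>x - y\<bar>"
    have cov': "\<bar>expectation (\<lambda>\<omega>. X i \<omega> * X j \<omega>)\<bar> \<le> C\<^sub>0 * \<rho> (real (if i \<le> j then j - i else i - j))" for i j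
      using cov[of i j] by (auto simp: of_nat_diff abs_if split: if_splits)
    have "\<bar>expectation (\<lambda>\<omega>. g (V n \<omega> / sqrt (v n))) - (\<integral>x. std_normal_density x * g x \<partial>lborel)\<bar>
        \<le> c * (real n powr (-1/2) * (\<Sum>k<n. sqrt (\<rho> (real k)) ^ 3)\<^sup>2) / v n powr (3/2)"
      unfolding c_def
      by (rule normal_approximation_V[where r="\<lambda>k. \<rho> (real k)", OF cov'])
         (use C\<^sub>0 \<rho>_pos vn n lip in \<open>auto simp: less_imp_le\<close>)
    also have "\<dots> \<le> c * (K * rate \<beta> n) / v n powr (3/2)"
      using K(2)[OF n] \<open>c \<ge> 0\<close> by (intro divide_right_mono mult_left_mono) auto
    also have "\<dots> \<le> (c + 1) * (K * rate \<beta> n) / v n powr (3/2)"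
      using K(1) rate_nonneg[of \<beta> n] by (intro divide_right_mono mult_right_mono) auto
    finally show "\<bar>expectation (\<lambda>\<omega>. g (V n \<omega> / sqrt (v n))) - (\<integral>x. std_normal_density x * g x \<partial>lborel)\<bar>
        \<le> (c + 1) * K * rate \<beta> n / v n powr (3/2)"
      by (simp add: mult_ac)
  qed
qed

text \<open>The bias \<open>b\<close> shifts the argument of a 1-Lipschitz function and so costs at
  most \<open>\<bar>b\<bar>\<close>; the rest is the approximation of
  \<open>V n / sqrt (v n)\<close>. That one divides by \<open>v n powr (3/2)\<close>, and passing to
  the minimum only enlarges the bound.\<close>

lemma wasserstein_self_normalized:
  obtains C where "C > 0" "\<And>n. n > 1 \<Longrightarrow> v n > 0 \<Longrightarrow>
    wasserstein (distr M borel (\<lambda>\<omega>. sqrt (real n / v n) * (f_hat X n \<omega> - f))) std_normal_distribution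
      \<le> ereal (sqrt (real n / v n) * \<bar>A n - f\<bar> + C / min ((v n)\<^sup>2) (v n powr (3/2)) * rate \<beta> n)"
proof -
  obtain K where K: "K > 0"
    "\<And>n g. n > 1 \<Longrightarrow> v n > 0 \<Longrightarrow> (\<And>x y. \<bar>g x - g y\<bar> \<le> \<bar>x - y\<bar>) \<Longrightarrow>
      \<bar>expectation (\<lambda>\<omega>. g (V n \<omega> / sqrt (v n))) - (\<integral>x. std_normal_density x * g x \<partial>lborel)\<bar>
      \<le> K * rate \<beta> n / v n powr (3/2)"
    by (rule normal_approximation_rate) blast
  show ?thesis
  proof (rule that[OF K(1)])
    fix n :: nat assume n: "n > 1" and vn: "v n > 0"
    show "wasserstein (distr M borel (\<lambda>\<omega>. sqrt (real n / v n) * (f_hat X n \<omega> - f))) std_normal_distribution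
      \<le> ereal (sqrt (real n / v n) * \<bar>A n - f\<bar> + K / min ((v n)\<^sup>2) (v n powr (3/2)) * rate \<beta> n)"
    proof (rule wasserstein_std_normal_le)
      fix g :: "real \<Rightarrow> real" assume lip: "\<And>x y. \<bar>g x - g y\<bar> \<le> \<bar>x - y\<bar>"
      define b where "b = sqrt (real n / v n) * (A n - f)"
      have "sqrt (real n / v n) * (f_hat X n \<omega> - f) = (1 / sqrt (v n)) * V n \<omega> + b" for \<omega>
        using n vn by (simp add: f_hat_eq b_def real_sqrt_divide field_simps)
      moreover have "\<bar>expectation (\<lambda>\<omega>. g ((1 / sqrt (v n)) * V n \<omega> + b))
          - expectation (\<lambda>\<omega>. g ((1 / sqrt (v n)) * V n \<omega>))\<bar> \<le> \<bar>b\<bar>"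
        using lipschitz_affine_difference[OF V_moments(1) lip, of "1 / sqrt (v n)" n b "1 / sqrt (v n)"]
        by simp
      moreover have "\<bar>expectation (\<lambda>\<omega>. g ((1 / sqrt (v n)) * V n \<omega>)) - (\<integral>x. std_normal_density x * g x \<partial>lborel)\<bar>
          \<le> K * rate \<beta> n / v n powr (3/2)"
        using K(2)[OF n vn lip] by simp
      moreover have "K * rate \<beta> n / v n powr (3/2) \<le> K / min ((v n)\<^sup>2) (v n powr (3/2)) * rate \<beta> n"
      proof -
        have "K / v n powr (3/2) \<le> K / min ((v n)\<^sup>2) (v n powr (3/2))"
          using K(1) vn by (intro divide_left_mono) (auto simp: min_def)
        from mult_right_mono[OF this rate_nonneg[of \<beta> n]] show ?thesis by simp
      qed
      moreover have "\<bar>b\<bar> = sqrt (real n / v n) * \<bar>A n - f\<bar>"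
        using vn by (simp add: b_def abs_mult)
      ultimately show "\<bar>expectation (\<lambda>\<omega>. g (sqrt (real n / v n) * (f_hat X n \<omega> - f)))
          - (\<integral>x. std_normal_density x * g x \<partial>lborel)\<bar>
        \<le> sqrt (real n / v n) * \<bar>A n - f\<bar> + K / min ((v n)\<^sup>2) (v n powr (3/2)) * rate \<beta> n"
        by simp
    qed measurable
  qed
qed

text \<open>If \<open>v n < \<sigma>\<^sup>2 / 2\<close>, the trivial bound \<open>2\<close> is absorbed by the term \<open>\<bar>v n - \<sigma>\<^sup>2\<bar>\<close>.\<close>

lemma normal_approximation_fixed_scale:
  assumes \<sigma>: "\<sigma> > 0"
  obtains C where "C > 0"
    "\<And>n g. n > 1 \<Longrightarrow> (\<And>x y. \<bar>g x - g y\<bar> \<le> \<bar>x - y\<bar>) \<Longrightarrow>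
      \<bar>expectation (\<lambda>\<omega>. g (sqrt (real n) / \<sigma> * (f_hat X n \<omega> - f)))
        - (\<integral>x. std_normal_density x * g x \<partial>lborel)\<bar>
      \<le> C * (sqrt (real n) * \<bar>A n - f\<bar> + \<bar>v n - \<sigma>\<^sup>2\<bar>) + C * rate \<beta> n"
proof -
  obtain K where K: "K > 0"
    "\<And>n g. n > 1 \<Longrightarrow> v n > 0 \<Longrightarrow> (\<And>x y. \<bar>g x - g y\<bar> \<le> \<bar>x - y\<bar>) \<Longrightarrow>
      \<bar>expectation (\<lambda>\<omega>. g (V n \<omega> / sqrt (v n))) - (\<integral>x. std_normal_density x * g x \<partial>lborel)\<bar>
      \<le> K * rate \<beta> n / v n powr (3/2)"
    by (rule normal_approximation_rate) blast
  define K' where "K' = K / (\<sigma>\<^sup>2 / 2) powr (3/2)"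
  have "K' > 0" using K \<sigma> by (simp add: K'_def)
  \<comment> \<open>\<open>1 / \<sigma>\<close> pays for the bias and
    \<open>4 / \<sigma>\<^sup>2\<close> for the trivial bound when \<open>v n\<close> is small.
    Otherwise \<open>1 / \<sigma>\<^sup>2\<close>, which is smaller than the latter, pays for the
    change of scale, and \<open>K'\<close> is the rate constant at
    \<open>v n = \<sigma>\<^sup>2 / 2\<close>.\<close>
  define C where "C = 1 / \<sigma> + 4 / \<sigma>\<^sup>2 + K'"
  have C: "C > 0" "1 / \<sigma> \<le> C" "4 / \<sigma>\<^sup>2 \<le> C" "1 / \<sigma>\<^sup>2 \<le> C" "K' \<le> C"
  proof -
    have "1 / \<sigma> > 0" "4 / \<sigma>\<^sup>2 > 0" "1 / \<sigma>\<^sup>2 \<le> 4 / \<sigma>\<^sup>2"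
      using \<sigma> by (auto intro: divide_right_mono)
    then show "C > 0" "1 / \<sigma> \<le> C" "4 / \<sigma>\<^sup>2 \<le> C" "1 / \<sigma>\<^sup>2 \<le> C" "K' \<le> C"
      using \<open>K' > 0\<close> unfolding C_def by linarith+
  qed
  show ?thesis
  proof (rule that[OF C(1)])
    fix n :: nat and g :: "real \<Rightarrow> real"
    assume n: "n > 1" and lip: "\<And>x y. \<bar>g x - g y\<bar> \<le> \<bar>x - y\<bar>"
    define b where "b = sqrt (real n) / \<sigma> * (A n - f)"
    define Y where "Y = (\<lambda>\<omega>. 1 / \<sigma> * V n \<omega> + b)"
    define c where "c = (\<integral>x. std_normal_density x * g x \<partial>lborel)"
    have Y: "sqrt (real n) / \<sigma> * (f_hat X n \<omega> - f) = Y \<omega>" for \<omega>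
      using n \<sigma> by (simp add: f_hat_eq b_def Y_def field_simps)
    have v_nonneg: "v n \<ge> 0" by (simp add: var_v_def)
    have b_abs: "\<bar>b\<bar> = 1 / \<sigma> * (sqrt (real n) * \<bar>A n - f\<bar>)"
      using \<sigma> by (simp add: b_def abs_mult)
    have b_le: "\<bar>b\<bar> \<le> C * (sqrt (real n) * \<bar>A n - f\<bar>)"
      unfolding b_abs using C by (intro mult_right_mono) auto
    have rate_C: "0 \<le> C * rate \<beta> n" using C rate_nonneg by simp
    have "\<bar>expectation (\<lambda>\<omega>. g (Y \<omega>)) - c\<bar> \<le> \<bar>b\<bar> + C * \<bar>v n - \<sigma>\<^sup>2\<bar> + C * rate \<beta> n"
    proof (cases "v n < \<sigma>\<^sup>2 / 2")
      case True
      \<comment> \<open>Scale 0 replaces the second variable by the constant 0. Apart from the bias,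
        both \<open>Y\<close> and the normal law are then within 1 of \<open>g 0\<close>, which
        gives the trivial bound 2.\<close>
      have "\<bar>expectation (\<lambda>\<omega>. g (Y \<omega>)) - expectation (\<lambda>\<omega>. g (0 * V n \<omega>))\<bar>
          \<le> \<bar>1 / \<sigma> - 0\<bar> * expectation (\<lambda>\<omega>. \<bar>V n \<omega>\<bar>) + \<bar>b\<bar>"
        unfolding Y_def by (rule lipschitz_affine_difference[OF V_moments(1) lip])
      then have "\<bar>expectation (\<lambda>\<omega>. g (Y \<omega>)) - g 0\<bar> \<le> 1 / \<sigma> * expectation (\<lambda>\<omega>. \<bar>V n \<omega>\<bar>) + \<bar>b\<bar>"
        using \<sigma> by (simp add: prob_space)
      also have "1 / \<sigma> * expectation (\<lambda>\<omega>. \<bar>V n \<omega>\<bar>) \<le> 1 / \<sigma> * \<sigma>"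
      proof (intro mult_left_mono order_trans[OF V_moments(2)] real_le_lsqrt)
        have "\<sigma>\<^sup>2 / 2 \<le> \<sigma>\<^sup>2" by simp
        with True show "v n \<le> \<sigma>\<^sup>2" by linarith
      qed (use \<sigma> in auto)
      also have "1 / \<sigma> * \<sigma> = 1" using \<sigma> by simp
      finally have "\<bar>expectation (\<lambda>\<omega>. g (Y \<omega>)) - g 0\<bar> \<le> 1 + \<bar>b\<bar>" by simp
      moreover have "\<bar>g 0 - c\<bar> \<le> 1"
        using lipschitz_std_normal(2)[OF lip, of 0] by (simp add: c_def)
      moreover have "2 \<le> 4 / \<sigma>\<^sup>2 * \<bar>v n - \<sigma>\<^sup>2\<bar>"
      proof -
        have "\<sigma>\<^sup>2 / 2 \<le> \<bar>v n - \<sigma>\<^sup>2\<bar>" using True by linarith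
        have "2 = 4 / \<sigma>\<^sup>2 * (\<sigma>\<^sup>2 / 2)" using \<sigma> by simp
        also have "\<dots> \<le> 4 / \<sigma>\<^sup>2 * \<bar>v n - \<sigma>\<^sup>2\<bar>" by (intro mult_left_mono) (fact, simp)
        finally show ?thesis .
      qed
      moreover have "4 / \<sigma>\<^sup>2 * \<bar>v n - \<sigma>\<^sup>2\<bar> \<le> C * \<bar>v n - \<sigma>\<^sup>2\<bar>"
        using C by (intro mult_right_mono) auto
      ultimately show ?thesis using rate_C by linarith
    next
      case False
      then have vn: "v n \<ge> \<sigma>\<^sup>2 / 2" by simp
      with \<sigma> have v_pos: "v n > 0" by (smt (verit) half_gt_zero zero_less_power)
      \<comment> \<open>Since \<open>E \<bar>V\<bar> \<le> sqrt (v n)\<close>, the change of scale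
        costs \<open>\<bar>sqrt (v n) - \<sigma>\<bar> / \<sigma>\<close>. Factoring
        \<open>v n - \<sigma>\<^sup>2\<close> and bounding \<open>sqrt (v n) + \<sigma>\<close>
        below by \<open>\<sigma>\<close> makes this linear in
        \<open>\<bar>v n - \<sigma>\<^sup>2\<bar>\<close>.\<close>
      have "\<bar>expectation (\<lambda>\<omega>. g (Y \<omega>)) - expectation (\<lambda>\<omega>. g (1 / sqrt (v n) * V n \<omega>))\<bar>
          \<le> \<bar>1 / \<sigma> - 1 / sqrt (v n)\<bar> * expectation (\<lambda>\<omega>. \<bar>V n \<omega>\<bar>) + \<bar>b\<bar>"
        unfolding Y_def by (rule lipschitz_affine_difference[OF V_moments(1) lip])
      also have "\<bar>1 / \<sigma> - 1 / sqrt (v n)\<bar> * expectation (\<lambda>\<omega>. \<bar>V n \<omega>\<bar>)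
          \<le> \<bar>1 / \<sigma> - 1 / sqrt (v n)\<bar> * sqrt (v n)"
        by (intro mult_left_mono V_moments) auto
      also have "\<bar>1 / \<sigma> - 1 / sqrt (v n)\<bar> * sqrt (v n) = \<bar>(1 / \<sigma> - 1 / sqrt (v n)) * sqrt (v n)\<bar>"
        using v_pos by (simp add: abs_mult)
      also have "(1 / \<sigma> - 1 / sqrt (v n)) * sqrt (v n) = (sqrt (v n) - \<sigma>) / \<sigma>"
        using v_pos \<sigma> by (simp add: field_simps)
      also have "\<bar>(sqrt (v n) - \<sigma>) / \<sigma>\<bar> \<le> 1 / \<sigma>\<^sup>2 * \<bar>v n - \<sigma>\<^sup>2\<bar>"
      proof -
        have "v n - \<sigma>\<^sup>2 = (sqrt (v n) - \<sigma>) * (sqrt (v n) + \<sigma>)"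
          using v_pos by (simp add: power2_eq_square algebra_simps)
        then have "\<bar>v n - \<sigma>\<^sup>2\<bar> = \<bar>sqrt (v n) - \<sigma>\<bar> * (sqrt (v n) + \<sigma>)"
          using v_pos \<sigma> by (simp add: abs_mult)
        also have "\<dots> \<ge> \<bar>sqrt (v n) - \<sigma>\<bar> * \<sigma>"
          using v_pos by (intro mult_left_mono) auto
        finally have "\<bar>sqrt (v n) - \<sigma>\<bar> * \<sigma> / \<sigma>\<^sup>2 \<le> \<bar>v n - \<sigma>\<^sup>2\<bar> / \<sigma>\<^sup>2"
          by (intro divide_right_mono) auto
        then show ?thesis using \<sigma> by (simp add: abs_divide power2_eq_square)
      qed
      also have "1 / \<sigma>\<^sup>2 * \<bar>v n - \<sigma>\<^sup>2\<bar> \<le> C * \<bar>v n - \<sigma>\<^sup>2\<bar>"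
        using C by (intro mult_right_mono) auto
      finally have 1: "\<bar>expectation (\<lambda>\<omega>. g (Y \<omega>)) - expectation (\<lambda>\<omega>. g (V n \<omega> / sqrt (v n)))\<bar>
          \<le> C * \<bar>v n - \<sigma>\<^sup>2\<bar> + \<bar>b\<bar>" by simp
      have "\<bar>expectation (\<lambda>\<omega>. g (V n \<omega> / sqrt (v n))) - c\<bar> \<le> K * rate \<beta> n / v n powr (3/2)"
        unfolding c_def by (rule K(2)[OF n v_pos lip])
      also have "\<dots> \<le> K * rate \<beta> n / (\<sigma>\<^sup>2 / 2) powr (3/2)"
        using vn \<sigma> K(1) rate_nonneg[of \<beta> n] v_pos
        by (intro divide_left_mono powr_mono2 mult_nonneg_nonneg) auto
      also have "\<dots> = K' * rate \<beta> n" by (simp add: K'_def)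
      also have "\<dots> \<le> C * rate \<beta> n"
        using C rate_nonneg by (intro mult_right_mono) auto
      finally show ?thesis using 1 by linarith
    qed
    then show "\<bar>expectation (\<lambda>\<omega>. g (sqrt (real n) / \<sigma> * (f_hat X n \<omega> - f)))
        - (\<integral>x. std_normal_density x * g x \<partial>lborel)\<bar>
      \<le> C * (sqrt (real n) * \<bar>A n - f\<bar> + \<bar>v n - \<sigma>\<^sup>2\<bar>) + C * rate \<beta> n"
      using b_le unfolding Y c_def by (simp add: distrib_left)
  qed
qed

text \<open>Convergence against continuous steps suffices for weak convergence. These steps are
  Lipschitz, so the bound for a fixed scale applies to them, and each of its terms tends to
  0.\<close>

lemma weak_convergence_f_hat:
  assumes \<sigma>: "\<sigma> > 0" and \<beta>': "\<beta> > 1/2" and v_lim: "v \<longlonglongrightarrow> \<sigma>\<^sup>2"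
    and A_lim: "(\<lambda>n. sqrt (real n) * \<bar>A n - f\<bar>) \<longlonglongrightarrow> 0"
  shows "weak_conv_m (\<lambda>n. distr M borel (\<lambda>\<omega>. sqrt (real n) * (f_hat X n \<omega> - f)))
    (density lborel (normal_density 0 \<sigma>))"
proof -
  obtain C where C: "C > 0"
    "\<And>n g. n > 1 \<Longrightarrow> (\<And>x y. \<bar>g x - g y\<bar> \<le> \<bar>x - y\<bar>) \<Longrightarrow>
      \<bar>expectation (\<lambda>\<omega>. g (sqrt (real n) / \<sigma> * (f_hat X n \<omega> - f)))
        - (\<integral>x. std_normal_density x * g x \<partial>lborel)\<bar>
      \<le> C * (sqrt (real n) * \<bar>A n - f\<bar> + \<bar>v n - \<sigma>\<^sup>2\<bar>) + C * rate \<beta> n"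
    by (rule normal_approximation_fixed_scale[OF \<sigma>]) blast
  define B where "B = (\<lambda>n. C * (sqrt (real n) * \<bar>A n - f\<bar> + \<bar>v n - \<sigma>\<^sup>2\<bar>) + C * rate \<beta> n)"
  have "(\<lambda>n. \<bar>v n - \<sigma>\<^sup>2\<bar>) \<longlonglongrightarrow> 0"
    using tendsto_rabs_zero[OF LIM_zero[OF v_lim]] .
  then have "B \<longlonglongrightarrow> C * (0 + 0) + C * 0"
    unfolding B_def by (intro tendsto_intros A_lim rate_tendsto_0[OF \<beta>'])
  then have B: "B \<longlonglongrightarrow> 0" by simp
  show ?thesis
  proof (rule integral_cts_step_conv_imp_weak_conv)
    show "real_distribution (distr M borel (\<lambda>\<omega>. sqrt (real n) * (f_hat X n \<omega> - f)))" for n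
      by (rule real_distribution_distr) measurable
    show "real_distribution (density lborel (normal_density 0 \<sigma>))"
      using prob_space_normal_density[OF \<sigma>]
      by (simp add: real_distribution_def real_distribution_axioms_def)
    fix a b :: real assume ab: "a < b"
    \<comment> \<open>\<open>\<kappa>\<close> is the Lipschitz constant of the step after its
      argument is multiplied by \<open>\<sigma>\<close>; dividing by it gives an admissible test
      function for the standardized variable.\<close>
    define \<kappa> where "\<kappa> = \<sigma> / (b - a)"
    have "\<kappa> > 0" using \<sigma> ab by (simp add: \<kappa>_def)
    define g where "g = (\<lambda>x. cts_step a b (\<sigma> * x) / \<kappa>)"
    have [measurable]: "cts_step a b \<in> borel_measurable borel"
      by (auto simp: cts_step_def[abs_def])
    have lip: "\<bar>g x - g y\<bar> \<le> \<bar>x - y\<bar>" for x y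
    proof -
      have "\<bar>g x - g y\<bar> = \<bar>cts_step a b (\<sigma> * x) - cts_step a b (\<sigma> * y)\<bar> / \<kappa>"
        using \<open>\<kappa> > 0\<close> by (simp add: g_def diff_divide_distrib[symmetric] abs_divide)
      also have "\<dots> \<le> (\<bar>\<sigma> * x - \<sigma> * y\<bar> / (b - a)) / \<kappa>"
        using \<open>\<kappa> > 0\<close> by (intro divide_right_mono cts_step_lipschitz ab) auto
      also have "\<dots> = \<bar>x - y\<bar>"
        using \<sigma> ab by (simp add: \<kappa>_def right_diff_distrib[symmetric] abs_mult)
      finally show ?thesis .
    qed
    define m where "m = (\<lambda>n. \<integral>x. cts_step a b x \<partial>distr M borel (\<lambda>\<omega>. sqrt (real n) * (f_hat X n \<omega> - f)))"
    define m' where "m' = (\<integral>x. cts_step a b x \<partial>density lborel (normal_density 0 \<sigma>))"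
    have m: "m n = \<kappa> * expectation (\<lambda>\<omega>. g (sqrt (real n) / \<sigma> * (f_hat X n \<omega> - f)))" for n
      using \<sigma> \<open>\<kappa> > 0\<close> by (simp add: m_def integral_distr g_def)
    have m': "m' = \<kappa> * (\<integral>x. std_normal_density x * g x \<partial>lborel)"
      using \<open>\<kappa> > 0\<close> by (simp add: m'_def integral_normal_scale[OF \<sigma>] g_def)
    have "\<bar>m n - m'\<bar> \<le> \<kappa> * B n" if "n > 1" for n
      using C(2)[OF that lip] \<open>\<kappa> > 0\<close>
      by (simp add: m m' right_diff_distrib[symmetric] abs_mult B_def)
    then have "\<forall>\<^sub>F n in sequentially. norm (m n - m') \<le> \<kappa> * B n"
      by (auto intro: eventually_mono[OF eventually_gt_at_top[of 1]])
    moreover have "(\<lambda>n. \<kappa> * B n) \<longlonglongrightarrow> 0"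
      using B by (rule tendsto_mult_right_zero)
    ultimately have "(\<lambda>n. m n - m') \<longlonglongrightarrow> 0" by (rule Lim_null_comparison)
    then show "(\<lambda>n. \<integral>x. cts_step a b x \<partial>distr M borel (\<lambda>\<omega>. sqrt (real n) * (f_hat X n \<omega> - f)))
        \<longlonglongrightarrow> (\<integral>x. cts_step a b x \<partial>density lborel (normal_density 0 \<sigma>))"
      by (simp add: LIM_zero_iff m_def m'_def)
  qed
qed

end

end

theorem theorem6:
  fixes M :: "'w measure"
    and G :: "real \<Rightarrow> 'w \<Rightarrow> real"
    and e :: "real \<Rightarrow> 'h :: {real_inner, complete_space}"
    and I\<^sub>1 :: "'h \<Rightarrow> 'w \<Rightarrow> real"
    and h :: "nat \<Rightarrow> 'h"
    and X :: "nat \<Rightarrow> 'w \<Rightarrow> real"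
    and f C\<^sub>0 :: real
    and \<rho> :: "real \<Rightarrow> real"
  assumes "prob_space M"
    and "centered_gaussian_process M {0..} G"
    and "associated_hilbert_space M G e"
    and "wiener_integral M G e I\<^sub>1"
    and "\<And>n. X n = I\<^sub>1 (h n)"
    and "(\<lambda>n. \<integral>\<omega>. (X n \<omega>)\<^sup>2 \<partial>M) \<longlonglongrightarrow> f"
    and "\<And>t. \<rho> (- t) = \<rho> t"
    and "\<And>t. \<rho> t > 0"
    and "\<rho> 0 = 1"
    and "C\<^sub>0 > 0"
    and "\<And>t s. \<bar>\<integral>\<omega>. X t \<omega> * X s \<omega> \<partial>M\<bar> \<le> C\<^sub>0 * \<rho> \<bar>real t - real s\<bar>"
  shows
    "(\<forall>\<beta>\<ge>1/2. \<rho> \<in> O[at_infinity](\<lambda>t. \<bar>t\<bar> powr (-\<beta>)) \<longrightarrow>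
        (\<exists>C>0. \<forall>n>1. var_v M X n > 0 \<longrightarrow>
           wasserstein
             (distr M borel (\<lambda>\<omega>. sqrt (real n / var_v M X n) * (f_hat X n \<omega> - f)))
             (density lborel (normal_density 0 1))
           \<le> ereal (sqrt (real n / var_v M X n) * \<bar>mean_A M X n - f\<bar>
               + C / min ((var_v M X n)\<^sup>2) (var_v M X n powr (3/2)) * rate \<beta> n)))
     \<and> (\<forall>\<beta>>1/2. \<forall>\<sigma>>0. \<rho> \<in> O[at_infinity](\<lambda>t. \<bar>t\<bar> powr (-\<beta>)) \<longrightarrow>
        var_v M X \<longlonglongrightarrow> \<sigma>\<^sup>2 \<longrightarrow>
        (\<exists>C>0. \<forall>n>1.
           wasserstein
             (distr M borel (\<lambda>\<omega>. sqrt (real n) / \<sigma> * (f_hat X n \<omega> - f)))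
             (density lborel (normal_density 0 1))
           \<le> ereal (C * (sqrt (real n) * \<bar>mean_A M X n - f\<bar> + \<bar>var_v M X n - \<sigma>\<^sup>2\<bar>)
               + C * rate \<beta> n)))
     \<and> (\<forall>\<sigma>>0. var_v M X \<longlonglongrightarrow> \<sigma>\<^sup>2 \<longrightarrow>
        (\<lambda>n. sqrt (real n) * \<bar>mean_A M X n - f\<bar>) \<longlonglongrightarrow> 0 \<longrightarrow>
        (\<exists>\<beta>>1/2. \<rho> \<in> O[at_infinity](\<lambda>t. \<bar>t\<bar> powr (-\<beta>))) \<longrightarrow>
        weak_conv_m
          (\<lambda>n. distr M borel (\<lambda>\<omega>. sqrt (real n) * (f_hat X n \<omega> - f)))
          (density lborel (normal_density 0 \<sigma>)))"
proof -
  interpret prob_space M by fact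
  interpret wiener_sequence M G e I\<^sub>1 h X
    by unfold_locales (use assms in auto)
  note setting = assms(8-11)
  show ?thesis
  proof (intro conjI allI impI)
    fix \<beta> :: real
    assume \<beta>: "1/2 \<le> \<beta>" and O: "\<rho> \<in> O[at_infinity](\<lambda>t. \<bar>t\<bar> powr (-\<beta>))"
    show "\<exists>C>0. \<forall>n>1. var_v M X n > 0 \<longrightarrow>
           wasserstein
             (distr M borel (\<lambda>\<omega>. sqrt (real n / var_v M X n) * (f_hat X n \<omega> - f)))
             (density lborel (normal_density 0 1))
           \<le> ereal (sqrt (real n / var_v M X n) * \<bar>mean_A M X n - f\<bar>
               + C / min ((var_v M X n)\<^sup>2) (var_v M X n powr (3/2)) * rate \<beta> n)"
      by (rule wasserstein_self_normalized[OF setting O \<beta>, of f]) blast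
  next
    fix \<beta> \<sigma> :: real
    assume \<beta>: "1/2 < \<beta>" and \<sigma>: "0 < \<sigma>" and O: "\<rho> \<in> O[at_infinity](\<lambda>t. \<bar>t\<bar> powr (-\<beta>))"
    obtain C where C: "C > 0"
      "\<And>n g. n > 1 \<Longrightarrow> (\<And>x y. \<bar>g x - g y\<bar> \<le> \<bar>x - y\<bar>) \<Longrightarrow>
        \<bar>expectation (\<lambda>\<omega>. g (sqrt (real n) / \<sigma> * (f_hat X n \<omega> - f)))
          - (\<integral>x. std_normal_density x * g x \<partial>lborel)\<bar>
        \<le> C * (sqrt (real n) * \<bar>A n - f\<bar> + \<bar>v n - \<sigma>\<^sup>2\<bar>) + C * rate \<beta> n"
      by (rule normal_approximation_fixed_scale[OF setting O less_imp_le[OF \<beta>] \<sigma>, of f]) blast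
    show "\<exists>C>0. \<forall>n>1.
           wasserstein
             (distr M borel (\<lambda>\<omega>. sqrt (real n) / \<sigma> * (f_hat X n \<omega> - f)))
             (density lborel (normal_density 0 1))
           \<le> ereal (C * (sqrt (real n) * \<bar>mean_A M X n - f\<bar> + \<bar>var_v M X n - \<sigma>\<^sup>2\<bar>)
               + C * rate \<beta> n)"
      by (intro exI[of _ C] conjI allI impI wasserstein_std_normal_le C) measurable
  next
    fix \<sigma> :: real
    assume "0 < \<sigma>" "v \<longlonglongrightarrow> \<sigma>\<^sup>2" "(\<lambda>n. sqrt (real n) * \<bar>A n - f\<bar>) \<longlonglongrightarrow> 0"
      and "\<exists>\<beta>>1/2. \<rho> \<in> O[at_infinity](\<lambda>t. \<bar>t\<bar> powr (-\<beta>))"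
    then show "weak_conv_m
          (\<lambda>n. distr M borel (\<lambda>\<omega>. sqrt (real n) * (f_hat X n \<omega> - f)))
          (density lborel (normal_density 0 \<sigma>))"
      using weak_convergence_f_hat[OF setting] less_imp_le by blast
  qed
qed

end
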